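(* Let $U\subset\mathbb{R}^n$ be open and $m$ a positive Radon measure on $U$ with $\mathrm{supp}[m]=U$. Let $(A,D(A))$ be the generator of a strongly continuous contraction semigroup on $L^2(U;m)$ such that $A$ is a Dirichlet operator, and assume $C_0^\infty(U)\subset D(A)\cap D(\hat A)$, where $(\hat A,D(\hat A))$ is the co-generator (the adjoint of $A$). Let $J$ and $K$ be the jumping and killing measures of the bilinear form $\mathcal{E}(u,v):=(-Au,v)$, $u,v\in C_0^\infty(U)$. Let $\delta>0$ be such that $U^\delta\neq\emptyset$. Then there exist signed Radon measures $\{\nu_{ij}\}_{i,j=1}^n$ on $U$ such that for every compact $F\subset U$, $\nu_{ij}(F)=\nu_{ji}(F)$ and $\sum_{i,j=1}^n\xi_i\xi_j\nu_{ij}(F)\ge 0$ for all $(\xi_1,\dots,\xi_n)\in\mathbb{R}^n$, and signed Radon measures $\{\nu^\delta_i\}_{i=1}^n$ on $U^\delta$, such that for all $u,v\in C_0^\infty(U^\delta)$, \begin{align*} (-Au,v)&=\frac12\sum_{i,j=1}^n\int_U\frac{\partial u}{\partial x_i}\frac{\partial v}{\partial x_j}\,\nu_{ij}(dx)+\sum_{i=1}^n\int_{U^\delta}\frac{\partial u}{\partial x_i}(x)v(x)\,\nu^\delta_i(dx)\\ &\quad+\int_{U\times U\setminus d}\sum_{i=1}^n(y_i-x_i)\Big(\frac{\partial u}{\partial y_i}(y)v(y)-\frac{\partial u}{\partial x_i}(x)v(x)\Big)I_{\{|x-y|\le\delta\}}(x,y)\,J(dxdy)\\ &\quad+\int_{U\times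 U\setminus d}2\Big(u(y)-u(x)-\sum_{i=1}^n(y_i-x_i)\frac{\partial u}{\partial y_i}(y)I_{\{|x-y|\le\delta\}}(x,y)\Big)v(y)\,J(dxdy)\\ &\quad+\int_U u(x)v(x)\,K(dx). \end{align*}
   Context: $(\cdot,\cdot)$ is the inner product of $L^2(U;m)$, $d$ the diagonal of $U\times U$. An operator $A$ on $L^2(U;m)$ is a Dirichlet operator if $(Au,(u-1)\vee 0)\le 0$ for all $u\in D(A)$ (equivalently the semigroup is sub-Markovian). The jumping measure $J$ (a positive Radon measure on $U\times U\setminus d$) and killing measure $K$ (a positive Radon measure on $U$) are the unique such measures satisfying $\mathcal{E}(u,v)=\int_{U\times U\setminus d}2(u(y)-u(x))v(y)J(dxdy)+\int_U u(x)v(x)K(dx)$ for all $v\in C_0^\infty(U)$ and all $u\in C_0^\infty(U)$ that are constant on a neighbourhood of $\mathrm{supp}[v]$. For $\delta>0$, $U^\delta:=\{x\in U:\inf_{y\in\partial U}|x-y|>\delta\}$, where $\partial U$ is the boundary of $U$ in $\mathbb{R}^n$. *)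

theory Defs
  imports "HOL-Analysis.Analysis"
begin

definition pd :: "'n::finite \<Rightarrow> (real^'n \<Rightarrow> real) \<Rightarrow> real^'n \<Rightarrow> real" where
  "pd i u x = deriv (\<lambda>t. u (x + t *\<^sub>R axis i 1)) 0"

coinductive smooth :: "(real^'n::finite \<Rightarrow> real) \<Rightarrow> bool" where
  "\<lbrakk>\<forall>x. u differentiable (at x); \<forall>i. smooth (pd i u)\<rbrakk> \<Longrightarrow> smooth u"

definition tsupp :: "(real^'n::finite \<Rightarrow> real) \<Rightarrow> (real^'n) set" where
  "tsupp u = closure {x. u x \<noteq> 0}"

definition C0inf :: "(real^'n::finite) set \<Rightarrow> (real^'n \<Rightarrow> real) set" where
  "C0inf S = {u. smooth u \<and> compact (tsupp u) \<and> tsupp u \<subseteq> S}"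

text \<open>U^delta; the infimum over an empty boundary is +infinity.\<close>
definition Udelta :: "(real^'n::finite) set \<Rightarrow> real \<Rightarrow> (real^'n) set" where
  "Udelta U \<delta> = {x \<in> U. frontier U = {} \<or> infdist x (frontier U) > \<delta>}"

definition radon_on :: "'a::topological_space set \<Rightarrow> 'a measure \<Rightarrow> bool" where
  "radon_on S \<mu> \<longleftrightarrow> sets \<mu> = sets borel \<and> emeasure \<mu> (- S) = 0 \<and>
     (\<forall>F. compact F \<and> F \<subseteq> S \<longrightarrow> emeasure \<mu> F < \<infinity>)"

text \<open>Signed Radon measure on S, represented by a (local Jordan) decomposition
  into two positive Radon measures.\<close>
definition signed_radon_on :: "'a::topological_space set \<Rightarrow> 'a measure \<times> 'a measure \<Rightarrow> bool" where
  "signed_radon_on S \<nu> \<longleftrightarrow> radon_on S (fst \<nu>) \<and> radon_on S (snd \<nu>)"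

definition sval :: "'a measure \<times> 'a measure \<Rightarrow> 'a set \<Rightarrow> real" where
  "sval \<nu> F = measure (fst \<nu>) F - measure (snd \<nu>) F"

definition sintegrable :: "'a measure \<times> 'a measure \<Rightarrow> ('a \<Rightarrow> real) \<Rightarrow> bool" where
  "sintegrable \<nu> f \<longleftrightarrow> integrable (fst \<nu>) f \<and> integrable (snd \<nu>) f"

definition sint :: "'a measure \<times> 'a measure \<Rightarrow> ('a \<Rightarrow> real) \<Rightarrow> real" where
  "sint \<nu> f = (\<integral>x. f x \<partial>fst \<nu>) - (\<integral>x. f x \<partial>snd \<nu>)"

definition full_support_on :: "'a::metric_space set \<Rightarrow> 'a measure \<Rightarrow> bool" where
  "full_support_on U m \<longleftrightarrow> (\<forall>x\<in>U. \<forall>e>0. emeasure m (ball x e \<inter> U) > 0)"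

definition L2 :: "'a measure \<Rightarrow> ('a \<Rightarrow> real) set" where
  "L2 m = {f. f \<in> borel_measurable m \<and> integrable m (\<lambda>x. (f x)\<^sup>2)}"

definition l2_inner :: "'a measure \<Rightarrow> ('a \<Rightarrow> real) \<Rightarrow> ('a \<Rightarrow> real) \<Rightarrow> real" where
  "l2_inner m f g = (\<integral>x. f x * g x \<partial>m)"

definition l2_norm :: "'a measure \<Rightarrow> ('a \<Rightarrow> real) \<Rightarrow> real" where
  "l2_norm m f = sqrt (\<integral>x. (f x)\<^sup>2 \<partial>m)"

definition sc_contraction_semigroup :: "'a measure \<Rightarrow> (real \<Rightarrow> ('a \<Rightarrow> real) \<Rightarrow> ('a \<Rightarrow> real)) \<Rightarrow> bool" where
  "sc_contraction_semigroup m T \<longleftrightarrow>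
     (\<forall>t\<ge>0. \<forall>f\<in>L2 m. T t f \<in> L2 m) \<and>
     (\<forall>t\<ge>0. \<forall>f\<in>L2 m. \<forall>g\<in>L2 m. (AE x in m. f x = g x) \<longrightarrow> (AE x in m. T t f x = T t g x)) \<and>
     (\<forall>t\<ge>0. \<forall>f\<in>L2 m. \<forall>g\<in>L2 m. \<forall>a b. AE x in m. T t (\<lambda>y. a * f y + b * g y) x = a * T t f x + b * T t g x) \<and>
     (\<forall>f\<in>L2 m. AE x in m. T 0 f x = f x) \<and>
     (\<forall>s\<ge>0. \<forall>t\<ge>0. \<forall>f\<in>L2 m. AE x in m. T (s + t) f x = T s (T t f) x) \<and>
     (\<forall>t\<ge>0. \<forall>f\<in>L2 m. l2_norm m (T t f) \<le> l2_norm m f) \<and>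
     (\<forall>f\<in>L2 m. ((\<lambda>t. l2_norm m (\<lambda>x. T t f x - f x)) \<longlongrightarrow> 0) (at_right 0))"

definition is_generator :: "'a measure \<Rightarrow> (real \<Rightarrow> ('a \<Rightarrow> real) \<Rightarrow> ('a \<Rightarrow> real)) \<Rightarrow>
    (('a \<Rightarrow> real) \<Rightarrow> ('a \<Rightarrow> real)) \<Rightarrow> ('a \<Rightarrow> real) set \<Rightarrow> bool" where
  "is_generator m T A DA \<longleftrightarrow>
     DA = {f \<in> L2 m. \<exists>g\<in>L2 m.
            ((\<lambda>t. l2_norm m (\<lambda>x. (T t f x - f x) / t - g x)) \<longlongrightarrow> 0) (at_right 0)} \<and>
     (\<forall>f\<in>DA. A f \<in> L2 m \<and>
        ((\<lambda>t. l2_norm m (\<lambda>x. (T t f x - f x) / t - A f x)) \<longlongrightarrow> 0) (at_right 0))"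

definition adjoint_domain :: "'a measure \<Rightarrow> (('a \<Rightarrow> real) \<Rightarrow> ('a \<Rightarrow> real)) \<Rightarrow> ('a \<Rightarrow> real) set \<Rightarrow> ('a \<Rightarrow> real) set" where
  "adjoint_domain m A DA = {v \<in> L2 m. \<exists>w\<in>L2 m. \<forall>u\<in>DA. l2_inner m (A u) v = l2_inner m u w}"

definition dirichlet_operator :: "'a measure \<Rightarrow> (('a \<Rightarrow> real) \<Rightarrow> ('a \<Rightarrow> real)) \<Rightarrow> ('a \<Rightarrow> real) set \<Rightarrow> bool" where
  "dirichlet_operator m A DA \<longleftrightarrow> (\<forall>u\<in>DA. l2_inner m (A u) (\<lambda>x. max (u x - 1) 0) \<le> 0)"

definition offdiag :: "'a set \<Rightarrow> ('a \<times> 'a) set" where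
  "offdiag U = U \<times> U - {(x, y). x = y}"

definition jump_kill :: "(real^'n::finite) set \<Rightarrow> ((real^'n \<Rightarrow> real) \<Rightarrow> (real^'n \<Rightarrow> real) \<Rightarrow> real) \<Rightarrow>
    ((real^'n) \<times> (real^'n)) measure \<Rightarrow> (real^'n) measure \<Rightarrow> bool" where
  "jump_kill U E J K \<longleftrightarrow> radon_on (offdiag U) J \<and> radon_on U K \<and>
     (\<forall>u\<in>C0inf U. \<forall>v\<in>C0inf U.
        (\<exists>N c. open N \<and> tsupp v \<subseteq> N \<and> (\<forall>x\<in>N. u x = c)) \<longrightarrow>
          integrable J (\<lambda>(x, y). 2 * (u y - u x) * v y) \<and>
          integrable K (\<lambda>x. u x * v x) \<and>
          E u v = (\<integral>(x, y). 2 * (u y - u x) * v y \<partial>J) + (\<integral>x. u x * v x \<partial>K))"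

end

theory Submission
  imports Defs "HOL-Computational_Algebra.Polynomial"
begin

text \<open>
  No Riesz representation is needed, because every measure in the formula is locally a density
  with respect to \<open>m\<close> plus marginals of \<open>J\<close>. Write \<open>L(S)\<close> for the operator \<open>A\<close> acting on the first
  variable of a finite sum \<open>S(x, y)\<close> of products, restricted to the diagonal. Since the semigroup
  preserves positivity, \<open>L(S)\<close> is nonnegative whenever \<open>S \<ge> 0\<close> vanishes on the diagonal, and
  by the definition of \<open>J\<close> it equals \<open>2 \<integral> S(x, \<cdot>) J(dx, \<cdot>)\<close> whenever \<open>S\<close> vanishes near the diagonal.
  Cutting off the diagonal shows that \<open>J\<close> integrates \<open>|x - y|\<^sup>2\<close> locally, that the difference of
  the two sides is a nonnegative measure for \<open>S \<ge> 0\<close>, and that it is zero for \<open>S = o(|x - y|\<^sup>2)\<close>. The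
  difference for \<open>S = (x\<^sub>i - y\<^sub>i)(x\<^sub>j - y\<^sub>j)\<close> is \<open>\<nu>\<^sub>i\<^sub>j\<close>, and the Taylor remainder of \<open>u\<close> of order three gives
  the formula up to the first-order terms. These are measures because \<open>\<Sum>\<^sub>j \<integral> \<partial>\<^sub>j w d\<nu>\<^sub>i\<^sub>j\<close> can be
  computed from \<open>S = (w(x) - w(y))(x\<^sub>i - y\<^sub>i)\<close>, where the adjoint of \<open>A\<close> removes \<open>A\<close> from \<open>w\<close>.
\<close>

section \<open>Smooth functions and cutoffs\<close>

text \<open>Coordinates and constants are not in the domain of \<open>A\<close>, so every polynomial
  in the first variable carries a cutoff \<open>\<kappa>\<close> that is one near the tested points
  \<open>y\<close>. Two such cutoffs give tensors that differ only away from the diagonal, where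
  \<open>J\<close> describes \<open>A\<close> exactly, so the compensated functionals are
  independent of the choice. Only the constant Taylor term meets \<open>K\<close>: there
  \<open>\<kappa>\<close> plays the part of the function that is constant near the support in the
  definition of \<open>J\<close> and \<open>K\<close>. Finite sums of products are used because
  \<open>A a\<close> is determined only up to a null set: the value of \<open>A\<close> on
  S(\<cdot>, p) can be taken at p = y when \<open>p\<close> enters through coefficients. The set
  U^\<delta> enters with the first-order terms. \<open>J\<close> controls |x - y|^2 but need not
  control |x - y|, so long jumps are separated from short ones, and the closed
  \<delta>-neighbourhood of a compact subset of U^\<delta> is compact in U. Hence one pair of
  cutoffs is one at both ends of every short jump that touches the support of
  \<open>w\<close>.\<close>

lemma smooth_differentiable: "smooth u \<Longrightarrow> u differentiable (at x)"
  by (erule smooth.cases) auto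

lemma smooth_pd: "smooth u \<Longrightarrow> smooth (pd i u)"
  by (erule smooth.cases) auto

lemma smooth_continuous_on: "smooth u \<Longrightarrow> continuous_on S u"
  by (meson differentiable_imp_continuous_on differentiable_on_def
      differentiable_at_withinI smooth_differentiable)

lemma smooth_measurable: "smooth u \<Longrightarrow> u \<in> borel_measurable borel"
  by (intro borel_measurable_continuous_onI smooth_continuous_on)

lemma has_derivative_imp_line_derivative:
  fixes u :: "real^'n::finite \<Rightarrow> real"
  assumes "(u has_derivative D) (at (x + t *\<^sub>R h))"
  shows "((\<lambda>t. u (x + t *\<^sub>R h)) has_real_derivative D h) (at t)"
proof -
  interpret D: bounded_linear D using assms by (rule has_derivative_bounded_linear)
  have "((\<lambda>t. x + t *\<^sub>R h) has_derivative (\<lambda>s. s *\<^sub>R h)) (at t)"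
    by (auto intro!: derivative_eq_intros)
  from has_derivative_compose[OF this assms]
  moreover have "(\<lambda>s. s * D h) = (*) (D h)" by (simp add: fun_eq_iff)
  ultimately show ?thesis by (simp add: has_field_derivative_def D.scaleR)
qed

lemma pd_eq_derivative:
  assumes "(u has_derivative D) (at x)"
  shows "pd i u x = D (axis i 1)"
  unfolding pd_def using has_derivative_imp_line_derivative[of u D x 0 "axis i 1"] assms
  by (intro DERIV_imp_deriv) simp

lemma derivative_eq_sum_pd:
  fixes u :: "real^'n::finite \<Rightarrow> real"
  assumes "(u has_derivative D) (at x)"
  shows "D h = (\<Sum>i\<in>UNIV. h $ i * pd i u x)"
proof -
  interpret D: bounded_linear D using assms by (rule has_derivative_bounded_linear)
  have "D h = D (\<Sum>i\<in>UNIV. (h $ i) *\<^sub>R axis i 1)"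
    using basis_expansion[of h] by (simp add: scalar_mult_eq_scaleR)
  also have "\<dots> = (\<Sum>i\<in>UNIV. h $ i * D (axis i 1))"
    by (simp add: D.sum D.scaleR)
  finally show ?thesis using pd_eq_derivative[OF assms] by simp
qed

lemma smooth_line_derivative:
  fixes u :: "real^'n::finite \<Rightarrow> real"
  assumes "smooth u"
  shows "((\<lambda>t. u (x + t *\<^sub>R h)) has_real_derivative (\<Sum>i\<in>UNIV. h $ i * pd i u (x + t *\<^sub>R h))) (at t)"
proof -
  obtain D where D: "(u has_derivative D) (at (x + t *\<^sub>R h))"
    using smooth_differentiable[OF assms] unfolding differentiable_def by blast
  show ?thesis
    using has_derivative_imp_line_derivative[OF D] derivative_eq_sum_pd[OF D] by simp
qed

lemma pd_const [simp]: "pd i (\<lambda>x. c) = (\<lambda>x. 0)"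
  by (auto simp: fun_eq_iff pd_def)

lemma pd_eqI: "(u has_derivative D) (at x) \<Longrightarrow> D (axis i 1) = c \<Longrightarrow> pd i u x = c"
  using pd_eq_derivative by blast

lemma pd_add:
  assumes "u differentiable (at x)" "v differentiable (at x)"
  shows "pd i (\<lambda>x. u x + v x) x = pd i u x + pd i v x"
proof -
  obtain D E where D: "(u has_derivative D) (at x)" "(v has_derivative E) (at x)"
    using assms unfolding differentiable_def by blast
  show ?thesis using pd_eq_derivative[OF D(1)] pd_eq_derivative[OF D(2)]
    by (intro pd_eqI[OF has_derivative_add[OF D]]) simp
qed

lemma pd_mult:
  assumes "u differentiable (at x)" "v differentiable (at x)"
  shows "pd i (\<lambda>x. u x * v x) x = u x * pd i v x + pd i u x * v x"
proof -
  obtain D E where D: "(u has_derivative D) (at x)" "(v has_derivative E) (at x)"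
    using assms unfolding differentiable_def by blast
  show ?thesis using pd_eq_derivative[OF D(1)] pd_eq_derivative[OF D(2)]
    by (intro pd_eqI[OF has_derivative_mult[OF D]]) simp
qed

lemma smooth_const [intro, simp]: "smooth (\<lambda>x::real^'n::finite. c)"
proof -
  have "smooth u" if "\<exists>c. u = (\<lambda>x. c)" for u :: "real^'n \<Rightarrow> real"
    using that by (coinduction arbitrary: u) auto
  thus ?thesis by blast
qed

text \<open>Coinduction with the set of all sums of two smooth functions, which is closed under
  \<open>pd\<close> because \<open>pd\<close> is additive.\<close>

lemma smooth_add [intro]:
  fixes u v :: "real^'n::finite \<Rightarrow> real"
  assumes "smooth u" "smooth v" shows "smooth (\<lambda>x. u x + v x)"
proof -
  have "smooth w" if "\<exists>u v. smooth u \<and> smooth v \<and> w = (\<lambda>x. u x + v x)" for w :: "real^'n \<Rightarrow> real"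
    using that
  proof (coinduction arbitrary: w)
    case (smooth w)
    then obtain u v where uv: "smooth u" "smooth v" "w = (\<lambda>x. u x + v x)" by blast
    have "pd i w = (\<lambda>x. pd i u x + pd i v x)" for i
      unfolding uv(3) by (intro ext pd_add smooth_differentiable uv)
    moreover have "w differentiable (at x)" for x
      unfolding uv(3) by (intro differentiable_add smooth_differentiable uv)
    ultimately show ?case using uv smooth_pd by blast
  qed
  thus ?thesis using assms by blast
qed

text \<open>The Leibniz rule turns one product into a sum of two, so single products are not a
  coinduction invariant; their closure under addition is one.\<close>

inductive sums_of_products :: "(real^'n::finite \<Rightarrow> real) \<Rightarrow> bool" where
  prod: "smooth u \<Longrightarrow> smooth v \<Longrightarrow> sums_of_products (\<lambda>x. u x * v x)"
| add: "sums_of_products u \<Longrightarrow> sums_of_products v \<Longrightarrow> sums_of_products (\<lambda>x. u x + v x)"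

lemma sums_of_products_derivative:
  "sums_of_products w \<Longrightarrow> (\<forall>x. w differentiable (at x)) \<and> (\<forall>i. sums_of_products (pd i w))"
proof (induction rule: sums_of_products.induct)
  case (prod u v)
  have "pd i (\<lambda>x. u x * v x) = (\<lambda>x. u x * pd i v x + pd i u x * v x)" for i
    using prod by (intro ext pd_mult smooth_differentiable)
  moreover have "sums_of_products (\<lambda>x. u x * pd i v x + pd i u x * v x)" for i
    using prod by (intro sums_of_products.add sums_of_products.prod smooth_pd)
  ultimately show ?case using prod by (simp add: differentiable_mult smooth_differentiable)
next
  case (add u v)
  have "pd i (\<lambda>x. u x + v x) = (\<lambda>x. pd i u x + pd i v x)" for i
    using add by (intro ext pd_add) auto
  thus ?case using add by (simp add: differentiable_add sums_of_products.add)
qed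

lemma smooth_mult [intro]:
  fixes u v :: "real^'n::finite \<Rightarrow> real"
  assumes "smooth u" "smooth v" shows "smooth (\<lambda>x. u x * v x)"
proof -
  have "smooth w" if "sums_of_products w" for w :: "real^'n \<Rightarrow> real"
    using that by (coinduction arbitrary: w) (use sums_of_products_derivative in blast)
  thus ?thesis using assms sums_of_products.prod by blast
qed

lemma smooth_minus [intro]: "smooth u \<Longrightarrow> smooth (\<lambda>x. - u x)"
  using smooth_mult[of "\<lambda>x. - 1" u] by simp

lemma smooth_diff [intro]: "smooth u \<Longrightarrow> smooth v \<Longrightarrow> smooth (\<lambda>x. u x - v x)"
  using smooth_add[of u "\<lambda>x. - v x"] smooth_minus[of v] by simp

lemma smooth_sum [intro]:
  "(\<And>k. k \<in> I \<Longrightarrow> smooth (f k)) \<Longrightarrow> smooth (\<lambda>x. \<Sum>k\<in>I. f k x)"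
  by (induction I rule: infinite_finite_induct) auto

lemma smooth_coord [intro]: "smooth (\<lambda>x::real^'n::finite. x $ j)"
proof -
  have lin: "((\<lambda>x::real^'n. x $ j) has_derivative (\<lambda>h. h $ j)) (at x)" for x
    by (intro bounded_linear_imp_has_derivative bounded_linear_vec_nth)
  have "pd i (\<lambda>x::real^'n. x $ j) = (\<lambda>x. axis i 1 $ j)" for i
    by (intro ext pd_eqI[OF lin]) simp
  thus ?thesis using lin by (subst smooth.simps) (auto simp: differentiable_def)
qed

text \<open>The coinduction invariant is the set of all \<open>v x / u x ^ k\<close> with
  \<open>v\<close> smooth: differentiating changes the numerator and raises the exponent by one. The
  reciprocal is the member with v = 1 and k = 1.\<close>

lemma smooth_inverse:
  fixes u :: "real^'n::finite \<Rightarrow> real"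
  assumes "smooth u" "\<And>x. u x > 0" shows "smooth (\<lambda>x. 1 / u x)"
proof -
  have "smooth w" if "\<exists>k v. smooth v \<and> w = (\<lambda>x. v x / u x ^ k)" for w :: "real^'n \<Rightarrow> real"
    using that
  proof (coinduction arbitrary: w)
    case (smooth w)
    then obtain k v where v: "smooth v" "w = (\<lambda>x. v x / u x ^ k)" by blast
    have "(\<exists>D. (w has_derivative D) (at x)) \<and>
        pd i w x = (u x * pd i v x - real k * v x * pd i u x) / u x ^ Suc k" for i x
    proof -
      obtain D E where D: "(u has_derivative D) (at x)" "(v has_derivative E) (at x)"
        using smooth_differentiable[OF assms(1), of x] smooth_differentiable[OF v(1), of x]
        unfolding differentiable_def by blast
      have E: "(w has_derivative (\<lambda>h. (u x * E h - real k * v x * D h) / u x ^ Suc k)) (at x)"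
      proof -
        have "((\<lambda>x. v x / u x ^ k) has_derivative
            (\<lambda>h. (E h * u x ^ k - v x * (real k * D h * u x ^ (k - 1))) / (u x ^ k * u x ^ k))) (at x)"
          using assms(2)[of x] by (intro has_derivative_divide' has_derivative_power D) simp
        moreover have "(E h * u x ^ k - v x * (real k * D h * u x ^ (k - 1))) / (u x ^ k * u x ^ k)
            = (u x * E h - real k * v x * D h) / u x ^ Suc k" for h
        proof (cases k)
          case (Suc j)
          have "(E h * u x ^ k - v x * (real k * D h * u x ^ (k - 1))) / (u x ^ k * u x ^ k)
            = (u x ^ j * (u x * E h - real k * v x * D h)) / (u x ^ j * u x ^ Suc k)"
            by (simp add: Suc algebra_simps)
          thus ?thesis using assms(2)[of x] by simp
        qed (use assms(2)[of x] in simp)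
        ultimately show ?thesis by (simp only: v(2))
      qed
      show ?thesis using pd_eqI[OF E refl] E pd_eq_derivative[OF D(1)] pd_eq_derivative[OF D(2)]
        by auto
    qed
    hence "\<forall>x. w differentiable (at x)" 
      "\<And>i. pd i w = (\<lambda>x. (u x * pd i v x - real k * v x * pd i u x) / u x ^ Suc k)"
      by (auto simp: differentiable_def fun_eq_iff)
    moreover have "smooth (\<lambda>x. u x * pd i v x - real k * v x * pd i u x)" for i
      using v assms by (intro smooth_diff smooth_mult smooth_pd smooth_const)
    ultimately show ?case by blast
  qed
  from this[of "\<lambda>x. 1 / u x"] show ?thesis
    by (metis (no_types, lifting) power_one_right smooth_const ext)
qed

lemma smooth_divide:
  "smooth u \<Longrightarrow> smooth v \<Longrightarrow> (\<And>x. v x > 0) \<Longrightarrow> smooth (\<lambda>x. u x / v x)"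
  using smooth_mult[of u "\<lambda>x. 1 / v x"] smooth_inverse[of v] by simp

text \<open>The functions p(1/t) exp(-1/t), extended by zero to t \<le> 0. Arbitrary polynomials
  \<open>p\<close> are allowed because differentiation replaces \<open>p\<close> by X^2 (p - p');
  the usual flat function is the member with p = 1.\<close>

definition flat_exp :: "real poly \<Rightarrow> real \<Rightarrow> real" where
  "flat_exp p t = (if t > 0 then poly p (1 / t) * exp (- (1 / t)) else 0)"

lemma poly_exp_decay: "((\<lambda>s. poly p s * exp (- s)) \<longlongrightarrow> (0::real)) at_top"
proof -
  have "((\<lambda>s. \<Sum>i\<le>degree p. coeff p i * (s ^ i / exp s)) \<longlongrightarrow> (\<Sum>i\<le>degree p. coeff p i * 0)) at_top"
    by (intro tendsto_sum tendsto_mult tendsto_const tendsto_power_div_exp_0)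
  moreover have "(\<Sum>i\<le>degree p. coeff p i * (s ^ i / exp s)) = poly p s * exp (- s)" for s
    by (simp add: poly_altdef sum_distrib_right exp_minus divide_inverse mult.assoc)
  ultimately show ?thesis by simp
qed

lemma flat_exp_derivative:
  "(flat_exp p has_real_derivative flat_exp ([:0, 0, 1:] * (p - pderiv p)) t) (at t)"
proof -
  consider "t > 0" | "t < 0" | "t = 0" by linarith
  thus ?thesis
  proof cases
    case 1
    have "((\<lambda>t. poly p (1 / t) * exp (- (1 / t))) has_real_derivative
        flat_exp ([:0, 0, 1:] * (p - pderiv p)) t) (at t)"
    proof -
      have r: "((\<lambda>t. 1 / t) has_real_derivative - (1 / t)\<^sup>2) (at t)"
        using 1 by (auto intro!: derivative_eq_intros simp: field_simps power2_eq_square)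
      have pp: "((\<lambda>t. poly p (1 / t)) has_real_derivative poly (pderiv p) (1 / t) * - (1 / t)\<^sup>2) (at t)"
        by (rule DERIV_chain2[OF poly_DERIV r])
      have ee: "((\<lambda>t. exp (- (1 / t))) has_real_derivative exp (- (1 / t)) * (1 / t)\<^sup>2) (at t)"
        using DERIV_chain2[OF DERIV_exp DERIV_minus[OF r]] by simp
      show ?thesis
        by (rule DERIV_cong[OF DERIV_mult[OF pp ee]])
          (use 1 in \<open>simp add: flat_exp_def algebra_simps power2_eq_square\<close>)
    qed
    moreover have "eventually (\<lambda>s. s > 0) (nhds t)"
      using 1 by (intro eventually_nhds_in_open[of "{0<..}", simplified]) auto
    hence "eventually (\<lambda>s. poly p (1 / s) * exp (- (1 / s)) = flat_exp p s) (nhds t)"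
      by eventually_elim (simp add: flat_exp_def)
    ultimately show ?thesis by (subst (asm) DERIV_cong_ev[OF refl _ refl]) auto
  next
    case 2
    have "eventually (\<lambda>s. s < 0) (nhds t)"
      using 2 by (intro eventually_nhds_in_open[of "{..<0}", simplified]) auto
    hence "eventually (\<lambda>s. 0 = flat_exp p s) (nhds t)"
      by eventually_elim (simp add: flat_exp_def)
    moreover have "((\<lambda>t. 0) has_real_derivative flat_exp ([:0, 0, 1:] * (p - pderiv p)) t) (at t)"
      using 2 by (simp add: flat_exp_def)
    ultimately show ?thesis by (subst (asm) DERIV_cong_ev[OF refl _ refl]) auto
  next
    case 3
    \<comment> \<open>Dividing by \<open>h\<close> multiplies \<open>p\<close> by X, so the
      difference quotient at 0 is again a polynomial in 1/h times exp(-1/h).\<close>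
    have "((\<lambda>h. poly ([:0, 1:] * p) (1 / h) * exp (- (1 / h))) \<longlongrightarrow> 0) (at_right 0)"
      by (rule filterlim_compose[OF poly_exp_decay])
        (use filterlim_inverse_at_top_right in \<open>simp add: inverse_eq_divide\<close>)
    moreover have "eventually (\<lambda>h. poly ([:0, 1:] * p) (1 / h) * exp (- (1 / h))
        = flat_exp p h / h) (at_right 0)"
      by (auto simp: flat_exp_def eventually_at_right_less intro!: eventually_at_right_less eventually_mono[OF eventually_at_right_less])
    ultimately have R: "((\<lambda>h. flat_exp p h / h) \<longlongrightarrow> 0) (at_right 0)"
      by (rule Lim_transform_eventually)
    have "eventually (\<lambda>h::real. h < 0) (at_left 0)"
      by (simp add: eventually_at_filter)
    hence "eventually (\<lambda>h. 0 = flat_exp p h / h) (at_left 0)"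
      by eventually_elim (simp add: flat_exp_def)
    hence L: "((\<lambda>h. flat_exp p h / h) \<longlongrightarrow> 0) (at_left 0)"
      by (rule Lim_transform_eventually[OF tendsto_const])
    show ?thesis using R L 3 unfolding DERIV_def
      by (simp add: flat_exp_def[of _ 0] filterlim_at_split)
  qed
qed

text \<open>By the chain rule a derivative of the composition with \<open>u\<close> is
  \<open>flat_exp q (u x) * pd i u x\<close> with a new polynomial \<open>q\<close>; hence the
  smooth factor and the closure under sums in the invariant.\<close>

inductive flat_exp_sums :: "(real^'n::finite \<Rightarrow> real) \<Rightarrow> (real^'n \<Rightarrow> real) \<Rightarrow> bool"
  for u where
  prod: "smooth v \<Longrightarrow> flat_exp_sums u (\<lambda>x. flat_exp p (u x) * v x)"
| add: "flat_exp_sums u v \<Longrightarrow> flat_exp_sums u w \<Longrightarrow> flat_exp_sums u (\<lambda>x. v x + w x)"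

lemma flat_exp_sums_derivative:
  assumes "smooth u"
  shows "flat_exp_sums u w \<Longrightarrow> (\<forall>x. w differentiable (at x)) \<and> (\<forall>i. flat_exp_sums u (pd i w))"
proof (induction rule: flat_exp_sums.induct)
  case (prod v p)
  define q where "q = [:0, 0, 1:] * (p - pderiv p)"
  have "(\<lambda>x. flat_exp p (u x)) differentiable (at x) \<and>
      pd i (\<lambda>x. flat_exp p (u x)) x = flat_exp q (u x) * pd i u x" for x i
  proof -
    obtain D where D: "(u has_derivative D) (at x)"
      using smooth_differentiable[OF assms] unfolding differentiable_def by blast
    have "((\<lambda>x. flat_exp p (u x)) has_derivative (\<lambda>h. flat_exp q (u x) * D h)) (at x)"
      using has_derivative_compose[OF D, of "flat_exp p"] flat_exp_derivative[of p "u x"]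
      unfolding q_def has_field_derivative_def by blast
    from pd_eqI[OF this refl] this show ?thesis
      using pd_eq_derivative[OF D] by (auto simp: differentiable_def)
  qed
  note * = this
  have "pd i (\<lambda>x. flat_exp p (u x) * v x) =
      (\<lambda>x. flat_exp p (u x) * pd i v x + flat_exp q (u x) * (pd i u x * v x))" for i
    using * prod by (subst ext[OF pd_mult]) (auto intro: smooth_differentiable simp: mult_ac)
  moreover have "flat_exp_sums u (\<lambda>x. flat_exp p (u x) * pd i v x + flat_exp q (u x) * (pd i u x * v x))" for i
    using prod assms by (intro flat_exp_sums.add flat_exp_sums.prod smooth_pd smooth_mult)
  ultimately show ?case using * prod by (simp add: differentiable_mult smooth_differentiable)
next
  case (add v w)
  have "pd i (\<lambda>x. v x + w x) = (\<lambda>x. pd i v x + pd i w x)" for i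
    using add by (intro ext pd_add) auto
  thus ?case using add by (simp add: differentiable_add flat_exp_sums.add)
qed

lemma smooth_flat_exp:
  fixes u :: "real^'n::finite \<Rightarrow> real"
  assumes "smooth u" shows "smooth (\<lambda>x. flat_exp p (u x))"
proof -
  have "smooth w" if "flat_exp_sums u w" for w :: "real^'n \<Rightarrow> real"
    using that by (coinduction arbitrary: w) (use flat_exp_sums_derivative[OF assms] in blast)
  from this[OF flat_exp_sums.prod[of "\<lambda>_. 1"]] show ?thesis by simp
qed

lemma flat_exp_1: "flat_exp 1 t \<ge> 0" "flat_exp 1 t > 0 \<longleftrightarrow> t > 0" "flat_exp 1 t = 0 \<longleftrightarrow> t \<le> 0"
  by (auto simp: flat_exp_def)


section \<open>Test functions and their supports\<close>

lemma C0infD: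
  assumes "u \<in> C0inf S"
  shows "smooth u" "compact (tsupp u)" "tsupp u \<subseteq> S"
  using assms by (auto simp: C0inf_def)

lemma tsupp_zero: "x \<notin> tsupp u \<Longrightarrow> u x = 0"
  unfolding tsupp_def using closure_subset[of "{x. u x \<noteq> 0}"] by auto

lemma C0inf_mono: "S \<subseteq> S' \<Longrightarrow> C0inf S \<subseteq> C0inf S'"
  by (auto simp: C0inf_def)

lemma closed_tsupp: "closed (tsupp u)"
  by (simp add: tsupp_def)

lemma tsupp_subsetI:
  assumes "closed F" "\<And>x. x \<notin> F \<Longrightarrow> u x = 0" shows "tsupp u \<subseteq> F"
  unfolding tsupp_def using assms by (intro closure_minimal) auto

lemma C0infI:
  assumes "smooth u" "compact F" "F \<subseteq> S" "\<And>x. x \<notin> F \<Longrightarrow> u x = 0"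
  shows "u \<in> C0inf S"
proof -
  have "tsupp u \<subseteq> F" using assms by (intro tsupp_subsetI compact_imp_closed) auto
  moreover have "closed (tsupp u)" by (simp add: tsupp_def)
  ultimately have "compact (tsupp u)"
    using assms(2) compact_Int_closed[of F "tsupp u"] by (simp add: Int_absorb1)
  thus ?thesis using \<open>tsupp u \<subseteq> F\<close> assms by (auto simp: C0inf_def)
qed

lemma C0inf_mult_left: "smooth b \<Longrightarrow> v \<in> C0inf S \<Longrightarrow> (\<lambda>x. b x * v x) \<in> C0inf S"
  by (rule C0infI[of _ "tsupp v"]) (auto dest: C0infD simp: tsupp_zero)

lemma C0inf_mult_right: "v \<in> C0inf S \<Longrightarrow> smooth b \<Longrightarrow> (\<lambda>x. v x * b x) \<in> C0inf S"
  by (rule C0infI[of _ "tsupp v"]) (auto dest: C0infD simp: tsupp_zero)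

lemma C0inf_add:
  "u \<in> C0inf S \<Longrightarrow> v \<in> C0inf S \<Longrightarrow> (\<lambda>x. u x + v x) \<in> C0inf S"
  by (rule C0infI[of _ "tsupp u \<union> tsupp v"]) (auto dest: C0infD simp: tsupp_zero)

lemma C0inf_zero: "(\<lambda>x. 0) \<in> C0inf S"
  by (rule C0infI[of _ "{}"]) auto

lemma C0inf_sum:
  "(\<And>k. k \<in> I \<Longrightarrow> f k \<in> C0inf S) \<Longrightarrow> (\<lambda>x. \<Sum>k\<in>I. f k x) \<in> C0inf S"
  by (induction I rule: infinite_finite_induct) (auto intro: C0inf_add C0inf_zero)

lemma pd_cong_open:
  assumes "open N" "\<And>y. y \<in> N \<Longrightarrow> u y = v y" "x \<in> N"
  shows "pd i u x = pd i v x"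
proof -
  have "((\<lambda>t. x + t *\<^sub>R axis i 1) \<longlongrightarrow> x + 0 *\<^sub>R axis i 1) (nhds (0::real))"
    by (rule isCont_tendsto_compose[where g="\<lambda>t. x + t *\<^sub>R axis i 1", OF _ filterlim_ident])
      (intro continuous_intros)
  hence "eventually (\<lambda>t::real. x + t *\<^sub>R axis i 1 \<in> N) (nhds 0)"
    using assms(1,3) by (auto dest!: topological_tendstoD[of _ _ _ N])
  hence "eventually (\<lambda>t::real. u (x + t *\<^sub>R axis i 1) = v (x + t *\<^sub>R axis i 1)) (nhds 0)"
    by eventually_elim (use assms in auto)
  thus ?thesis unfolding pd_def by (intro deriv_cong_ev) auto
qed

lemma pd_zero_outside: "x \<notin> tsupp u \<Longrightarrow> pd i u x = 0"
  using pd_cong_open[of "- tsupp u" u "\<lambda>_. 0" x i] by (simp add: tsupp_zero) (simp add: tsupp_def open_Compl)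

lemma C0inf_pd: "u \<in> C0inf S \<Longrightarrow> pd i u \<in> C0inf S"
  by (rule C0infI[of _ "tsupp u"]) (auto dest: C0infD pd_zero_outside intro: smooth_pd)

lemma tsupp_pd: "tsupp (pd i u) \<subseteq> tsupp u"
  by (rule tsupp_subsetI) (auto simp: tsupp_def pd_zero_outside[unfolded tsupp_def])

lemma C0inf_bounded:
  assumes "u \<in> C0inf S" obtains B where "B > 0" "\<And>x. \<bar>u x\<bar> \<le> B"
proof -
  have "compact (u ` tsupp u)"
    using assms by (intro compact_continuous_image smooth_continuous_on C0infD)
  then obtain B where B: "B > 0" "\<And>x. x \<in> tsupp u \<Longrightarrow> \<bar>u x\<bar> \<le> B"
    by (auto dest!: compact_imp_bounded simp: bounded_pos)
  have "\<bar>u x\<bar> \<le> B" for x using B tsupp_zero[of x u] by (cases "x \<in> tsupp u") auto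
  thus ?thesis using B that by blast
qed

section \<open>Cutoff functions and Taylor estimates\<close>

lemma dist_power2_vec: "(dist x y)\<^sup>2 = (\<Sum>i\<in>UNIV. (x $ i - y $ i) * (x $ i - y $ i))" for x y :: "real^'n::finite"
  by (simp add: dist_vec_def L2_set_def sum_nonneg power2_eq_square dist_real_def)

text \<open>Compactness gives finitely many balls in \<open>U\<close> whose bump functions have a
  sum \<open>s\<close> that is positive on \<open>C\<close> and vanishes off the balls. Passing
  \<open>s\<close> through a smooth step between two levels below its minimum on \<open>C\<close>
  makes it constant near \<open>C\<close>.\<close>

lemma cutoff_exists:
  fixes C U :: "(real^'n::finite) set"
  assumes "compact C" "C \<subseteq> U" "open U"
  obtains \<kappa> N where "\<kappa> \<in> C0inf U" "\<And>x. 0 \<le> \<kappa> x" "\<And>x. \<kappa> x \<le> 1"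
    "open N" "C \<subseteq> N" "\<And>x. x \<in> N \<Longrightarrow> \<kappa> x = 1"
proof (cases "C = {}")
  case True
  show ?thesis by (rule that[of "\<lambda>_. 0" "{}"]) (use True C0inf_zero in auto)
next
  case False
  have "\<forall>p\<in>C. \<exists>r>0. cball p r \<subseteq> U" using assms open_contains_cball by blast
  then obtain r where r: "\<And>p. p \<in> C \<Longrightarrow> r p > 0 \<and> cball p (r p) \<subseteq> U" by metis
  obtain P where P: "finite P" "P \<subseteq> C" "C \<subseteq> (\<Union>p\<in>P. ball p (r p))"
    using compactE_image[OF assms(1), of C "\<lambda>p. ball p (r p)"] r
    by (metis (no_types, lifting) UN_iff centre_in_ball open_ball subsetI)
  define f where "f = (\<lambda>p x. flat_exp 1 ((r p)\<^sup>2 - (\<Sum>i\<in>UNIV. (x $ i - p $ i) * (x $ i - p $ i))))"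
  have sf: "smooth (f p)" for p unfolding f_def
    by (intro smooth_flat_exp smooth_diff smooth_sum smooth_mult smooth_coord smooth_const)
  have f0: "f p x \<ge> 0" for p x by (simp add: f_def flat_exp_1)
  have fpos: "f p x > 0 \<longleftrightarrow> x \<in> ball p (r p)" if "p \<in> P" for p x
  proof -
    have "0 < r p" using r that P by auto
    hence "(dist x p)\<^sup>2 < (r p)\<^sup>2 \<longleftrightarrow> dist x p < r p"
      by (metis abs_of_nonneg abs_of_pos power2_abs power2_less_imp_less power_strict_mono
          zero_le_dist pos2 less_imp_le)
    thus ?thesis by (simp add: f_def flat_exp_1 dist_power2_vec[symmetric] dist_commute)
  qed
  define s where "s = (\<lambda>x. \<Sum>p\<in>P. f p x)"
  have ss: "smooth s" unfolding s_def by (intro smooth_sum sf)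
  have spos: "s x > 0 \<longleftrightarrow> x \<in> (\<Union>p\<in>P. ball p (r p))" for x
  proof -
    have "s x > 0 \<longleftrightarrow> (\<exists>p\<in>P. f p x > 0)" unfolding s_def
      using P(1) f0 by (auto intro: sum_pos2 simp: not_less[symmetric]) (meson not_less sum_nonpos)
    thus ?thesis using fpos by auto
  qed
  obtain x0 where x0: "x0 \<in> C" "\<And>x. x \<in> C \<Longrightarrow> s x0 \<le> s x"
    using continuous_attains_inf[OF assms(1) False smooth_continuous_on[OF ss]] by auto
  define c where "c = s x0"
  have c: "c > 0" using x0(1) P(3) spos[of x0] unfolding c_def by blast
  \<comment> \<open>\<open>\<kappa>\<close> is 0 where \<open>s\<close> is at most c/4 and 1 where
    \<open>s\<close> is at least c/2. Since c/4 < c/2, at least one summand of \<open>den\<close> is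
    positive everywhere; since c/2 < c, the set where s > c/2 is an open neighbourhood of
    \<open>C\<close>.\<close>
  define den where "den = (\<lambda>x. flat_exp 1 (s x - c / 4) + flat_exp 1 (c / 2 - s x))"
  define \<kappa> where "\<kappa> = (\<lambda>x. flat_exp 1 (s x - c / 4) / den x)"
  have den: "den x > 0" for x
  proof (cases "s x > c / 4")
    case False
    hence "flat_exp 1 (c / 2 - s x) > 0" using c by (simp add: flat_exp_1)
    thus ?thesis unfolding den_def using flat_exp_1(1) add_nonneg_pos by blast
  qed (use flat_exp_1 in \<open>auto simp: den_def intro!: add_pos_nonneg\<close>)
  have smooth_num: "smooth (\<lambda>x. flat_exp 1 (s x - c / 4))"
    by (intro smooth_flat_exp smooth_diff smooth_const ss)
  have "smooth \<kappa>" unfolding \<kappa>_def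
    by (intro smooth_divide smooth_num den)
      (unfold den_def, intro smooth_add smooth_num smooth_flat_exp smooth_diff smooth_const ss)
  moreover have "compact (\<Union>p\<in>P. cball p (r p))" using P by auto
  moreover have "(\<Union>p\<in>P. cball p (r p)) \<subseteq> U" using P r by blast
  moreover have "\<kappa> x = 0" if "x \<notin> (\<Union>p\<in>P. cball p (r p))" for x
  proof -
    have "x \<notin> (\<Union>p\<in>P. ball p (r p))" using that ball_subset_cball by blast
    hence "s x \<le> 0" using spos[of x] by linarith
    thus ?thesis using c by (simp add: \<kappa>_def flat_exp_1)
  qed
  ultimately have "\<kappa> \<in> C0inf U" by (rule C0infI)
  moreover have "0 \<le> \<kappa> x" for x using den[of x] by (simp add: \<kappa>_def flat_exp_1)
  moreover have "\<kappa> x \<le> 1" for x using den[of x] by (simp add: \<kappa>_def flat_exp_1 den_def)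
  moreover have "open {x. s x > c / 2}"
    by (intro open_Collect_less continuous_on_const smooth_continuous_on ss)
  moreover have "C \<subseteq> {x. s x > c / 2}" using x0 c unfolding c_def by fastforce
  moreover have "\<kappa> x = 1" if "x \<in> {x. s x > c / 2}" for x
  proof -
    have "flat_exp 1 (c / 2 - s x) = 0" using that by (simp add: flat_exp_1)
    thus ?thesis using den[of x] by (simp add: \<kappa>_def den_def)
  qed
  ultimately show ?thesis using that by blast
qed

text \<open>A test function is smooth on the whole space with globally bounded derivatives, so the
  estimate holds for all \<open>x\<close> and \<open>y\<close>, also when the segment between them
  leaves \<open>S\<close>.\<close>

lemma taylor_order2:
  fixes u :: "real^'n::finite \<Rightarrow> real"
  assumes "u \<in> C0inf S"
  obtains B where "B > 0"
    "\<And>x y. \<bar>u x - u y - (\<Sum>i\<in>UNIV. (x $ i - y $ i) * pd i u y)\<bar> \<le> B * (dist x y)\<^sup>2"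
proof -
  have "\<exists>B>0. \<forall>x. \<bar>pd j (pd i u) x\<bar> \<le> B" for i j
    using C0inf_bounded[OF C0inf_pd[OF C0inf_pd[OF assms]]] by metis
  note ex = this
  define B where "B = (\<lambda>i j. SOME B. B > 0 \<and> (\<forall>x. \<bar>pd j (pd i u) x\<bar> \<le> B))"
  have B: "B i j > 0" "\<bar>pd j (pd i u) x\<bar> \<le> B i j" for i j x
    using someI_ex[OF ex[of j i]] unfolding B_def by auto
  define M where "M = 1 + (\<Sum>i\<in>UNIV. \<Sum>j\<in>UNIV. B i j)"
  have M: "M > 0" unfolding M_def using B(1) by (intro add_pos_nonneg sum_nonneg) (auto intro: less_imp_le)
  have su: "smooth u" using C0infD(1)[OF assms] .
  have "\<bar>u x - u y - (\<Sum>i\<in>UNIV. (x $ i - y $ i) * pd i u y)\<bar> \<le> M * (dist x y)\<^sup>2" for x y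
  proof -
    define h where "h = x - y"
    \<comment> \<open>\<open>D m\<close> is the \<open>m\<close>-th derivative of \<open>u\<close>
      along the segment from \<open>y\<close> (at t = 0) to \<open>x\<close> (at t = 1), which
      reduces the claim to Taylor's theorem in one variable.\<close>
    define D where "D = (\<lambda>m t. if m = 0 then u (y + t *\<^sub>R h)
        else if m = Suc 0 then (\<Sum>i\<in>UNIV. h $ i * pd i u (y + t *\<^sub>R h))
        else (\<Sum>i\<in>UNIV. h $ i * (\<Sum>j\<in>UNIV. h $ j * pd j (pd i u) (y + t *\<^sub>R h))))"
    have "DERIV (D m) t :> D (Suc m) t" if "m < 2" for m t
      using that smooth_line_derivative[OF su, where x=y and h=h and t=t]
        smooth_line_derivative[OF smooth_pd[OF su], where x=y and h=h and t=t]
      by (auto simp: D_def less_2_cases_iff intro!: DERIV_sum DERIV_cmult)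
    then obtain t where t: "D 0 1 = (\<Sum>m<2. (D m 0 / fact m) * (1 - 0) ^ m) + (D 2 t / fact 2) * (1 - 0) ^ 2"
      using Taylor_up[of 2 D "D 0" 0 1 0] by auto
    have "u x - u y - (\<Sum>i\<in>UNIV. h $ i * pd i u y) = D 2 t / 2"
      using t by (simp add: D_def h_def numeral_2_eq_2)
    moreover have "\<bar>D 2 t\<bar> \<le> M * (dist x y)\<^sup>2"
    proof -
      have "\<bar>D 2 t\<bar> \<le> (\<Sum>i\<in>UNIV. \<Sum>j\<in>UNIV. \<bar>h $ i * (h $ j * pd j (pd i u) (y + t *\<^sub>R h))\<bar>)"
        unfolding D_def by (simp add: sum_distrib_left) (intro order.trans[OF sum_abs] sum_mono sum_abs)
      also have "\<dots> \<le> (\<Sum>i\<in>UNIV. \<Sum>j\<in>UNIV. (norm h)\<^sup>2 * B i j)"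
      proof (intro sum_mono)
        fix i j
        have "\<bar>h $ i\<bar> * (\<bar>h $ j\<bar> * \<bar>pd j (pd i u) (y + t *\<^sub>R h)\<bar>) \<le> norm h * (norm h * B i j)"
          by (intro mult_mono component_le_norm_cart B) auto
        thus "\<bar>h $ i * (h $ j * pd j (pd i u) (y + t *\<^sub>R h))\<bar> \<le> (norm h)\<^sup>2 * B i j"
          by (simp add: abs_mult power2_eq_square mult_ac)
      qed
      also have "\<dots> = (norm h)\<^sup>2 * (M - 1)" by (simp add: M_def sum_distrib_left)
      also have "\<dots> \<le> M * (norm h)\<^sup>2" by (simp add: algebra_simps)
      finally show ?thesis by (simp add: h_def dist_norm)
    qed
    ultimately show ?thesis by (simp add: h_def)
  qed
  thus ?thesis using that M by blast
qed

text \<open>Used for \<open>u\<close> itself, where the remainder has to be o(|x - y|^2); the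
  quadratic bound serves where a further factor of order |x - y| is present.\<close>

lemma taylor_order3:
  fixes u :: "real^'n::finite \<Rightarrow> real"
  assumes "u \<in> C0inf S"
  obtains B where "B > 0"
    "\<And>x y. \<bar>u x - u y - (\<Sum>i\<in>UNIV. (x $ i - y $ i) * pd i u y)
       - 1 / 2 * (\<Sum>i\<in>UNIV. \<Sum>j\<in>UNIV. (x $ i - y $ i) * (x $ j - y $ j) * pd j (pd i u) y)\<bar>
       \<le> B * (dist x y) ^ 3"
proof -
  have "\<exists>B>0. \<forall>x. \<bar>pd k (pd j (pd i u)) x\<bar> \<le> B" for i j k
    using C0inf_bounded[OF C0inf_pd[OF C0inf_pd[OF C0inf_pd[OF assms]]]] by metis
  note ex = this
  define B where "B = (\<lambda>i j k. SOME B. B > 0 \<and> (\<forall>x. \<bar>pd k (pd j (pd i u)) x\<bar> \<le> B))"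
  have B: "B i j k > 0" "\<bar>pd k (pd j (pd i u)) x\<bar> \<le> B i j k" for i j k x
    using someI_ex[OF ex[of k j i]] unfolding B_def by auto
  define M where "M = 1 + (\<Sum>i\<in>UNIV. \<Sum>j\<in>UNIV. \<Sum>k\<in>UNIV. B i j k)"
  have M: "M > 0" unfolding M_def using B(1) by (intro add_pos_nonneg sum_nonneg) (auto intro: less_imp_le)
  have su: "smooth u" using C0infD(1)[OF assms] .
  have "\<bar>u x - u y - (\<Sum>i\<in>UNIV. (x $ i - y $ i) * pd i u y)
       - 1 / 2 * (\<Sum>i\<in>UNIV. \<Sum>j\<in>UNIV. (x $ i - y $ i) * (x $ j - y $ j) * pd j (pd i u) y)\<bar>
       \<le> M * (dist x y) ^ 3" for x y
  proof -
    define h where "h = x - y"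
    define D where "D = (\<lambda>m t. if m = 0 then u (y + t *\<^sub>R h)
        else if m = Suc 0 then (\<Sum>i\<in>UNIV. h $ i * pd i u (y + t *\<^sub>R h))
        else if m = Suc (Suc 0) then (\<Sum>i\<in>UNIV. h $ i * (\<Sum>j\<in>UNIV. h $ j * pd j (pd i u) (y + t *\<^sub>R h)))
        else (\<Sum>i\<in>UNIV. h $ i * (\<Sum>j\<in>UNIV. h $ j * (\<Sum>k\<in>UNIV. h $ k * pd k (pd j (pd i u)) (y + t *\<^sub>R h)))))"
    have "DERIV (D m) t :> D (Suc m) t" if "m < 3" for m t
    proof -
      have "m = 0 \<or> m = Suc 0 \<or> m = Suc (Suc 0)" using that by linarith
      thus ?thesis using smooth_line_derivative[OF su, where x=y and h=h and t=t]
        smooth_line_derivative[OF smooth_pd[OF su], where x=y and h=h and t=t]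
        smooth_line_derivative[OF smooth_pd[OF smooth_pd[OF su]], where x=y and h=h and t=t]
        by (auto simp: D_def intro!: DERIV_sum DERIV_cmult)
    qed
    then obtain t where t: "D 0 1 = (\<Sum>m<3. (D m 0 / fact m) * (1 - 0) ^ m) + (D 3 t / fact 3) * (1 - 0) ^ 3"
      using Taylor_up[of 3 D "D 0" 0 1 0] by auto
    have "(\<Sum>i\<in>UNIV. \<Sum>j\<in>UNIV. h $ i * h $ j * pd j (pd i u) y) = D 2 0"
      by (simp add: D_def numeral_2_eq_2 sum_distrib_left mult.assoc)
    hence "u x - u y - (\<Sum>i\<in>UNIV. h $ i * pd i u y)
        - 1 / 2 * (\<Sum>i\<in>UNIV. \<Sum>j\<in>UNIV. h $ i * h $ j * pd j (pd i u) y) = D 3 t / 6"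
      using t by (simp add: D_def h_def numeral_3_eq_3 numeral_2_eq_2 fact_numeral)
    moreover have "\<bar>D 3 t\<bar> \<le> M * (dist x y) ^ 3"
    proof -
      have "\<bar>D 3 t\<bar> \<le> (\<Sum>i\<in>UNIV. \<Sum>j\<in>UNIV. \<Sum>k\<in>UNIV. \<bar>h $ i * (h $ j * (h $ k * pd k (pd j (pd i u)) (y + t *\<^sub>R h)))\<bar>)"
        unfolding D_def by (simp add: sum_distrib_left)
          (intro order.trans[OF sum_abs] sum_mono order.trans[OF sum_abs] sum_abs)
      also have "\<dots> \<le> (\<Sum>i\<in>UNIV. \<Sum>j\<in>UNIV. \<Sum>k\<in>UNIV. norm h ^ 3 * B i j k)"
      proof (intro sum_mono)
        fix i j k
        have "\<bar>h $ i\<bar> * (\<bar>h $ j\<bar> * (\<bar>h $ k\<bar> * \<bar>pd k (pd j (pd i u)) (y + t *\<^sub>R h)\<bar>)) \<le> norm h * (norm h * (norm h * B i j k))"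
          by (intro mult_mono component_le_norm_cart B) auto
        thus "\<bar>h $ i * (h $ j * (h $ k * pd k (pd j (pd i u)) (y + t *\<^sub>R h)))\<bar> \<le> norm h ^ 3 * B i j k"
          by (simp add: abs_mult power3_eq_cube mult_ac)
      qed
      also have "\<dots> = norm h ^ 3 * (M - 1)" by (simp add: M_def sum_distrib_left)
      also have "\<dots> \<le> M * norm h ^ 3" by (simp add: algebra_simps)
      finally show ?thesis by (simp add: h_def dist_norm)
    qed
    ultimately show ?thesis by (simp add: h_def)
  qed
  thus ?thesis using that M by blast
qed

section \<open>Positivity of the semigroup\<close>

lemma L2D: "f \<in> L2 m \<Longrightarrow> f \<in> borel_measurable m" "f \<in> L2 m \<Longrightarrow> integrable m (\<lambda>x. (f x)\<^sup>2)"
  by (auto simp: L2_def)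

lemma L2_mult_integrable:
  assumes "f \<in> L2 m" "g \<in> L2 m" shows "integrable m (\<lambda>x. f x * g x)"
proof (rule Bochner_Integration.integrable_bound)
  show "integrable m (\<lambda>x. (f x)\<^sup>2 + (g x)\<^sup>2)" using assms by (auto simp: L2_def)
  have "2 * \<bar>a * b\<bar> \<le> a\<^sup>2 + b\<^sup>2" for a b :: real
    using sum_squares_bound[of "\<bar>a\<bar>" "\<bar>b\<bar>"] by (simp add: abs_mult)
  hence "\<bar>a * b\<bar> \<le> a\<^sup>2 + b\<^sup>2" for a b :: real
    using abs_ge_zero[of "a * b"] by (smt (verit))
  thus "AE x in m. norm (f x * g x) \<le> norm ((f x)\<^sup>2 + (g x)\<^sup>2)"
    by (auto intro: order.trans[OF _ abs_ge_self])
qed (use assms in \<open>auto simp: L2_def\<close>)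

lemma L2_cmult: "f \<in> L2 m \<Longrightarrow> (\<lambda>x. c * f x) \<in> L2 m"
  by (auto simp: L2_def power_mult_distrib)

lemma L2_add: assumes "f \<in> L2 m" "g \<in> L2 m" shows "(\<lambda>x. f x + g x) \<in> L2 m"
  using assms L2_mult_integrable[OF assms]
  by (auto simp: L2_def power2_sum mult.assoc intro!: Bochner_Integration.integrable_add)

lemma L2_diff: "f \<in> L2 m \<Longrightarrow> g \<in> L2 m \<Longrightarrow> (\<lambda>x. f x - g x) \<in> L2 m"
  using L2_add[of f m "\<lambda>x. - 1 * g x"] L2_cmult[of g m "- 1"] by simp

lemma L2_divide: "f \<in> L2 m \<Longrightarrow> (\<lambda>x. f x / c) \<in> L2 m"
  using L2_cmult[of f m "1 / c"] by simp

lemma L2_zero: "(\<lambda>x. 0) \<in> L2 m"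
  by (simp add: L2_def)

lemma L2_pos_part: assumes "f \<in> L2 m" shows "(\<lambda>x. max (f x) 0) \<in> L2 m"
proof -
  have "integrable m (\<lambda>x. (max (f x) 0)\<^sup>2)"
    by (rule Bochner_Integration.integrable_bound[OF L2D(2)[OF assms]])
      (use assms in \<open>auto simp: L2_def max_def\<close>)
  thus ?thesis using assms by (auto simp: L2_def)
qed

lemma l2_norm_nonneg [simp]: "l2_norm m f \<ge> 0"
  by (simp add: l2_norm_def)

lemma l2_norm_power2: "(l2_norm m f)\<^sup>2 = (\<integral>x. (f x)\<^sup>2 \<partial>m)"
  by (simp add: l2_norm_def)

lemma l2_norm_cmult: "l2_norm m (\<lambda>x. c * f x) = \<bar>c\<bar> * l2_norm m f"
  by (simp add: l2_norm_def power_mult_distrib real_sqrt_mult)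

lemma l2_norm_cong:
  assumes "AE x in m. f x = g x" "f \<in> L2 m" "g \<in> L2 m" shows "l2_norm m f = l2_norm m g"
  unfolding l2_norm_def using assms
  by (intro arg_cong[where f=sqrt] integral_cong_AE) (auto simp: L2_def)

lemma l2_inner_le:
  assumes "f \<in> L2 m" "g \<in> L2 m"
  shows "\<bar>\<integral>x. f x * g x \<partial>m\<bar> \<le> l2_norm m f * l2_norm m g"
proof -
  define a where "a = (\<integral>x. (f x)\<^sup>2 \<partial>m)"
  define b where "b = (\<integral>x. f x * g x \<partial>m)"
  define c where "c = (\<integral>x. (g x)\<^sup>2 \<partial>m)"
  have *: "s\<^sup>2 * a + 2 * s * t * b + t\<^sup>2 * c \<ge> 0" for s t
  proof -
    have "(\<integral>x. (s * f x + t * g x)\<^sup>2 \<partial>m) = (\<integral>x. s\<^sup>2 * (f x)\<^sup>2 + 2 * s * t * (f x * g x) + t\<^sup>2 * (g x)\<^sup>2 \<partial>m)"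
      by (intro Bochner_Integration.integral_cong) (auto simp: power2_eq_square algebra_simps)
    moreover have "(\<integral>x. s\<^sup>2 * (f x)\<^sup>2 + 2 * s * t * (f x * g x) + t\<^sup>2 * (g x)\<^sup>2 \<partial>m) = s\<^sup>2 * a + 2 * s * t * b + t\<^sup>2 * c"
      using L2D(2)[OF assms(1)] L2D(2)[OF assms(2)] L2_mult_integrable[OF assms]
      by (simp add: a_def b_def c_def)
    moreover have "(\<integral>x. (s * f x + t * g x)\<^sup>2 \<partial>m) \<ge> 0" by (rule integral_nonneg_AE) simp
    ultimately show ?thesis by simp
  qed
  have a0: "a \<ge> 0" "c \<ge> 0" by (auto simp: a_def c_def)
  have "b\<^sup>2 \<le> a * c"
  proof (cases "a = 0")
    case True
    have "b = 0"
    proof (rule ccontr)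
      assume "b \<noteq> 0"
      \<comment> \<open>With a = 0 the quadratic form is affine in \<open>s\<close>; this value of
        \<open>s\<close> together with t = 1 gives it the value -1.\<close>
      hence "2 * (- (c + 1) / (2 * b)) * 1 * b = - (c + 1)" by simp
      thus False using *[of "- (c + 1) / (2 * b)" 1] True by simp
    qed
    thus ?thesis using True by simp
  next
    case False
    have "0 \<le> (- b)\<^sup>2 * a + 2 * (- b) * a * b + a\<^sup>2 * c" by (rule *)
    also have "\<dots> = a * (a * c - b\<^sup>2)" by (simp add: algebra_simps power2_eq_square)
    finally show ?thesis using False a0 by (simp add: zero_le_mult_iff)
  qed
  hence "sqrt (b\<^sup>2) \<le> sqrt (a * c)" by (rule real_sqrt_le_mono)
  thus ?thesis by (simp add: real_sqrt_mult l2_norm_def a_def b_def c_def)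
qed

lemma l2_norm_triangle:
  assumes "f \<in> L2 m" "g \<in> L2 m"
  shows "l2_norm m (\<lambda>x. f x + g x) \<le> l2_norm m f + l2_norm m g"
proof (rule power2_le_imp_le)
  have "(l2_norm m (\<lambda>x. f x + g x))\<^sup>2 = (\<integral>x. (f x)\<^sup>2 + (g x)\<^sup>2 + 2 * (f x * g x) \<partial>m)"
    unfolding l2_norm_power2 by (intro Bochner_Integration.integral_cong) (auto simp: power2_sum)
  also have "\<dots> = (l2_norm m f)\<^sup>2 + (l2_norm m g)\<^sup>2 + 2 * (\<integral>x. f x * g x \<partial>m)"
    using L2D(2)[OF assms(1)] L2D(2)[OF assms(2)] L2_mult_integrable[OF assms]
    by (simp add: l2_norm_power2)
  also have "\<dots> \<le> (l2_norm m f + l2_norm m g)\<^sup>2"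
    using l2_inner_le[OF assms] by (simp add: power2_sum)
  finally show "(l2_norm m (\<lambda>x. f x + g x))\<^sup>2 \<le> (l2_norm m f + l2_norm m g)\<^sup>2" .
qed simp

lemma l2_norm_triangle_diff:
  assumes "f \<in> L2 m" "g \<in> L2 m"
  shows "l2_norm m (\<lambda>x. f x - g x) \<le> l2_norm m f + l2_norm m g"
  using l2_norm_triangle[of f m "\<lambda>x. - 1 * g x"] l2_norm_cmult[of m "- 1" g]
    L2_cmult[of g m "- 1"] assms by simp

lemma l2_norm_zero_AE:
  assumes "f \<in> L2 m" "l2_norm m f = 0" shows "AE x in m. f x = 0"
proof -
  have "(\<integral>x. (f x)\<^sup>2 \<partial>m) = 0" using assms(2) by (simp add: l2_norm_def)
  hence "AE x in m. (f x)\<^sup>2 = 0"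
    using integral_nonneg_eq_0_iff_AE[OF L2D(2)[OF assms(1)]] by simp
  thus ?thesis by simp
qed

lemma tendsto_inner_of_l2:
  assumes "((\<lambda>t. l2_norm m (\<lambda>x. F t x - g x)) \<longlongrightarrow> 0) Q" "eventually (\<lambda>t. F t \<in> L2 m) Q"
    "g \<in> L2 m" "w \<in> L2 m"
  shows "((\<lambda>t. \<integral>x. F t x * w x \<partial>m) \<longlongrightarrow> (\<integral>x. g x * w x \<partial>m)) Q"
proof -
  have "((\<lambda>t. (\<integral>x. F t x * w x \<partial>m) - (\<integral>x. g x * w x \<partial>m)) \<longlongrightarrow> 0) Q"
  proof (rule tendsto_rabs_zero_cancel, rule tendsto_sandwich[OF _ _ tendsto_const])
    show "((\<lambda>t. l2_norm m (\<lambda>x. F t x - g x) * l2_norm m w) \<longlongrightarrow> 0) Q"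
      using tendsto_mult_right[OF assms(1), of "l2_norm m w"] by simp
    show "eventually (\<lambda>t. \<bar>(\<integral>x. F t x * w x \<partial>m) - (\<integral>x. g x * w x \<partial>m)\<bar>
        \<le> l2_norm m (\<lambda>x. F t x - g x) * l2_norm m w) Q"
      using assms(2)
    proof eventually_elim
      case (elim t)
      have "(\<integral>x. F t x * w x \<partial>m) - (\<integral>x. g x * w x \<partial>m) = (\<integral>x. (F t x - g x) * w x \<partial>m)"
        using L2_mult_integrable[OF elim assms(4)] L2_mult_integrable[OF assms(3,4)]
        by (simp add: left_diff_distrib)
      thus ?case using l2_inner_le[OF L2_diff[OF elim assms(3)] assms(4)] by simp
    qed
  qed auto
  thus ?thesis by (rule LIM_zero_cancel)
qed

section \<open>Orbits of the semigroup and their positive parts\<close>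

locale dirichlet_generator =
  fixes m :: "'a measure" and T :: "real \<Rightarrow> ('a \<Rightarrow> real) \<Rightarrow> ('a \<Rightarrow> real)"
    and A :: "('a \<Rightarrow> real) \<Rightarrow> ('a \<Rightarrow> real)" and DA :: "('a \<Rightarrow> real) set"
  assumes semigroup: "sc_contraction_semigroup m T" and generator: "is_generator m T A DA"
    and dirichlet: "dirichlet_operator m A DA"
begin

lemma T_L2: "t \<ge> 0 \<Longrightarrow> f \<in> L2 m \<Longrightarrow> T t f \<in> L2 m"
  and T_linear: "t \<ge> 0 \<Longrightarrow> f \<in> L2 m \<Longrightarrow> g \<in> L2 m \<Longrightarrow>
     AE x in m. T t (\<lambda>y. a * f y + b * g y) x = a * T t f x + b * T t g x"
  and T_0: "f \<in> L2 m \<Longrightarrow> AE x in m. T 0 f x = f x"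
  and T_add: "s \<ge> 0 \<Longrightarrow> t \<ge> 0 \<Longrightarrow> f \<in> L2 m \<Longrightarrow> AE x in m. T (s + t) f x = T s (T t f) x"
  and T_contraction: "t \<ge> 0 \<Longrightarrow> f \<in> L2 m \<Longrightarrow> l2_norm m (T t f) \<le> l2_norm m f"
  using semigroup by (simp_all add: sc_contraction_semigroup_def)

lemma T_cmult: "t \<ge> 0 \<Longrightarrow> f \<in> L2 m \<Longrightarrow> AE x in m. T t (\<lambda>y. a * f y) x = a * T t f x"
  using T_linear[of t f f a 0] by simp

lemma T_diff: "t \<ge> 0 \<Longrightarrow> f \<in> L2 m \<Longrightarrow> g \<in> L2 m \<Longrightarrow> AE x in m. T t (\<lambda>y. f y - g y) x = T t f x - T t g x"
  using T_linear[of t f g 1 "- 1"] by simp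

text \<open>The generator as a relation: \<open>A f\<close> is one representative of a class modulo
  null sets, and \<open>graph f g\<close> admits every other representative
  \<open>g\<close>.\<close>

definition graph :: "('a \<Rightarrow> real) \<Rightarrow> ('a \<Rightarrow> real) \<Rightarrow> bool" where
  "graph f g \<longleftrightarrow> f \<in> L2 m \<and> g \<in> L2 m \<and>
     ((\<lambda>t. l2_norm m (\<lambda>x. (T t f x - f x) / t - g x)) \<longlongrightarrow> 0) (at_right 0)"

lemma graph_A: "f \<in> DA \<Longrightarrow> graph f (A f)"
  using generator unfolding is_generator_def graph_def by blast

lemma graph_DA: "graph f g \<Longrightarrow> f \<in> DA"
  using generator unfolding is_generator_def graph_def by blast

lemma A_L2: "f \<in> DA \<Longrightarrow> A f \<in> L2 m" and DA_L2: "f \<in> DA \<Longrightarrow> f \<in> L2 m"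
  using graph_A unfolding graph_def by blast+

lemma quotient_L2: "t \<ge> 0 \<Longrightarrow> f \<in> L2 m \<Longrightarrow> (\<lambda>x. (T t f x - f x) / t) \<in> L2 m"
  by (intro L2_divide L2_diff T_L2)

lemma eventually_right_pos: "eventually (\<lambda>t. t > 0) (at_right (0::real))"
  by (simp add: eventually_at_filter)

lemma graph_unique:
  assumes "graph f g" "graph f h" shows "AE x in m. g x = h x"
proof -
  have *: "f \<in> L2 m" "g \<in> L2 m" "h \<in> L2 m" using assms by (auto simp: graph_def)
  have "l2_norm m (\<lambda>x. g x - h x) \<le> 0"
  proof (rule tendsto_le[of "at_right (0::real)"])
    show "((\<lambda>t. l2_norm m (\<lambda>x. (T t f x - f x) / t - h x)
        + l2_norm m (\<lambda>x. (T t f x - f x) / t - g x)) \<longlongrightarrow> 0) (at_right 0)"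
      using tendsto_add[of _ 0 _ _ 0] assms unfolding graph_def by fastforce
    show "((\<lambda>t. l2_norm m (\<lambda>x. g x - h x)) \<longlongrightarrow> l2_norm m (\<lambda>x. g x - h x)) (at_right 0)" by simp
    show "eventually (\<lambda>t. l2_norm m (\<lambda>x. g x - h x) \<le> l2_norm m (\<lambda>x. (T t f x - f x) / t - h x)
        + l2_norm m (\<lambda>x. (T t f x - f x) / t - g x)) (at_right 0)"
      using eventually_right_pos
    proof eventually_elim
      case (elim t)
      show ?case
        using l2_norm_triangle_diff[of "\<lambda>x. (T t f x - f x) / t - h x" m "\<lambda>x. (T t f x - f x) / t - g x"]
          L2_diff[OF quotient_L2 *(2)] L2_diff[OF quotient_L2 *(3)] elim *(1) by simp
    qed
  qed simp
  hence "l2_norm m (\<lambda>x. g x - h x) = 0" using l2_norm_nonneg by (simp add: order_antisym)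
  from l2_norm_zero_AE[OF L2_diff[OF *(2,3)] this] show ?thesis by simp
qed

lemma graph_cmult:
  assumes "graph f g" shows "graph (\<lambda>x. c * f x) (\<lambda>x. c * g x)"
proof -
  have *: "f \<in> L2 m" "g \<in> L2 m" using assms by (auto simp: graph_def)
  have "((\<lambda>t. \<bar>c\<bar> * l2_norm m (\<lambda>x. (T t f x - f x) / t - g x)) \<longlongrightarrow> 0) (at_right 0)"
    using assms unfolding graph_def by (auto intro!: tendsto_mult_right_zero)
  moreover have "eventually (\<lambda>t. \<bar>c\<bar> * l2_norm m (\<lambda>x. (T t f x - f x) / t - g x)
      = l2_norm m (\<lambda>x. (T t (\<lambda>x. c * f x) x - c * f x) / t - c * g x)) (at_right 0)"
    using eventually_right_pos
  proof eventually_elim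
    case (elim t)
    have "AE x in m. c * ((T t f x - f x) / t - g x) = (T t (\<lambda>x. c * f x) x - c * f x) / t - c * g x"
      using T_cmult[OF less_imp_le[OF elim] *(1), of c]
      by eventually_elim (simp add: right_diff_distrib)
    thus ?case unfolding l2_norm_cmult[symmetric]
      by (rule l2_norm_cong) (use elim * in \<open>auto intro!: L2_diff L2_divide L2_cmult T_L2\<close>)
  qed
  ultimately have "((\<lambda>t. l2_norm m (\<lambda>x. (T t (\<lambda>x. c * f x) x - c * f x) / t - c * g x)) \<longlongrightarrow> 0) (at_right 0)"
    by (rule Lim_transform_eventually)
  thus ?thesis using * unfolding graph_def by (simp add: L2_cmult)
qed

text \<open>The difference quotient at time \<open>s\<close> is \<open>T s\<close> applied to the
  one at time 0, so contractivity bounds the error at every \<open>s\<close> by the error at 0. This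
  is the uniformity in \<open>s\<close> on which the energy estimate rests.\<close>

lemma T_quotient_error:
  assumes "graph f g" "s \<ge> 0" "t \<ge> 0"
  shows "l2_norm m (\<lambda>x. (T (s + t) f x - T s f x) / t - T s g x)
      \<le> l2_norm m (\<lambda>x. (T t f x - f x) / t - g x)"
proof -
  have *: "f \<in> L2 m" "g \<in> L2 m" using assms by (auto simp: graph_def)
  have "AE x in m. T s (\<lambda>x. (1 / t) * (T t f x - f x) + (- 1) * g x) x
      = (1 / t) * T s (\<lambda>x. T t f x - f x) x + (- 1) * T s g x"
    using * assms by (intro T_linear L2_diff T_L2)
  moreover have "AE x in m. T s (\<lambda>x. T t f x - f x) x = T s (T t f) x - T s f x"
    using * assms by (intro T_diff T_L2)
  moreover have "AE x in m. T (s + t) f x = T s (T t f) x" using * assms by (intro T_add)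
  ultimately have "AE x in m. (T (s + t) f x - T s f x) / t - T s g x
      = T s (\<lambda>x. (T t f x - f x) / t - g x) x"
    by eventually_elim simp
  hence "l2_norm m (\<lambda>x. (T (s + t) f x - T s f x) / t - T s g x)
      = l2_norm m (T s (\<lambda>x. (T t f x - f x) / t - g x))"
    by (rule l2_norm_cong) (use assms * in \<open>auto intro!: L2_diff L2_divide T_L2\<close>)
  also have "\<dots> \<le> l2_norm m (\<lambda>x. (T t f x - f x) / t - g x)"
    using assms * by (intro T_contraction L2_diff L2_divide T_L2)
  finally show ?thesis .
qed

lemma graph_T:
  assumes "graph f g" "s \<ge> 0" shows "graph (T s f) (T s g)"
proof -
  have *: "f \<in> L2 m" "g \<in> L2 m" using assms by (auto simp: graph_def)
  have "((\<lambda>t. l2_norm m (\<lambda>x. (T t (T s f) x - T s f x) / t - T s g x)) \<longlongrightarrow> 0) (at_right 0)"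
  proof (rule tendsto_sandwich[OF _ _ tendsto_const])
    show "((\<lambda>t. l2_norm m (\<lambda>x. (T t f x - f x) / t - g x)) \<longlongrightarrow> 0) (at_right 0)"
      using assms by (simp add: graph_def)
    show "eventually (\<lambda>t. l2_norm m (\<lambda>x. (T t (T s f) x - T s f x) / t - T s g x)
        \<le> l2_norm m (\<lambda>x. (T t f x - f x) / t - g x)) (at_right 0)"
      using eventually_right_pos
    proof eventually_elim
      case (elim t)
      have "AE x in m. (T t (T s f) x - T s f x) / t - T s g x = (T (s + t) f x - T s f x) / t - T s g x"
        using T_add[of t s f] elim assms * by (auto simp: add.commute)
      hence "l2_norm m (\<lambda>x. (T t (T s f) x - T s f x) / t - T s g x)
          = l2_norm m (\<lambda>x. (T (s + t) f x - T s f x) / t - T s g x)"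
        by (rule l2_norm_cong) (use assms * elim in \<open>auto intro!: L2_diff L2_divide T_L2\<close>)
      thus ?case using T_quotient_error[OF assms, of t] elim by simp
    qed
  qed auto
  thus ?thesis using * assms by (simp add: graph_def T_L2)
qed

text \<open>The Dirichlet condition cuts at level 1. Applied to \<open>c * f\<close> and divided by
  c^2 it cuts \<open>f\<close> at level 1/c, and c \<rightarrow> \<infinity> lowers the level to
  0.\<close>

lemma graph_pos_part:
  assumes "graph f g" shows "(\<integral>x. g x * max (f x) 0 \<partial>m) \<le> 0"
proof -
  have *: "f \<in> L2 m" "g \<in> L2 m" using assms by (auto simp: graph_def)
  have fpos: "(\<lambda>x. max (f x) 0) \<in> L2 m" by (rule L2_pos_part[OF *(1)])
  have step: "(\<integral>x. g x * max (f x - 1 / real (Suc n)) 0 \<partial>m) \<le> 0" for n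
  proof -
    define c where "c = real (Suc n)"
    have c: "c > 0" by (simp add: c_def)
    have gr: "graph (\<lambda>x. c * f x) (\<lambda>x. c * g x)" by (rule graph_cmult[OF assms])
    have "l2_inner m (A (\<lambda>x. c * f x)) (\<lambda>x. max (c * f x - 1) 0) \<le> 0"
      using dirichlet graph_DA[OF gr] unfolding dirichlet_operator_def by blast
    also have "l2_inner m (A (\<lambda>x. c * f x)) (\<lambda>x. max (c * f x - 1) 0)
        = (\<integral>x. c\<^sup>2 * (g x * max (f x - 1 / c) 0) \<partial>m)"
      unfolding l2_inner_def
    proof (rule integral_cong_AE)
      show "(\<lambda>x. A (\<lambda>x. c * f x) x * max (c * f x - 1) 0) \<in> borel_measurable m"
        using L2D(1)[OF A_L2[OF graph_DA[OF gr]]] L2D(1)[OF *(1)] by measurable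
      show "(\<lambda>x. c\<^sup>2 * (g x * max (f x - 1 / c) 0)) \<in> borel_measurable m"
        using L2D(1)[OF *(1)] L2D(1)[OF *(2)] by measurable
      have "max (c * f x - 1) 0 = c * max (f x - 1 / c) 0" for x
        using c by (auto simp: max_def field_simps)
      note mx = this
      show "AE x in m. A (\<lambda>x. c * f x) x * max (c * f x - 1) 0 = c\<^sup>2 * (g x * max (f x - 1 / c) 0)"
        using graph_unique[OF graph_A[OF graph_DA[OF gr]] gr]
        by eventually_elim (simp add: power2_eq_square mx)
    qed
    also have "\<dots> = c\<^sup>2 * (\<integral>x. g x * max (f x - 1 / c) 0 \<partial>m)" by simp
    finally show ?thesis using c by (simp add: mult_le_0_iff c_def)
  qed
  have "(\<lambda>n. \<integral>x. g x * max (f x - 1 / real (Suc n)) 0 \<partial>m) \<longlonglongrightarrow> (\<integral>x. g x * max (f x) 0 \<partial>m)"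
  proof (rule integral_dominated_convergence[where w="\<lambda>x. \<bar>g x * max (f x) 0\<bar>"])
    show "integrable m (\<lambda>x. \<bar>g x * max (f x) 0\<bar>)"
      using L2_mult_integrable[OF *(2) fpos] by simp
    show "AE x in m. (\<lambda>n. g x * max (f x - 1 / real (Suc n)) 0) \<longlonglongrightarrow> g x * max (f x) 0"
    proof (rule AE_I2)
      fix x
      have "(\<lambda>n. 1 / real (Suc n)) \<longlonglongrightarrow> 0" using LIMSEQ_inverse_real_of_nat by (simp add: inverse_eq_divide)
      hence "(\<lambda>n. g x * max (f x - 1 / real (Suc n)) 0) \<longlonglongrightarrow> g x * max (f x - 0) 0"
        by (intro tendsto_intros)
      thus "(\<lambda>n. g x * max (f x - 1 / real (Suc n)) 0) \<longlonglongrightarrow> g x * max (f x) 0" by simp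
    qed
    show "AE x in m. norm (g x * max (f x - 1 / real (Suc n)) 0) \<le> \<bar>g x * max (f x) 0\<bar>" for n
    proof (rule AE_I2)
      fix x
      have "1 / real (Suc n) > 0" by simp
      hence "\<bar>max (f x - 1 / real (Suc n)) 0\<bar> \<le> \<bar>max (f x) 0\<bar>" by linarith
      thus "norm (g x * max (f x - 1 / real (Suc n)) 0) \<le> \<bar>g x * max (f x) 0\<bar>"
        by (simp add: abs_mult mult_left_mono)
    qed
  qed (use L2D(1)[OF *(1)] L2D(1)[OF *(2)] in measurable)
  thus ?thesis by (rule LIMSEQ_le_const2) (use step in blast)
qed

definition pos_energy :: "(real \<Rightarrow> 'a \<Rightarrow> real) \<Rightarrow> real \<Rightarrow> real" where
  "pos_energy w s = (\<integral>x. (max (w s x) 0)\<^sup>2 \<partial>m)"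

text \<open>The energy of the positive part along an orbit decreases up to an error that is
  \<open>o(t)\<close> uniformly in the base point \<open>s\<close>, so no differentiability in \<open>s\<close> is needed.\<close>

lemma pos_energy_step:
  assumes "graph f g" "s \<ge> 0" "t > 0"
  defines "e \<equiv> l2_norm m (\<lambda>x. (T t f x - f x) / t - g x)"
  shows "pos_energy (\<lambda>s. T s f) (s + t) \<le> pos_energy (\<lambda>s. T s f) s
     + t * (2 * e * l2_norm m f + t * (e + l2_norm m g)\<^sup>2)"
proof -
  have *: "f \<in> L2 m" "g \<in> L2 m" using assms by (auto simp: graph_def)
  define w where "w = T s f"
  define p where "p = (\<lambda>x. max (w x) 0)"
  define k where "k = (\<lambda>x. (T (s + t) f x - T s f x) / t)"
  have L: "w \<in> L2 m" "p \<in> L2 m" "k \<in> L2 m" "T (s + t) f \<in> L2 m" "T s g \<in> L2 m"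
    using * assms L2_pos_part unfolding w_def p_def k_def by (auto intro!: T_L2 L2_divide L2_diff)
  have err: "l2_norm m (\<lambda>x. k x - T s g x) \<le> e"
    using T_quotient_error[OF assms(1,2), of t] assms(3) by (simp add: k_def e_def)
  have np: "l2_norm m p \<le> l2_norm m f"
  proof -
    have "l2_norm m p \<le> l2_norm m w" unfolding l2_norm_def p_def using L
      by (intro real_sqrt_le_mono integral_mono L2D L2_pos_part) (auto simp: max_def)
    also have "\<dots> \<le> l2_norm m f" unfolding w_def using * assms by (intro T_contraction)
    finally show ?thesis .
  qed
  have nk: "l2_norm m k \<le> e + l2_norm m g"
  proof -
    have "l2_norm m (\<lambda>x. (k x - T s g x) + T s g x) \<le> l2_norm m (\<lambda>x. k x - T s g x) + l2_norm m (T s g)"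
      using L by (intro l2_norm_triangle L2_diff)
    also have "\<dots> \<le> e + l2_norm m g" using err T_contraction[of s g] * assms by simp
    finally show ?thesis by simp
  qed
  have kp: "(\<integral>x. k x * p x \<partial>m) \<le> e * l2_norm m f"
  proof -
    \<comment> \<open>\<open>k\<close> is \<open>T s g\<close> up to an error of norm at most
      \<open>e\<close>. The part with \<open>T s g\<close> has the right sign because
      \<open>T s f\<close> and \<open>T s g\<close> are again related by the generator.\<close>
    have "(\<integral>x. k x * p x \<partial>m) = (\<integral>x. (k x - T s g x) * p x \<partial>m) + (\<integral>x. T s g x * p x \<partial>m)"
      using L2_mult_integrable[OF L(3,2)] L2_mult_integrable[OF L(5,2)] by (simp add: left_diff_distrib)
    moreover have "(\<integral>x. T s g x * p x \<partial>m) \<le> 0"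
      unfolding p_def w_def by (rule graph_pos_part[OF graph_T[OF assms(1,2)]])
    moreover have "(\<integral>x. (k x - T s g x) * p x \<partial>m) \<le> e * l2_norm m f"
      using l2_inner_le[OF L2_diff[OF L(3,5)] L(2)] mult_mono[OF err np] by (simp add: e_def)
    ultimately show ?thesis by simp
  qed
  have pw: "(max (T (s + t) f x) 0)\<^sup>2 \<le> (p x)\<^sup>2 + 2 * t * (k x * p x) + t\<^sup>2 * (k x)\<^sup>2" for x
  proof -
    have a: "T (s + t) f x = w x + t * k x" using assms(3) by (simp add: w_def k_def)
    \<comment> \<open>Squaring this bound replaces a differentiation of the squared positive part:
      the first-order term is \<open>2 * t * (k x * p x)\<close>, in which \<open>k\<close> is seen
      only where w > 0.\<close>
    have "max (w x + t * k x) 0 \<le> \<bar>p x + t * k x\<bar>" by (auto simp: p_def max_def)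
    hence "(max (w x + t * k x) 0)\<^sup>2 \<le> \<bar>p x + t * k x\<bar>\<^sup>2" by (intro power_mono) auto
    also have "\<dots> = (p x)\<^sup>2 + 2 * t * (k x * p x) + t\<^sup>2 * (k x)\<^sup>2"
      by (simp add: power2_sum power_mult_distrib)
    finally show ?thesis by (simp add: a)
  qed
  have "pos_energy (\<lambda>s. T s f) (s + t) \<le> (\<integral>x. (p x)\<^sup>2 + 2 * t * (k x * p x) + t\<^sup>2 * (k x)\<^sup>2 \<partial>m)"
    unfolding pos_energy_def
    by (intro integral_mono pw Bochner_Integration.integrable_add integrable_mult_right L2D(2)
        L2_mult_integrable L L2_pos_part)
  also have "\<dots> = pos_energy (\<lambda>s. T s f) s + 2 * t * (\<integral>x. k x * p x \<partial>m) + t\<^sup>2 * (l2_norm m k)\<^sup>2"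
    using L2D(2)[OF L(2)] L2D(2)[OF L(3)] L2_mult_integrable[OF L(3,2)]
    by (simp add: l2_norm_power2 pos_energy_def p_def w_def)
  also have "\<dots> \<le> pos_energy (\<lambda>s. T s f) s + 2 * t * (e * l2_norm m f) + t\<^sup>2 * (e + l2_norm m g)\<^sup>2"
    using kp nk assms(3) by (intro add_mono mult_left_mono power_mono order_refl) auto
  finally show ?thesis by (simp add: algebra_simps power2_eq_square)
qed

text \<open>The energy of the positive part of the orbit of \<open>- f\<close> starts at 0. Cutting
  [0, t] into equal steps of length h bounds it at time \<open>t\<close> by t r(h) with r(h)
  \<rightarrow> 0 as h \<rightarrow> 0, so it is 0 there.\<close>

lemma T_nonneg:
  assumes f: "f \<in> DA" "AE x in m. 0 \<le> f x" and "t \<ge> 0"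
  shows "AE x in m. 0 \<le> T t f x"
proof (cases "t = 0")
  case True
  show ?thesis using T_0[OF DA_L2[OF f(1)]] f(2) unfolding True by eventually_elim simp
next
  case False
  hence t: "t > 0" using assms by simp
  define w where "w = (\<lambda>x. - 1 * f x)"
  define g where "g = (\<lambda>x. - 1 * A f x)"
  have gr: "graph w g" unfolding w_def g_def by (rule graph_cmult[OF graph_A[OF f(1)]])
  have L: "w \<in> L2 m" "g \<in> L2 m" using gr by (auto simp: graph_def)
  define e where "e = (\<lambda>h. l2_norm m (\<lambda>x. (T h w x - w x) / h - g x))"
  define r where "r = (\<lambda>h. 2 * e h * l2_norm m w + h * (e h + l2_norm m g)\<^sup>2)"
  define P where "P = pos_energy (\<lambda>s. T s w)"
  have steps: "P (real n * h) \<le> P 0 + real n * (h * r h)" if "h > 0" for n h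
  proof (induction n)
    case (Suc n)
    have "P (real n * h + h) \<le> P (real n * h) + h * r h"
      unfolding P_def r_def e_def by (rule pos_energy_step[OF gr]) (use that in auto)
    thus ?case using Suc by (simp add: algebra_simps)
  qed simp
  have P0: "P 0 = 0"
  proof -
    have "AE x in m. (max (T 0 w x) 0)\<^sup>2 = 0"
      using T_0[OF L(1)] f(2) by eventually_elim (simp add: w_def)
    thus ?thesis unfolding P_def pos_energy_def by (rule integral_eq_zero_AE)
  qed
  have h: "filterlim (\<lambda>n. t / real (Suc n)) (at_right 0) sequentially"
  proof (rule tendsto_imp_filterlim_at_right)
    show "(\<lambda>n. t / real (Suc n)) \<longlonglongrightarrow> 0"
      using tendsto_mult_left[OF LIMSEQ_inverse_real_of_nat, of t] by (simp add: divide_inverse)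
  qed (use t in auto)
  have e: "(e \<longlongrightarrow> 0) (at_right 0)" using gr by (simp add: graph_def e_def)
  have "(r \<longlongrightarrow> 2 * 0 * l2_norm m w + 0 * (0 + l2_norm m g)\<^sup>2) (at_right 0)"
    unfolding r_def by (intro tendsto_intros e)
  hence "(\<lambda>n. r (t / real (Suc n))) \<longlonglongrightarrow> 0"
    using filterlim_compose[OF _ h] by simp
  hence "(\<lambda>n. t * r (t / real (Suc n))) \<longlonglongrightarrow> t * 0"
    by (intro tendsto_mult tendsto_const)
  moreover have "P t \<le> t * r (t / real (Suc n))" for n
    using steps[of "t / real (Suc n)" "Suc n"] t P0 by simp
  ultimately have "P t \<le> 0" by (intro LIMSEQ_le_const[of _ 0]) auto
  hence "P t = 0" unfolding P_def pos_energy_def by (intro order_antisym) auto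
  hence "AE x in m. (max (T t w x) 0)\<^sup>2 = 0"
    unfolding P_def pos_energy_def
    using integral_nonneg_eq_0_iff_AE[OF L2D(2)[OF L2_pos_part[OF T_L2[OF assms(3) L(1)]]]] by simp
  moreover have "AE x in m. T t w x = - 1 * T t f x"
    unfolding w_def using T_cmult[OF assms(3) DA_L2[OF f(1)]] .
  ultimately show ?thesis by eventually_elim (auto simp: max_def split: if_splits)
qed

end

section \<open>Tensors and the jump measure\<close>

locale dirichlet_form_on = dirichlet_generator m T A DA
  for m :: "(real^'n::finite) measure" and T A DA +
  fixes U :: "(real^'n) set" and J :: "((real^'n) \<times> (real^'n)) measure" and K :: "(real^'n) measure"
  assumes U: "open U" and m: "radon_on U m"
    and C0inf_DA: "C0inf U \<subseteq> DA" and C0inf_adjoint: "C0inf U \<subseteq> adjoint_domain m A DA"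
    and JK: "jump_kill U (\<lambda>u v. - l2_inner m (A u) v) J K"
begin

lemma sets_m [measurable_cong, simp]: "sets m = sets borel"
  and sets_J [measurable_cong, simp]: "sets J = sets borel"
  and sets_K [measurable_cong, simp]: "sets K = sets borel"
  using m JK by (auto simp: radon_on_def jump_kill_def)

lemma emeasure_m_compact: "compact F \<Longrightarrow> F \<subseteq> U \<Longrightarrow> emeasure m F < \<infinity>"
  using m by (auto simp: radon_on_def)

lemma compact_support_L2:
  assumes "f \<in> borel_measurable borel" "\<And>x. \<bar>f x\<bar> \<le> B" "compact F" "F \<subseteq> U" "\<And>x. x \<notin> F \<Longrightarrow> f x = 0"
  shows "f \<in> L2 m"
proof -
  have "integrable m (\<lambda>x. (f x)\<^sup>2)"
  proof (rule Bochner_Integration.integrable_bound)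
    show "integrable m (\<lambda>x. B\<^sup>2 * indicator F x)"
      using emeasure_m_compact[of F] assms by (intro integrable_mult_right integrable_real_indicator)
        (auto intro: borel_compact)
    have "(f x)\<^sup>2 \<le> B\<^sup>2 * indicator F x" for x
      using assms(2)[of x] assms(5)[of x] by (auto simp: indicator_def abs_le_square_iff)
        (metis abs_ge_self abs_ge_zero abs_le_square_iff order.trans power2_abs)
    thus "AE x in m. norm ((f x)\<^sup>2) \<le> norm (B\<^sup>2 * indicator F x)" by (simp add: indicator_def)
  qed (use assms in measurable)
  thus ?thesis using assms(1) by (auto simp: L2_def measurable_cong_sets[OF sets_m refl])
qed

lemma C0inf_L2: assumes "v \<in> C0inf U" shows "v \<in> L2 m"
proof -
  obtain B where "\<And>x. \<bar>v x\<bar> \<le> B" using C0inf_bounded[OF assms] by metis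
  thus ?thesis using C0infD[OF assms] by (intro compact_support_L2[of v B "tsupp v"])
      (auto simp: smooth_measurable tsupp_zero)
qed

lemma C0inf_A_L2: "a \<in> C0inf U \<Longrightarrow> A a \<in> L2 m"
  using C0inf_DA A_L2 by blast

text \<open>\<open>tens S g\<close>: \<open>S\<close> is a finite sum of products \<open>a x * b y\<close>, and \<open>g y\<close> is the value at \<open>x = y\<close> of the
  operator \<open>A\<close> applied to \<open>S\<close> in its first variable.\<close>

inductive tens :: "(real^'n \<Rightarrow> real^'n \<Rightarrow> real) \<Rightarrow> (real^'n \<Rightarrow> real) \<Rightarrow> bool" where
  zero: "tens (\<lambda>x y. 0) (\<lambda>y. 0)"
| step: "a \<in> C0inf U \<Longrightarrow> smooth b \<Longrightarrow> tens S g \<Longrightarrow>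
    tens (\<lambda>x y. S x y + a x * b y) (\<lambda>y. g y + b y * A a y)"

lemma tens_single: "a \<in> C0inf U \<Longrightarrow> smooth b \<Longrightarrow> tens (\<lambda>x y. a x * b y) (\<lambda>y. b y * A a y)"
  using tens.step[OF _ _ tens.zero] by simp

lemma tens_add:
  assumes "tens S g" shows "tens S' g' \<Longrightarrow> tens (\<lambda>x y. S x y + S' x y) (\<lambda>y. g y + g' y)"
proof (induction rule: tens.induct)
  case (step a b S' g')
  from tens.step[OF step(1,2,4)] show ?case by (simp add: add.assoc)
qed (use assms in simp)

lemma tens_ymult:
  assumes "smooth c" shows "tens S g \<Longrightarrow> tens (\<lambda>x y. S x y * c y) (\<lambda>y. g y * c y)"
proof (induction rule: tens.induct)
  case (step a b S g)
  have "smooth (\<lambda>y. b y * c y)" using step assms by (intro smooth_mult)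
  from tens.step[OF step(1) this step(4)] show ?case by (simp add: algebra_simps)
qed (use tens.zero in simp)

lemma tens_cmult: "tens S g \<Longrightarrow> tens (\<lambda>x y. c * S x y) (\<lambda>y. c * g y)"
  using tens_ymult[of "\<lambda>_. c" S g] by (simp add: mult.commute)

lemma tens_diff: "tens S g \<Longrightarrow> tens S' g' \<Longrightarrow> tens (\<lambda>x y. S x y - S' x y) (\<lambda>y. g y - g' y)"
  using tens_add[of S g "\<lambda>x y. - 1 * S' x y" "\<lambda>y. - 1 * g' y"] tens_cmult[of S' g' "- 1"] by simp

lemma tens_sum:
  "(\<And>k. k \<in> I \<Longrightarrow> tens (S k) (g k)) \<Longrightarrow> tens (\<lambda>x y. \<Sum>k\<in>I. S k x y) (\<lambda>y. \<Sum>k\<in>I. g k y)"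
  by (induction I rule: infinite_finite_induct) (auto intro: tens.zero tens_add)

lemma tens_integrable:
  assumes v: "v \<in> C0inf U" shows "tens S g \<Longrightarrow> integrable m (\<lambda>y. g y * v y)"
proof (induction rule: tens.induct)
  case (step a b S g)
  have "integrable m (\<lambda>y. A a y * (b y * v y))"
    using step v by (intro L2_mult_integrable C0inf_A_L2 C0inf_L2 C0inf_mult_left)
  thus ?case using step by (simp add: algebra_simps)
qed simp

text \<open>Only the first variable is confined to a compact set; the second one is localized later
  by the test function.\<close>

lemma tens_support:
  "tens S g \<Longrightarrow> \<exists>X. compact X \<and> X \<subseteq> U \<and> (\<forall>x y. x \<notin> X \<longrightarrow> S x y = 0)"
proof (induction rule: tens.induct)
  case (step a b S g)
  then obtain X where "compact X" "X \<subseteq> U" "\<forall>x y. x \<notin> X \<longrightarrow> S x y = 0" by blast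
  thus ?case using C0infD[OF step(1)] by (intro exI[of _ "X \<union> tsupp a"]) (auto simp: tsupp_zero)
qed auto

lemma tens_continuous: "tens S g \<Longrightarrow> continuous_on UNIV (\<lambda>z. S (fst z) (snd z))"
proof (induction rule: tens.induct)
  case (step a b S g)
  have "continuous_on UNIV (\<lambda>z. a (fst z))" "continuous_on UNIV (\<lambda>z. b (snd z))"
    using step C0infD(1) by (auto intro!: continuous_on_compose2[OF smooth_continuous_on] continuous_intros)
  thus ?case using step by (intro continuous_intros)
qed auto

lemma tens_measurable [measurable]:
  "tens S g \<Longrightarrow> (\<lambda>z. S (fst z) (snd z)) \<in> borel_measurable borel"
  by (intro borel_measurable_continuous_onI tens_continuous)

lemma smooth_snd_measurable: "smooth v \<Longrightarrow> (\<lambda>z. v (snd z)) \<in> borel_measurable borel"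
  by (intro borel_measurable_continuous_onI continuous_on_compose2[OF smooth_continuous_on[of v UNIV]]
      continuous_intros) auto

lemma smooth_fst_measurable: "smooth v \<Longrightarrow> (\<lambda>z. v (fst z)) \<in> borel_measurable borel"
  by (intro borel_measurable_continuous_onI continuous_on_compose2[OF smooth_continuous_on[of v UNIV]]
      continuous_intros) auto

text \<open>\<open>G t p y\<close> is the sum of the \<open>b p * T t a y\<close>. It represents
  \<open>T t\<close> applied to S(\<cdot>, p) for all \<open>p\<close> together and is continuous in
  \<open>p\<close>, which is what gives the diagonal value \<open>G t y y\<close> a meaning. Its
  difference quotients converge because each coefficient times \<open>v\<close> is in L^2.\<close>

lemma tens_semigroup:
  "tens S g \<Longrightarrow> \<exists>G. (\<forall>p. (\<lambda>x. S x p) \<in> C0inf U) \<and>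
     (\<forall>t\<ge>0. \<forall>p. AE y in m. T t (\<lambda>x. S x p) y = G t p y) \<and>
     (\<forall>t y. continuous_on UNIV (\<lambda>p. G t p y)) \<and>
     (\<forall>v\<in>C0inf U. \<forall>t>0. integrable m (\<lambda>y. (G t y y - S y y) / t * v y)) \<and>
     (\<forall>v\<in>C0inf U. ((\<lambda>t. \<integral>y. (G t y y - S y y) / t * v y \<partial>m) \<longlongrightarrow> (\<integral>y. g y * v y \<partial>m)) (at_right 0))"
proof (induction rule: tens.induct)
  case zero
  have "AE y in m. T t (\<lambda>x. 0) y = 0" if "t \<ge> 0" for t
    using T_cmult[OF that L2_zero, of 0] by simp
  thus ?case by (intro exI[of _ "\<lambda>t p y. 0"]) (auto simp: C0inf_zero)
next
  case (step a b S g)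
  then obtain G where G: "\<And>p. (\<lambda>x. S x p) \<in> C0inf U"
    "\<And>t p. t \<ge> 0 \<Longrightarrow> AE y in m. T t (\<lambda>x. S x p) y = G t p y"
    "\<And>t y. continuous_on UNIV (\<lambda>p. G t p y)"
    "\<And>v t. v \<in> C0inf U \<Longrightarrow> t > 0 \<Longrightarrow> integrable m (\<lambda>y. (G t y y - S y y) / t * v y)"
    "\<And>v. v \<in> C0inf U \<Longrightarrow> ((\<lambda>t. \<integral>y. (G t y y - S y y) / t * v y \<partial>m) \<longlongrightarrow> (\<integral>y. g y * v y \<partial>m)) (at_right 0)"
    by blast
  have aL: "a \<in> L2 m" and gr: "graph a (A a)"
    using step C0inf_L2 graph_A C0inf_DA by auto
  let ?q = "\<lambda>t y. (T t a y - a y) / t"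
  have split: "(G t y y + b y * T t a y - (S y y + a y * b y)) / t * v y
      = (G t y y - S y y) / t * v y + ?q t y * (b y * v y)" for t y v
    by (simp add: diff_divide_distrib add_divide_distrib algebra_simps)
  show ?case
  proof (intro exI[of _ "\<lambda>t p y. G t p y + b p * T t a y"] conjI allI ballI impI)
    fix p show "(\<lambda>x. S x p + a x * b p) \<in> C0inf U"
      using G(1) step by (intro C0inf_add C0inf_mult_right) auto
    fix t :: real assume t: "t \<ge> 0"
    show "AE y in m. T t (\<lambda>x. S x p + a x * b p) y = G t p y + b p * T t a y"
      using T_linear[OF t C0inf_L2[OF G(1)] aL, of 1 p "b p"] G(2)[OF t, of p]
      by eventually_elim (simp add: mult.commute)
  next
    fix t y show "continuous_on UNIV (\<lambda>p. G t p y + b p * T t a y)"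
      by (intro continuous_on_add continuous_on_mult continuous_on_const G(3)
          smooth_continuous_on[OF step(2)])
  next
    fix v assume v: "v \<in> C0inf U"
    have bv: "(\<lambda>y. b y * v y) \<in> L2 m" using v step by (intro C0inf_L2 C0inf_mult_left)
    have int: "integrable m (\<lambda>y. ?q t y * (b y * v y))" if "t > 0" for t
      using that aL bv by (intro L2_mult_integrable quotient_L2) auto
    show "integrable m (\<lambda>y. (G t y y + b y * T t a y - (S y y + a y * b y)) / t * v y)" if "t > 0" for t
      unfolding split using int[OF that] G(4)[OF v that] by simp
    have "((\<lambda>t. \<integral>y. ?q t y * (b y * v y) \<partial>m) \<longlongrightarrow> (\<integral>y. A a y * (b y * v y) \<partial>m)) (at_right 0)"
      using gr bv eventually_right_pos unfolding graph_def
      by (intro tendsto_inner_of_l2) (auto elim!: eventually_mono intro: quotient_L2)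
    from tendsto_add[OF G(5)[OF v] this]
    have "((\<lambda>t. (\<integral>y. (G t y y - S y y) / t * v y \<partial>m) + (\<integral>y. ?q t y * (b y * v y) \<partial>m)) \<longlongrightarrow>
        (\<integral>y. (g y + b y * A a y) * v y \<partial>m)) (at_right 0)"
      using tens_integrable[OF v step(3)] L2_mult_integrable[OF C0inf_A_L2[OF step(1)] bv]
      by (simp add: algebra_simps)
    moreover have "eventually (\<lambda>t. (\<integral>y. (G t y y - S y y) / t * v y \<partial>m) + (\<integral>y. ?q t y * (b y * v y) \<partial>m)
        = (\<integral>y. (G t y y + b y * T t a y - (S y y + a y * b y)) / t * v y \<partial>m)) (at_right 0)"
      using eventually_right_pos
      by eventually_elim (simp only: split Bochner_Integration.integral_add[OF G(4)[OF v] int])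
    ultimately show "((\<lambda>t. \<integral>y. (G t y y + b y * T t a y - (S y y + a y * b y)) / t * v y \<partial>m) \<longlongrightarrow>
        (\<integral>y. (g y + b y * A a y) * v y \<partial>m)) (at_right 0)"
      by (rule Lim_transform_eventually)
  qed
qed

text \<open>Positivity of \<open>T\<^sub>t\<close> holds almost everywhere for each frozen second argument \<open>p\<close>; continuity
  in \<open>p\<close> makes it hold for all \<open>p\<close> simultaneously, so that \<open>p\<close> can be put on the diagonal.\<close>

lemma tens_nonneg:
  assumes S: "tens S g" and v: "v \<in> C0inf U" "\<And>y. v y \<ge> 0"
    and pos: "\<And>x y. y \<in> tsupp v \<Longrightarrow> S x y \<ge> 0" and diag: "\<And>y. y \<in> tsupp v \<Longrightarrow> S y y = 0"
  shows "0 \<le> (\<integral>y. g y * v y \<partial>m)"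
proof -
  obtain G where G: "\<And>p. (\<lambda>x. S x p) \<in> C0inf U"
    "\<And>t p. t \<ge> 0 \<Longrightarrow> AE y in m. T t (\<lambda>x. S x p) y = G t p y"
    "\<And>t y. continuous_on UNIV (\<lambda>p. G t p y)"
    "((\<lambda>t. \<integral>y. (G t y y - S y y) / t * v y \<partial>m) \<longlongrightarrow> (\<integral>y. g y * v y \<partial>m)) (at_right 0)"
    using tens_semigroup[OF S] v(1) by blast
  \<comment> \<open>Countability lets the exceptional null sets be united; density in the support of
    \<open>v\<close> then reaches every \<open>p\<close> that is tested.\<close>
  obtain D where D: "countable D" "D \<subseteq> tsupp v" "tsupp v \<subseteq> closure D"
    using separable by metis
  have "0 \<le> (\<integral>y. (G t y y - S y y) / t * v y \<partial>m)" if t: "t > 0" for t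
  proof (rule integral_nonneg_AE)
    have "AE y in m. 0 \<le> G t p y" if "p \<in> D" for p
    proof -
      have "AE y in m. 0 \<le> T t (\<lambda>x. S x p) y"
        using G(1)[of p] C0inf_DA pos[of p] D(2) that t by (intro T_nonneg) auto
      with G(2)[of t p] t show ?thesis by (auto elim: eventually_elim2)
    qed
    hence "AE y in m. \<forall>p\<in>D. 0 \<le> G t p y" using D(1) by (simp add: AE_ball_countable)
    thus "AE y in m. 0 \<le> (G t y y - S y y) / t * v y"
    proof eventually_elim
      case (elim y)
      show ?case
      proof (cases "y \<in> tsupp v")
        case True
        have "closed {p. 0 \<le> G t p y}" by (intro closed_Collect_le G continuous_on_const)
        hence "closure D \<subseteq> {p. 0 \<le> G t p y}" using elim by (intro closure_minimal) auto
        hence "0 \<le> G t y y" using True D by auto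
        thus ?thesis using diag[OF True] v t by simp
      qed (simp add: tsupp_zero)
    qed
  qed
  thus ?thesis using eventually_right_pos
    by (intro tendsto_lowerbound[OF G(4)]) (auto elim: eventually_mono)
qed

text \<open>Disjoint supports make the first factor zero on a neighbourhood of the support of the
  second. This is the constancy that the definition of \<open>J\<close> and \<open>K\<close> asks
  for, with constant 0.\<close>

inductive offtens :: "(real^'n \<Rightarrow> real^'n \<Rightarrow> real) \<Rightarrow> (real^'n \<Rightarrow> real) \<Rightarrow> bool" where
  zero: "offtens (\<lambda>x y. 0) (\<lambda>y. 0)"
| step: "a \<in> C0inf U \<Longrightarrow> smooth b \<Longrightarrow> tsupp a \<inter> tsupp b = {} \<Longrightarrow> offtens S g \<Longrightarrow>
    offtens (\<lambda>x y. S x y + a x * b y) (\<lambda>y. g y + b y * A a y)"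

lemma offtens_tens: "offtens S g \<Longrightarrow> tens S g"
  by (induction rule: offtens.induct) (auto intro: tens.intros)

lemma offtens_single:
  "a \<in> C0inf U \<Longrightarrow> smooth b \<Longrightarrow> tsupp a \<inter> tsupp b = {} \<Longrightarrow> offtens (\<lambda>x y. a x * b y) (\<lambda>y. b y * A a y)"
  using offtens.step[OF _ _ _ offtens.zero] by simp

lemma offtens_add:
  assumes "offtens S g" shows "offtens S' g' \<Longrightarrow> offtens (\<lambda>x y. S x y + S' x y) (\<lambda>y. g y + g' y)"
proof (induction rule: offtens.induct)
  case (step a b S' g')
  from offtens.step[OF step(1,2,3,5)] show ?case by (simp add: add.assoc)
qed (use assms in simp)

lemma offtens_cmult: "offtens S g \<Longrightarrow> offtens (\<lambda>x y. c * S x y) (\<lambda>y. c * g y)"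
proof (induction rule: offtens.induct)
  case (step a b S g)
  have "tsupp (\<lambda>y. c * b y) \<subseteq> tsupp b" by (rule tsupp_subsetI) (simp_all add: tsupp_zero closed_tsupp)
  hence d: "tsupp a \<inter> tsupp (\<lambda>y. c * b y) = {}" using step(3) by auto
  have "smooth (\<lambda>y. c * b y)" by (intro smooth_mult smooth_const step)
  from offtens.step[OF step(1) this d step(5)] show ?case by (simp add: algebra_simps)
qed (use offtens.zero in simp)

lemma offtens_mult_single:
  assumes "a \<in> C0inf U" "smooth b" "tsupp a \<inter> tsupp b = {}"
  shows "tens S g \<Longrightarrow> \<exists>g'. offtens (\<lambda>x y. S x y * (a x * b y)) g'"
proof (induction rule: tens.induct)
  case zero
  show ?case using offtens.zero by auto
next
  case (step c d S g)
  then obtain g' where g': "offtens (\<lambda>x y. S x y * (a x * b y)) g'" by blast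
  have "tsupp (\<lambda>x. c x * a x) \<subseteq> tsupp a" "tsupp (\<lambda>x. d x * b x) \<subseteq> tsupp b"
    by (rule tsupp_subsetI[OF closed_tsupp], simp add: tsupp_zero)+
  hence d: "tsupp (\<lambda>x. c x * a x) \<inter> tsupp (\<lambda>x. d x * b x) = {}" using assms(3) by auto
  have "(\<lambda>x. c x * a x) \<in> C0inf U" "smooth (\<lambda>x. d x * b x)"
    by (intro C0inf_mult_left smooth_mult C0infD(1)[OF step(1)] step(2) assms)+
  from offtens.step[OF this d g'] show ?case
    by (intro exI) (simp add: algebra_simps)
qed

text \<open>Off-diagonal tensors form an ideal among the tensors, since multiplying a factor by a
  smooth function can only shrink its support. The function \<open>h\<close> is left unspecified
  because its integrals against test functions are determined by \<open>J\<close>.\<close>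

lemma offtens_mult:
  assumes "tens S g" shows "offtens \<tau> g' \<Longrightarrow> \<exists>h. offtens (\<lambda>x y. S x y * \<tau> x y) h"
proof (induction rule: offtens.induct)
  case zero
  show ?case using offtens.zero by auto
next
  case (step a b \<tau> g')
  then obtain h1 h2 where "offtens (\<lambda>x y. S x y * \<tau> x y) h1" "offtens (\<lambda>x y. S x y * (a x * b y)) h2"
    using offtens_mult_single[OF step(1-3) assms] by blast
  from offtens_add[OF this] show ?case by (auto simp: distrib_left)
qed

lemma jump_kill_formula:
  assumes "u \<in> C0inf U" "v \<in> C0inf U" "open N" "tsupp v \<subseteq> N" "\<forall>x\<in>N. u x = c"
  shows "integrable J (\<lambda>(x, y). 2 * (u y - u x) * v y)" "integrable K (\<lambda>x. u x * v x)"
    "- (\<integral>x. A u x * v x \<partial>m) = (\<integral>(x, y). 2 * (u y - u x) * v y \<partial>J) + (\<integral>x. u x * v x \<partial>K)"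
proof -
  have ex: "\<exists>N c. open N \<and> tsupp v \<subseteq> N \<and> (\<forall>x\<in>N. u x = c)"
    using assms(3-5) by (intro exI[of _ N] exI[of _ c]) auto
  note * = JK[unfolded jump_kill_def l2_inner_def, THEN conjunct2, THEN conjunct2,
      THEN bspec, OF assms(1), THEN bspec, OF assms(2), THEN mp, OF ex]
  show "integrable J (\<lambda>(x, y). 2 * (u y - u x) * v y)" "integrable K (\<lambda>x. u x * v x)"
    "- (\<integral>x. A u x * v x \<partial>m) = (\<integral>(x, y). 2 * (u y - u x) * v y \<partial>J) + (\<integral>x. u x * v x \<partial>K)"
    using * by simp_all
qed

text \<open>Near the support of \<open>b * v\<close> the function \<open>a\<close> is zero, so the
  defining identity of \<open>J\<close> and \<open>K\<close> applies to this pair. The products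
  \<open>a y * b y\<close> vanish, which removes the \<open>K\<close> term and the part of the
  \<open>J\<close> integrand taken at \<open>y\<close> and leaves -2 a(x) b(y) v(y); this is the
  origin of the factor 2.\<close>

lemma offtens_jump:
  assumes v: "v \<in> C0inf U"
  shows "offtens S g \<Longrightarrow> integrable J (\<lambda>(x, y). S x y * v y) \<and>
    (\<integral>y. g y * v y \<partial>m) = 2 * (\<integral>(x, y). S x y * v y \<partial>J)"
proof (induction rule: offtens.induct)
  case (step a b S g)
  have bv: "(\<lambda>y. b y * v y) \<in> C0inf U" using step v by (intro C0inf_mult_left)
  have "tsupp (\<lambda>y. b y * v y) \<subseteq> tsupp b" by (rule tsupp_subsetI) (simp_all add: tsupp_zero closed_tsupp)
  hence sub: "tsupp (\<lambda>y. b y * v y) \<subseteq> - tsupp a" using step by blast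
  have ab: "a y * b y = 0" for y
    using step(3) tsupp_zero[of y a] tsupp_zero[of y b] by (cases "y \<in> tsupp a") auto
  have opn: "open (- tsupp a)" by (simp add: closed_tsupp open_Compl)
  have a0: "\<forall>x\<in>- tsupp a. a x = 0" by (simp add: tsupp_zero)
  note jk = jump_kill_formula[OF step(1) bv opn sub a0]
  have e1: "2 * (a y - a x) * (b y * v y) = (- 2) * (a x * b y * v y)" for x y
  proof -
    have "2 * (a y - a x) * (b y * v y) = 2 * (a y * b y) * v y + (- 2) * (a x * b y * v y)"
      by (simp add: algebra_simps)
    thus ?thesis by (simp add: ab)
  qed
  have i: "integrable J (\<lambda>(x, y). a x * b y * v y)"
    using jk(1) unfolding e1 by (simp add: split_def)
  have "- (\<integral>x. A a x * (b x * v x) \<partial>m) = - 2 * (\<integral>(x, y). a x * b y * v y \<partial>J)"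
  proof -
    have "(\<lambda>x. a x * (b x * v x)) = (\<lambda>x. 0)"
    proof (rule ext)
      fix x show "a x * (b x * v x) = 0" using ab[of x] by auto
    qed
    hence "(\<integral>x. a x * (b x * v x) \<partial>K) = 0" by simp
    thus ?thesis using jk(3) unfolding e1 by (simp add: split_def)
  qed
  hence e2: "(\<integral>x. b x * A a x * v x \<partial>m) = 2 * (\<integral>(x, y). a x * b y * v y \<partial>J)"
    by (simp add: mult_ac)
  have i2: "integrable m (\<lambda>y. b y * A a y * v y)"
    using tens_integrable[OF v tens_single[OF step(1,2)]] .
  show ?case using step.IH i i2 e2 tens_integrable[OF v offtens_tens[OF step(4)]]
    by (simp add: split_def distrib_right)
qed simp

end

section \<open>Cutting off the diagonal\<close>

context dirichlet_form_on
begin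

lemma AE_J_offdiag: "AE z in J. z \<in> offdiag U"
proof (rule AE_I)
  have "closed {z :: (real^'n) \<times> (real^'n). fst z = snd z}"
    by (intro closed_Collect_eq continuous_intros)
  moreover have "{z :: (real^'n) \<times> (real^'n). fst z = snd z} = {(x, y). x = y}" by auto
  ultimately have "open (offdiag U)"
    unfolding offdiag_def by (intro open_Diff open_Times U) simp
  hence "- offdiag U \<in> sets borel" by (intro borel_closed) (simp add: closed_def)
  thus "- offdiag U \<in> sets J" by simp
  show "emeasure J (- offdiag U) = 0" using JK by (simp add: jump_kill_def radon_on_def)
qed auto

text \<open>Locally, two bumps with disjoint supports around distinct points give such a cutoff. Two
  cutoffs combine to 1 - (1 - \<tau>1)(1 - \<tau>2), which is one wherever either of them is, stays
  in [0, 1], and is an off-diagonal tensor by the ideal property. Compactness of \<open>C\<close>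
  reduces to finitely many.\<close>

lemma offtens_cutoff:
  assumes C: "compact C" "\<And>x y. (x, y) \<in> C \<Longrightarrow> x \<in> U \<and> x \<noteq> y"
  shows "\<exists>\<tau> g. offtens \<tau> g \<and> (\<forall>x y. 0 \<le> \<tau> x y \<and> \<tau> x y \<le> 1) \<and> (\<forall>(x, y)\<in>C. \<tau> x y = 1)"
proof -
  define P where "P = (\<lambda>C. \<exists>\<tau> g. offtens \<tau> g \<and> (\<forall>x y. 0 \<le> \<tau> x y \<and> \<tau> x y \<le> 1) \<and> (\<forall>(x, y)\<in>C. \<tau> x y = 1))"
  have P_empty: "P {}" unfolding P_def using offtens.zero by fastforce
  have P_mono: "P C' \<Longrightarrow> D \<subseteq> C' \<Longrightarrow> P D" for C' D unfolding P_def by blast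
  have P_un: "P (C1 \<union> C2)" if P12: "P C1" "P C2" for C1 C2
  proof -
    obtain \<tau>1 g1 where 1: "offtens \<tau>1 g1" "\<And>x y. 0 \<le> \<tau>1 x y" "\<And>x y. \<tau>1 x y \<le> 1" "\<forall>(x, y)\<in>C1. \<tau>1 x y = 1"
      using P12(1) unfolding P_def by auto
    obtain \<tau>2 g2 where 2: "offtens \<tau>2 g2" "\<And>x y. 0 \<le> \<tau>2 x y" "\<And>x y. \<tau>2 x y \<le> 1" "\<forall>(x, y)\<in>C2. \<tau>2 x y = 1"
      using P12(2) unfolding P_def by auto
    obtain h where h: "offtens (\<lambda>x y. \<tau>1 x y * \<tau>2 x y) h"
      using offtens_mult[OF offtens_tens[OF 1(1)] 2(1)] by auto
    have o: "offtens (\<lambda>x y. \<tau>1 x y + \<tau>2 x y + - 1 * (\<tau>1 x y * \<tau>2 x y)) (\<lambda>y. g1 y + g2 y + - 1 * h y)"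
      by (intro offtens_add[OF offtens_add[OF 1(1) 2(1)] offtens_cmult[OF h]])
    have e: "a + b + - 1 * (a * b) = 1 - (1 - a) * (1 - b)" for a b :: real by (simp add: algebra_simps)
    have "0 \<le> (1 - \<tau>1 x y) * (1 - \<tau>2 x y) \<and> (1 - \<tau>1 x y) * (1 - \<tau>2 x y) \<le> 1" for x y
      using 1(2,3)[of x y] 2(2,3)[of x y] by (auto intro!: mult_nonneg_nonneg mult_le_one)
    hence "\<forall>x y. 0 \<le> \<tau>1 x y + \<tau>2 x y + - 1 * (\<tau>1 x y * \<tau>2 x y) \<and> \<tau>1 x y + \<tau>2 x y + - 1 * (\<tau>1 x y * \<tau>2 x y) \<le> 1"
      unfolding e by simp
    moreover have "\<forall>(x, y)\<in>C1 \<union> C2. \<tau>1 x y + \<tau>2 x y + - 1 * (\<tau>1 x y * \<tau>2 x y) = 1"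
      unfolding e using 1(4) 2(4) by auto
    ultimately show ?thesis unfolding P_def using o by blast
  qed
  have local: "\<exists>W. open W \<and> z \<in> W \<and> P W" if "z \<in> C" for z
  proof -
    obtain p q where z: "z = (p, q)" by (cases z)
    have pq: "p \<in> U" "p \<noteq> q" using C(2) that z by auto
    define r where "r = dist p q / 2"
    have r: "r > 0" using pq by (simp add: r_def)
    have disj: "ball p r \<inter> ball q r = {}"
    proof (rule equals0I)
      fix x assume "x \<in> ball p r \<inter> ball q r"
      hence "dist p x < r" "dist q x < r" by auto
      thus False using dist_triangle[of p q x] by (simp add: r_def dist_commute)
    qed
    obtain a N where a: "a \<in> C0inf (U \<inter> ball p r)" "\<And>x. 0 \<le> a x" "\<And>x. a x \<le> 1" "open N" "{p} \<subseteq> N" "\<And>x. x \<in> N \<Longrightarrow> a x = 1"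
      by (rule cutoff_exists[of "{p}" "U \<inter> ball p r"]) (use pq r U in auto)
    obtain b M where b: "b \<in> C0inf (ball q r)" "\<And>x. 0 \<le> b x" "\<And>x. b x \<le> 1" "open M" "{q} \<subseteq> M" "\<And>x. x \<in> M \<Longrightarrow> b x = 1"
      by (rule cutoff_exists[of "{q}" "ball q r"]) (use pq r in auto)
    have "tsupp a \<inter> tsupp b = {}" using C0infD(3)[OF a(1)] C0infD(3)[OF b(1)] disj by auto
    moreover have "a \<in> C0inf U" using a(1) C0inf_mono[of "U \<inter> ball p r" U] by auto
    ultimately have o: "offtens (\<lambda>x y. a x * b y) (\<lambda>y. b y * A a y)"
      using C0infD(1)[OF b(1)] by (intro offtens_single)
    have "0 \<le> a x * b y \<and> a x * b y \<le> 1" for x y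
      using a(2,3)[of x] b(2,3)[of y] by (auto intro: mult_le_one)
    moreover have "\<forall>(x, y)\<in>N \<times> M. a x * b y = 1" using a(6) b(6) by auto
    ultimately have "P (N \<times> M)" unfolding P_def using o by blast
    thus ?thesis using a(4,5) b(4,5) z by (intro exI[of _ "N \<times> M"]) (auto intro: open_Times)
  qed
  then obtain W where W: "\<And>z. z \<in> C \<Longrightarrow> open (W z) \<and> z \<in> W z \<and> P (W z)" by metis
  obtain D where D: "finite D" "D \<subseteq> C" "C \<subseteq> (\<Union>z\<in>D. W z)"
    using compactE_image[OF C(1), of C W] W by (metis (no_types, lifting) UN_iff subsetI)
  have "P (\<Union>z\<in>D. W z)" using D(1,2)
    by (induction D rule: finite_induct) (auto intro!: P_empty P_un W[THEN conjunct2, THEN conjunct2])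
  hence "P C" using D(3) P_mono by blast
  thus ?thesis unfolding P_def .
qed

lemma compact_off_strip:
  fixes X F :: "(real^'n) set"
  assumes "compact X" "compact F"
  shows "compact {(x, y) \<in> X \<times> F. \<rho> \<le> dist x y}"
proof -
  have "closed {z :: (real^'n) \<times> (real^'n). \<rho> \<le> dist (fst z) (snd z)}"
    by (intro closed_Collect_le continuous_intros)
  moreover have "{(x, y) \<in> X \<times> F. \<rho> \<le> dist x y} = (X \<times> F) \<inter> {z. \<rho> \<le> dist (fst z) (snd z)}" by auto
  ultimately show ?thesis using compact_Int_closed[OF compact_Times[OF assms]] by simp
qed

lemma offtens_strip_cutoff:
  assumes "compact X" "X \<subseteq> U" "compact F" "\<rho> > 0"
  obtains \<tau> g where "offtens \<tau> g" "\<And>x y. 0 \<le> \<tau> x y" "\<And>x y. \<tau> x y \<le> 1"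
    "\<And>x y. x \<in> X \<Longrightarrow> y \<in> F \<Longrightarrow> \<rho> \<le> dist x y \<Longrightarrow> \<tau> x y = 1"
proof -
  have "\<exists>\<tau> g. offtens \<tau> g \<and> (\<forall>x y. 0 \<le> \<tau> x y \<and> \<tau> x y \<le> 1) \<and>
      (\<forall>(x, y)\<in>{(x, y) \<in> X \<times> F. \<rho> \<le> dist x y}. \<tau> x y = 1)"
    by (rule offtens_cutoff[OF compact_off_strip[OF assms(1,3)]]) (use assms in auto)
  thus ?thesis using that by auto
qed

text \<open>Take cutoffs \<tau>_n that are one, over the supports, outside the strip |x - y| < 1/(n
  + 1). The remainder S - S \<tau>_n is nonnegative and zero on the diagonal, so positivity bounds 2
  \<integral> S \<tau>_n v dJ by the integral of \<open>g y * v y\<close>. Fatou's lemma passes to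
  the limit because \<open>J\<close> does not charge the diagonal.\<close>

lemma tens_jump_le:
  assumes S: "tens S g" and v: "v \<in> C0inf U" "\<And>y. v y \<ge> 0"
    and pos: "\<And>x y. y \<in> tsupp v \<Longrightarrow> S x y \<ge> 0" and diag: "\<And>y. y \<in> tsupp v \<Longrightarrow> S y y = 0"
  shows "integrable J (\<lambda>(x, y). S x y * v y)"
    and "2 * (\<integral>(x, y). S x y * v y \<partial>J) \<le> (\<integral>y. g y * v y \<partial>m)"
proof -
  obtain X where X: "compact X" "X \<subseteq> U" "\<And>x y. x \<notin> X \<Longrightarrow> S x y = 0"
    using tens_support[OF S] by metis
  have F: "compact (tsupp v)" using C0infD[OF v(1)] by simp
  have "\<exists>\<tau> g. offtens \<tau> g \<and> (\<forall>x y. 0 \<le> \<tau> x y \<and> \<tau> x y \<le> 1 \<and>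
      (x \<in> X \<longrightarrow> y \<in> tsupp v \<longrightarrow> inverse (real (Suc n)) \<le> dist x y \<longrightarrow> \<tau> x y = 1))" for n
    using offtens_strip_cutoff[OF X(1,2) F, of "inverse (real (Suc n))"]
    by (metis inverse_positive_iff_positive of_nat_0_less_iff zero_less_Suc)
  then obtain \<tau> h where \<tau>: "\<And>n. offtens (\<tau> n) (h n)" "\<And>n x y. 0 \<le> \<tau> n x y" "\<And>n x y. \<tau> n x y \<le> 1"
    "\<And>n x y. x \<in> X \<Longrightarrow> y \<in> tsupp v \<Longrightarrow> inverse (real (Suc n)) \<le> dist x y \<Longrightarrow> \<tau> n x y = 1"
    by metis
  define I where "I = (\<integral>y. g y * v y \<partial>m)"
  have Sv: "0 \<le> S x y * v y" for x y
    using pos[of y x] v(2)[of y] tsupp_zero[of y v] by (cases "y \<in> tsupp v") auto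
  have ineq: "integrable J (\<lambda>(x, y). S x y * \<tau> n x y * v y) \<and> 2 * (\<integral>(x, y). S x y * \<tau> n x y * v y \<partial>J) \<le> I" for n
  proof -
    obtain k where k: "offtens (\<lambda>x y. S x y * \<tau> n x y) k" using offtens_mult[OF S \<tau>(1)] by blast
    have "0 \<le> (\<integral>y. (g y - k y) * v y \<partial>m)"
    proof (rule tens_nonneg[OF tens_diff[OF S offtens_tens[OF k]] v])
      fix x y assume y: "y \<in> tsupp v"
      have "S x y * \<tau> n x y \<le> S x y * 1" using pos[OF y] \<tau> by (intro mult_left_mono) auto
      thus "0 \<le> S x y - S x y * \<tau> n x y" by simp
    qed (use diag in auto)
    also have "\<dots> = I - (\<integral>y. k y * v y \<partial>m)"
      using tens_integrable[OF v(1) S] tens_integrable[OF v(1) offtens_tens[OF k]]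
      by (simp add: I_def left_diff_distrib)
    finally show ?thesis using offtens_jump[OF v(1) k] by simp
  qed
  have meas: "(\<lambda>z. S (fst z) (snd z) * v (snd z)) \<in> borel_measurable borel"
    "(\<lambda>z. S (fst z) (snd z) * \<tau> n (fst z) (snd z) * v (snd z)) \<in> borel_measurable borel" for n
    using tens_measurable[OF S] tens_measurable[OF offtens_tens[OF \<tau>(1)[of n]]]
      smooth_snd_measurable[OF C0infD(1)[OF v(1)]] by measurable
  have lim: "AE z in J. (\<lambda>n. S (fst z) (snd z) * \<tau> n (fst z) (snd z) * v (snd z)) \<longlonglongrightarrow> S (fst z) (snd z) * v (snd z)"
    using AE_J_offdiag
  proof eventually_elim
    case (elim z)
    obtain x y where z: "z = (x, y)" by (cases z)
    have xy: "x \<noteq> y" using elim z by (auto simp: offdiag_def)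
    have "eventually (\<lambda>n. S x y * \<tau> n x y * v y = S x y * v y) sequentially"
    proof (cases "x \<in> X \<and> y \<in> tsupp v")
      case True
      have "eventually (\<lambda>n. inverse (real (Suc n)) < dist x y) sequentially"
        using LIMSEQ_inverse_real_of_nat xy by (intro order_tendstoD(2)[of _ 0]) auto
      thus ?thesis by eventually_elim (use True in \<open>simp add: \<tau>(4)\<close>)
    qed (auto simp: X(3) tsupp_zero)
    thus ?case unfolding z by (simp add: tendsto_eventually)
  qed
  have I0: "0 \<le> I" using tens_nonneg[OF S v pos diag] by (simp add: I_def)
  have "(\<integral>\<^sup>+z. ennreal (S (fst z) (snd z) * v (snd z)) \<partial>J)
      = (\<integral>\<^sup>+z. liminf (\<lambda>n. ennreal (S (fst z) (snd z) * \<tau> n (fst z) (snd z) * v (snd z))) \<partial>J)"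
  proof (rule nn_integral_cong_AE)
    show "AE z in J. ennreal (S (fst z) (snd z) * v (snd z))
        = liminf (\<lambda>n. ennreal (S (fst z) (snd z) * \<tau> n (fst z) (snd z) * v (snd z)))"
      using lim
    proof eventually_elim
      case (elim z)
      from tendsto_ennrealI[OF elim] show ?case by (intro lim_imp_Liminf[symmetric]) auto
    qed
  qed
  also have "\<dots> \<le> liminf (\<lambda>n. \<integral>\<^sup>+z. ennreal (S (fst z) (snd z) * \<tau> n (fst z) (snd z) * v (snd z)) \<partial>J)"
    using meas by (intro nn_integral_liminf) (auto simp: measurable_cong_sets[OF sets_J refl])
  also have "\<dots> \<le> liminf (\<lambda>n::nat. ennreal (I / 2))"
  proof (intro Liminf_mono always_eventually allI)
    fix n
    have nn: "0 \<le> S x y * \<tau> n x y * v y" for x y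
      using mult_nonneg_nonneg[OF Sv[of x y] \<tau>(2)[of n x y]] by (simp add: mult_ac)
    have "(\<integral>\<^sup>+z. ennreal (S (fst z) (snd z) * \<tau> n (fst z) (snd z) * v (snd z)) \<partial>J)
        = ennreal (\<integral>z. S (fst z) (snd z) * \<tau> n (fst z) (snd z) * v (snd z) \<partial>J)"
      using ineq[of n] nn by (intro nn_integral_eq_integral) (auto simp: split_def)
    also have "\<dots> \<le> ennreal (I / 2)" using ineq[of n] by (intro ennreal_leI) (simp add: split_def)
    finally show "(\<integral>\<^sup>+z. ennreal (S (fst z) (snd z) * \<tau> n (fst z) (snd z) * v (snd z)) \<partial>J) \<le> ennreal (I / 2)" .
  qed
  also have "\<dots> = ennreal (I / 2)" by (simp add: Liminf_const)
  finally have fin: "(\<integral>\<^sup>+z. ennreal (S (fst z) (snd z) * v (snd z)) \<partial>J) \<le> ennreal (I / 2)" .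
  have int: "integrable J (\<lambda>z. S (fst z) (snd z) * v (snd z))"
    using meas(1) fin Sv
    by (intro integrableI_nonneg) (auto simp: measurable_cong_sets[OF sets_J refl] intro: le_less_trans)
  thus "integrable J (\<lambda>(x, y). S x y * v y)" by (simp add: split_def)
  have "ennreal (\<integral>z. S (fst z) (snd z) * v (snd z) \<partial>J) \<le> ennreal (I / 2)"
    using nn_integral_eq_integral[OF int] Sv fin by simp
  thus "2 * (\<integral>(x, y). S x y * v y \<partial>J) \<le> (\<integral>y. g y * v y \<partial>m)"
    using I0 by (simp add: split_def I_def ennreal_le_iff)
qed

section \<open>First and second moments with a cutoff\<close>

lemma C0inf_coord: "\<kappa> \<in> C0inf S \<Longrightarrow> (\<lambda>x. x $ i * \<kappa> x) \<in> C0inf S"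
  by (intro C0inf_mult_left smooth_coord)

text \<open>The value at x = y of \<open>A\<close> applied in \<open>x\<close> to
  \<open>(x $ i - y $ i) * \<kappa> x\<close>, with the coefficients in \<open>y\<close> taken out:
  a drift coefficient that still contains the jumps let through by \<open>\<kappa>\<close>.\<close>

definition d1 :: "(real^'n \<Rightarrow> real) \<Rightarrow> 'n \<Rightarrow> real^'n \<Rightarrow> real" where
  "d1 \<kappa> i y = A (\<lambda>x. x $ i * \<kappa> x) y - y $ i * A \<kappa> y"

text \<open>The same for \<open>(x $ i - y $ i) * (x $ j - y $ j) * \<kappa> x\<close>: the
  localized carre du champ of two coordinates, with its jump part still included.\<close>

definition d2 :: "(real^'n \<Rightarrow> real) \<Rightarrow> 'n \<Rightarrow> 'n \<Rightarrow> real^'n \<Rightarrow> real" where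
  "d2 \<kappa> i j y = A (\<lambda>x. x $ i * (x $ j * \<kappa> x)) y - y $ i * A (\<lambda>x. x $ j * \<kappa> x) y
     - y $ j * A (\<lambda>x. x $ i * \<kappa> x) y + y $ i * y $ j * A \<kappa> y"

lemma tens_d1:
  assumes "\<kappa> \<in> C0inf U" shows "tens (\<lambda>x y. (x $ i - y $ i) * \<kappa> x) (d1 \<kappa> i)"
proof -
  have "tens (\<lambda>x y. (x $ i * \<kappa> x) * 1 - \<kappa> x * y $ i) (\<lambda>y. 1 * A (\<lambda>x. x $ i * \<kappa> x) y - y $ i * A \<kappa> y)"
    by (intro tens_diff tens_single C0inf_coord assms smooth_const smooth_coord)
  thus ?thesis by (simp add: d1_def[abs_def] algebra_simps)
qed

lemma tens_d2:
  assumes "\<kappa> \<in> C0inf U" shows "tens (\<lambda>x y. (x $ i - y $ i) * (x $ j - y $ j) * \<kappa> x) (d2 \<kappa> i j)"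
proof -
  have "tens (\<lambda>x y. (x $ i * (x $ j * \<kappa> x)) * 1 - (x $ j * \<kappa> x) * y $ i - (x $ i * \<kappa> x) * y $ j + \<kappa> x * (y $ i * y $ j))
     (\<lambda>y. 1 * A (\<lambda>x. x $ i * (x $ j * \<kappa> x)) y - y $ i * A (\<lambda>x. x $ j * \<kappa> x) y
     - y $ j * A (\<lambda>x. x $ i * \<kappa> x) y + (y $ i * y $ j) * A \<kappa> y)"
    by (intro tens_diff tens_add tens_single C0inf_coord assms smooth_const smooth_coord smooth_mult)
  thus ?thesis by (simp add: d2_def[abs_def] algebra_simps)
qed

lemma tens_dist2:
  assumes "\<kappa> \<in> C0inf U"
  shows "tens (\<lambda>x y. (dist x y)\<^sup>2 * \<kappa> x) (\<lambda>y. \<Sum>i\<in>UNIV. d2 \<kappa> i i y)"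
  unfolding dist_power2_vec sum_distrib_right by (intro tens_sum tens_d2 assms)

lemma jump_dist2_integrable:
  assumes "\<kappa> \<in> C0inf U" "\<And>x. 0 \<le> \<kappa> x" "v \<in> C0inf U" "\<And>x. 0 \<le> v x"
  shows "integrable J (\<lambda>(x, y). (dist x y)\<^sup>2 * \<kappa> x * v y)"
  using assms by (intro tens_jump_le(1)[OF tens_dist2]) auto

text \<open>Cutoffs \<open>\<kappa>\<close> and \<open>\<eta>\<close> around \<open>X\<close> and
  \<open>F\<close> give the integrable majorant |C| |x - y|^2 \<kappa>(x) \<eta>(y).\<close>

lemma jump_integrable:
  assumes f: "f \<in> borel_measurable borel" and X: "compact X" "X \<subseteq> U" and F: "compact F" "F \<subseteq> U"
    and zero: "\<And>x y. x \<notin> X \<or> y \<notin> F \<Longrightarrow> f (x, y) = 0"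
    and bound: "\<And>x y. x \<in> X \<Longrightarrow> y \<in> F \<Longrightarrow> \<bar>f (x, y)\<bar> \<le> C * (dist x y)\<^sup>2"
  shows "integrable J f"
proof -
  obtain \<kappa> N where \<kappa>: "\<kappa> \<in> C0inf U" "\<And>x. 0 \<le> \<kappa> x" "X \<subseteq> N" "\<And>x. x \<in> N \<Longrightarrow> \<kappa> x = 1"
    using cutoff_exists[OF X U] by metis
  obtain \<eta> M where \<eta>: "\<eta> \<in> C0inf U" "\<And>x. 0 \<le> \<eta> x" "F \<subseteq> M" "\<And>x. x \<in> M \<Longrightarrow> \<eta> x = 1"
    using cutoff_exists[OF F U] by metis
  have "integrable J (\<lambda>z. \<bar>C\<bar> * (case z of (x, y) \<Rightarrow> (dist x y)\<^sup>2 * \<kappa> x * \<eta> y))"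
    using jump_dist2_integrable[OF \<kappa>(1,2) \<eta>(1,2)] by (intro integrable_mult_right)
  thus ?thesis
  proof (rule Bochner_Integration.integrable_bound)
    show "f \<in> borel_measurable J" using f by (simp add: measurable_cong_sets[OF sets_J refl])
    have "\<bar>f (x, y)\<bar> \<le> \<bar>C\<bar> * ((dist x y)\<^sup>2 * \<kappa> x * \<eta> y)" for x y
    proof (cases "x \<in> X \<and> y \<in> F")
      case True
      hence "\<kappa> x = 1" "\<eta> y = 1" using \<kappa> \<eta> by auto
      moreover have "\<bar>f (x, y)\<bar> \<le> \<bar>C\<bar> * (dist x y)\<^sup>2"
        using True by (intro order.trans[OF bound] mult_right_mono) auto
      ultimately show ?thesis by simp
    next
      case False
      thus ?thesis using zero[of x y] \<kappa>(2)[of x] \<eta>(2)[of y] by auto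
    qed
    thus "AE z in J. norm (f z) \<le> norm (\<bar>C\<bar> * (case z of (x, y) \<Rightarrow> (dist x y)\<^sup>2 * \<kappa> x * \<eta> y))"
      by (auto intro!: AE_I2 intro: order.trans[OF _ abs_ge_self])
  qed
qed

text \<open>A tensor that is \<open>o(|x - y|\<^sup>2)\<close> at the diagonal sees only the jump measure: cutting it off near the
  diagonal leaves a remainder dominated by \<open>\<epsilon>|x - y|\<^sup>2\<close>, whose action is \<open>O(\<epsilon>)\<close> by positivity.\<close>

theorem tens_local:
  assumes S: "tens S g" and v: "v \<in> C0inf U"
    and small: "\<And>\<epsilon>. \<epsilon> > 0 \<Longrightarrow> \<exists>\<rho>>0. \<forall>x. \<forall>y\<in>tsupp v. dist x y < \<rho> \<longrightarrow> \<bar>S x y\<bar> \<le> \<epsilon> * (dist x y)\<^sup>2"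
  shows "integrable J (\<lambda>(x, y). S x y * v y)"
    and "(\<integral>y. g y * v y \<partial>m) = 2 * (\<integral>(x, y). S x y * v y \<partial>J)"
proof -
  define F where "F = tsupp v"
  have F: "compact F" "F \<subseteq> U" using C0infD[OF v] by (auto simp: F_def)
  obtain X where X: "compact X" "X \<subseteq> U" "\<And>x y. x \<notin> X \<Longrightarrow> S x y = 0"
    using tens_support[OF S] by metis
  obtain \<kappa> N where \<kappa>: "\<kappa> \<in> C0inf U" "\<And>x. 0 \<le> \<kappa> x" "X \<subseteq> N" "\<And>x. x \<in> N \<Longrightarrow> \<kappa> x = 1"
    using cutoff_exists[OF X(1,2) U] by metis
  obtain h M where h: "h \<in> C0inf U" "\<And>x. 0 \<le> h x" "F \<subseteq> M" "\<And>x. x \<in> M \<Longrightarrow> h x = 1"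
    using cutoff_exists[OF F U] by metis
  obtain B where B: "B > 0" "\<And>y. \<bar>v y\<bar> \<le> B" using C0inf_bounded[OF v] by metis
  \<comment> \<open>\<open>v\<close> may change sign, whereas positivity wants a nonnegative test
    function. So \<open>v\<close> is absorbed into the tensor, and the test function becomes
    \<open>h\<close>, which is one on the support of \<open>v\<close>.\<close>
  define S' where "S' = (\<lambda>x y. S x y * v y)"
  define g' where "g' = (\<lambda>y. g y * v y)"
  have S': "tens S' g'" unfolding S'_def g'_def by (intro tens_ymult S C0infD(1)[OF v])
  have vh: "v y * h y = v y" for y using h tsupp_zero[of y v] by (cases "y \<in> F") (auto simp: F_def)
  define Q where "Q = (\<lambda>x y. (dist x y)\<^sup>2 * \<kappa> x)"
  define q where "q = (\<lambda>y. \<Sum>i\<in>UNIV. d2 \<kappa> i i y)"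
  have Q: "tens Q q" "Q x y \<ge> 0" "Q y y = 0" for x y
    unfolding Q_def q_def using \<kappa> by (auto intro: tens_dist2)
  have iQ: "integrable J (\<lambda>(x, y). Q x y * h y)"
    unfolding Q_def using \<kappa> h by (intro jump_dist2_integrable)
  define c where "c = (\<integral>y. q y * h y \<partial>m)"
  define a where "a = (\<integral>y. g' y * h y \<partial>m)"
  define b where "b = (\<integral>(x, y). S' x y * h y \<partial>J)"
  have c0: "c \<ge> 0" unfolding c_def using Q(2,3) h(2) by (intro tens_nonneg[OF Q(1) h(1)]) auto
  have main: "integrable J (\<lambda>(x, y). S' x y * h y) \<and> \<bar>a - 2 * b\<bar> \<le> \<epsilon> * c" if \<epsilon>: "\<epsilon> > 0" for \<epsilon>
  proof -
    \<comment> \<open>Dividing by \<open>B\<close> pays for the factor \<open>v\<close> contained in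
      \<open>S'\<close>.\<close>
    have "\<epsilon> / B > 0" using \<epsilon> B by simp
    then obtain \<rho> where \<rho>: "\<rho> > 0" "\<And>x y. y \<in> F \<Longrightarrow> dist x y < \<rho> \<Longrightarrow> \<bar>S x y\<bar> \<le> \<epsilon> / B * (dist x y)\<^sup>2"
      using small unfolding F_def by blast
    obtain \<tau> g0 where \<tau>: "offtens \<tau> g0" "\<And>x y. 0 \<le> \<tau> x y" "\<And>x y. \<tau> x y \<le> 1"
        "\<And>x y. x \<in> X \<Longrightarrow> y \<in> F \<Longrightarrow> \<rho> \<le> dist x y \<Longrightarrow> \<tau> x y = 1"
      using offtens_strip_cutoff[OF X(1,2) F(1) \<rho>(1)] by metis
    obtain k where k: "offtens (\<lambda>x y. S' x y * \<tau> x y) k" using offtens_mult[OF S' \<tau>(1)] by blast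
    define R where "R = (\<lambda>x y. S' x y - S' x y * \<tau> x y)"
    have R: "tens R (\<lambda>y. g' y - k y)" unfolding R_def by (intro tens_diff S' offtens_tens[OF k])
    have Rb: "\<bar>R x y\<bar> \<le> \<epsilon> * Q x y" for x y
    proof (cases "x \<in> X \<and> y \<in> F")
      case True
      show ?thesis
      proof (cases "\<rho> \<le> dist x y")
        case False
        have "R x y = S' x y * (1 - \<tau> x y)" by (simp add: R_def algebra_simps)
        hence "\<bar>R x y\<bar> = \<bar>S' x y\<bar> * (1 - \<tau> x y)" using \<tau>(3)[of x y] by (simp add: abs_mult)
        also have "\<dots> \<le> \<bar>S' x y\<bar> * 1" using \<tau>(2)[of x y] by (intro mult_left_mono) auto
        also have "\<dots> = \<bar>S x y\<bar> * \<bar>v y\<bar>" by (simp add: S'_def abs_mult)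
        also have "\<dots> \<le> (\<epsilon> / B * (dist x y)\<^sup>2) * B"
          using \<rho>(2)[of y x] False True B \<epsilon> by (intro mult_mono) auto
        also have "\<dots> = \<epsilon> * Q x y" using B True \<kappa>(3,4) by (auto simp: Q_def)
        finally show ?thesis .
      qed (use True \<tau>(4) \<epsilon> Q(2) in \<open>simp add: R_def\<close>)
    next
      case False
      hence "R x y = 0" using X(3) tsupp_zero[of y v] by (auto simp: R_def S'_def F_def)
      thus ?thesis using Q(2) \<epsilon> by simp
    qed
    have jk: "integrable J (\<lambda>(x, y). S' x y * \<tau> x y * h y)"
      "(\<integral>y. k y * h y \<partial>m) = 2 * (\<integral>(x, y). S' x y * \<tau> x y * h y \<partial>J)"
      using offtens_jump[OF h(1) k] by auto
    \<comment> \<open>\<epsilon> Q + R' is nonnegative and zero on the diagonal, so the one-sided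
      inequality for nonnegative tensors applies to it. Used with R' = R and with R' = -R it yields
      both signs of the estimate.\<close>
    have half: "integrable J (\<lambda>z. R' (fst z) (snd z) * h (snd z)) \<and>
        2 * (\<integral>z. R' (fst z) (snd z) * h (snd z) \<partial>J) - (\<integral>y. r y * h y \<partial>m) \<le> \<epsilon> * c"
      if R': "tens R' r" "\<And>x y. \<bar>R' x y\<bar> \<le> \<epsilon> * Q x y" for R' r
    proof -
      note p = tens_jump_le[OF tens_add[OF tens_cmult[OF Q(1), of \<epsilon>] R'(1)] h(1,2)]
      have n1: "0 \<le> \<epsilon> * Q x y + R' x y" for x y using R'(2)[of x y] by linarith
      have n2: "\<epsilon> * Q y y + R' y y = 0" for y using R'(2)[of y y] Q(3)[of y] by simp
      have i: "integrable J (\<lambda>z. (\<epsilon> * Q (fst z) (snd z) + R' (fst z) (snd z)) * h (snd z))"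
        using p(1) n1 n2 by (simp add: split_def)
      have iQ': "integrable J (\<lambda>z. \<epsilon> * (Q (fst z) (snd z) * h (snd z)))"
        using iQ by (simp add: split_def)
      have iR: "integrable J (\<lambda>z. R' (fst z) (snd z) * h (snd z))"
        using Bochner_Integration.integrable_diff[OF i iQ'] by (simp add: algebra_simps)
      have "2 * (\<integral>z. \<epsilon> * (Q (fst z) (snd z) * h (snd z)) + R' (fst z) (snd z) * h (snd z) \<partial>J)
          \<le> (\<integral>y. \<epsilon> * (q y * h y) + r y * h y \<partial>m)"
        using p(2) n1 n2 by (simp add: split_def algebra_simps)
      also have "\<dots> = \<epsilon> * c + (\<integral>y. r y * h y \<partial>m)"
        using tens_integrable[OF h(1) Q(1)] tens_integrable[OF h(1) R'(1)] by (simp add: c_def)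
      also have "(\<integral>z. \<epsilon> * (Q (fst z) (snd z) * h (snd z)) + R' (fst z) (snd z) * h (snd z) \<partial>J)
          = (\<integral>z. \<epsilon> * (Q (fst z) (snd z) * h (snd z)) \<partial>J) + (\<integral>z. R' (fst z) (snd z) * h (snd z) \<partial>J)"
        by (rule Bochner_Integration.integral_add[OF iQ' iR])
      finally have "2 * ((\<integral>z. \<epsilon> * (Q (fst z) (snd z) * h (snd z)) \<partial>J) + (\<integral>z. R' (fst z) (snd z) * h (snd z) \<partial>J))
          \<le> \<epsilon> * c + (\<integral>y. r y * h y \<partial>m)" .
      moreover have "0 \<le> (\<integral>z. \<epsilon> * (Q (fst z) (snd z) * h (snd z)) \<partial>J)"
        using Q(2) h(2) \<epsilon> by (intro integral_nonneg_AE) auto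
      ultimately show ?thesis using iR by (simp del: integral_mult_right_zero)
    qed
    have iR: "integrable J (\<lambda>z. R (fst z) (snd z) * h (snd z))" using half[OF R Rb] by simp
    have iS: "integrable J (\<lambda>(x, y). S' x y * h y)"
      using Bochner_Integration.integrable_add[OF iR jk(1)[unfolded split_def]]
      by (simp add: split_def algebra_simps R_def)
    have rr: "(\<integral>z. R (fst z) (snd z) * h (snd z) \<partial>J) = b - (\<integral>(x, y). S' x y * \<tau> x y * h y \<partial>J)"
      unfolding b_def using iS jk(1) by (simp add: R_def split_def left_diff_distrib)
    have e: "(\<integral>y. (g' y - k y) * h y \<partial>m) = a - 2 * (\<integral>(x, y). S' x y * \<tau> x y * h y \<partial>J)"
      using tens_integrable[OF h(1) S'] tens_integrable[OF h(1) offtens_tens[OF k]]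
      by (simp add: left_diff_distrib jk(2) a_def)
    have e': "(\<integral>y. (k y - g' y) * h y \<partial>m) = 2 * (\<integral>(x, y). S' x y * \<tau> x y * h y \<partial>J) - a"
      using tens_integrable[OF h(1) S'] tens_integrable[OF h(1) offtens_tens[OF k]]
      by (simp add: left_diff_distrib jk(2) a_def)
    have "2 * b - a \<le> \<epsilon> * c" using half[OF R Rb] by (simp add: rr e)
    moreover have "a - 2 * b \<le> \<epsilon> * c"
      using half[OF tens_cmult[OF R, of "- 1"]] Rb by (simp add: rr e')
    ultimately show ?thesis using iS by (simp add: abs_le_iff)
  qed
  have "S' x y * h y = S x y * v y" for x y using vh by (simp add: S'_def mult.assoc)
  hence e1: "(\<lambda>(x, y). S' x y * h y) = (\<lambda>(x, y). S x y * v y)" by simp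
  have "g' y * h y = g y * v y" for y using vh by (simp add: g'_def mult.assoc)
  hence e2: "a = (\<integral>y. g y * v y \<partial>m)" by (simp add: a_def)
  show "integrable J (\<lambda>(x, y). S x y * v y)" using main[of 1] e1 by simp
  have "\<bar>a - 2 * b\<bar> \<le> 0"
  proof (rule field_le_epsilon)
    fix e :: real assume "e > 0"
    hence "e / (c + 1) > 0" using c0 by simp
    from main[OF this] have "\<bar>a - 2 * b\<bar> \<le> e * (c / (c + 1))" by simp
    also have "\<dots> \<le> e * 1" using c0 \<open>e > 0\<close> by (intro mult_left_mono) auto
    finally show "\<bar>a - 2 * b\<bar> \<le> 0 + e" by simp
  qed
  thus "(\<integral>y. g y * v y \<partial>m) = 2 * (\<integral>(x, y). S x y * v y \<partial>J)"
    using e1 e2 by (simp add: b_def)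
qed

end

section \<open>Gluing locally represented functionals\<close>

text \<open>The glued measure is an infinite sum of finite measures and in general only locally
  finite: a compact subset of the open set meets finitely many of the pieces.\<close>

definition msum :: "(nat \<Rightarrow> 'a::topological_space measure) \<Rightarrow> 'a measure" where
  "msum M = measure_of UNIV (sets borel) (\<lambda>B. \<Sum>n. emeasure (M n) B)"

lemma sets_msum [simp, measurable_cong]: "sets (msum M) = sets borel"
  unfolding msum_def using sets.sigma_sets_eq[of "borel :: 'a measure"] by simp

lemma emeasure_msum:
  fixes M :: "nat \<Rightarrow> 'a::topological_space measure"
  assumes "\<And>n. sets (M n) = sets borel" "B \<in> sets borel"
  shows "emeasure (msum M) B = (\<Sum>n. emeasure (M n) B)"
  unfolding msum_def
proof (rule emeasure_measure_of_sigma)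
  show "sigma_algebra (UNIV :: 'a set) (sets borel)"
    using sets.sigma_algebra_axioms[of "borel :: 'a measure"] unfolding space_borel .
  show "positive (sets borel) (\<lambda>B. \<Sum>n. emeasure (M n) B)" by (simp add: positive_def)
  show "countably_additive (sets borel) (\<lambda>B. \<Sum>n. emeasure (M n) B)"
    unfolding countably_additive_def
  proof (intro allI impI)
    fix A :: "nat \<Rightarrow> 'a set"
    assume A: "range A \<subseteq> sets borel" "disjoint_family A" "\<Union>(range A) \<in> sets borel"
    have "(\<Sum>i. \<Sum>n. emeasure (M n) (A i)) = (\<integral>\<^sup>+n. (\<Sum>i. emeasure (M n) (A i)) \<partial>count_space UNIV)"
      by (subst nn_integral_suminf) (auto simp: nn_integral_count_space_nat)
    also have "\<dots> = (\<Sum>n. \<Sum>i. emeasure (M n) (A i))" by (rule nn_integral_count_space_nat)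
    also have "\<dots> = (\<Sum>n. emeasure (M n) (\<Union>(range A)))"
      using A assms(1) by (intro suminf_cong suminf_emeasure) auto
    finally show "(\<Sum>i. \<Sum>n. emeasure (M n) (A i)) = (\<Sum>n. emeasure (M n) (\<Union>(range A)))" .
  qed
qed fact

lemma nn_integral_msum:
  assumes M: "\<And>n. sets (M n) = sets borel" and f: "f \<in> borel_measurable borel"
  shows "(\<integral>\<^sup>+x. f x \<partial>msum M) = (\<Sum>n. \<integral>\<^sup>+x. f x \<partial>M n)"
  using f
proof (induction rule: borel_measurable_induct)
  case (cong f g)
  hence "f = g" by auto
  thus ?case using cong by simp
next
  case (set B)
  thus ?case using M emeasure_msum[OF M set] by simp
next
  case (mult u c)
  hence "u \<in> borel_measurable (M n)" "u \<in> borel_measurable (msum M)" for n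
    by (simp_all add: measurable_cong_sets[OF M refl] measurable_cong_sets[OF sets_msum refl])
  thus ?case using mult by (simp add: nn_integral_cmult)
next
  case (add u v)
  hence "u \<in> borel_measurable (M n)" "u \<in> borel_measurable (msum M)"
    "v \<in> borel_measurable (M n)" "v \<in> borel_measurable (msum M)" for n
    by (simp_all add: measurable_cong_sets[OF M refl] measurable_cong_sets[OF sets_msum refl])
  thus ?case using add by (simp add: nn_integral_add suminf_add)
next
  case (seq U)
  hence meas: "U i \<in> borel_measurable (M n)" "U i \<in> borel_measurable (msum M)" for n i
    by (simp_all add: measurable_cong_sets[OF M refl] measurable_cong_sets[OF sets_msum refl])
  have "(\<integral>\<^sup>+x. (SUP i. U i) x \<partial>msum M) = (SUP i. \<integral>\<^sup>+x. U i x \<partial>msum M)"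
    unfolding SUP_apply by (intro nn_integral_monotone_convergence_SUP seq meas)
  also have "\<dots> = (SUP i. \<Sum>n. \<integral>\<^sup>+x. U i x \<partial>M n)" using seq by simp
  also have "\<dots> = (\<Sum>n. SUP i. \<integral>\<^sup>+x. U i x \<partial>M n)"
    using seq(3) by (intro ennreal_suminf_SUP_eq[symmetric])
      (auto simp: incseq_def le_fun_def intro!: nn_integral_mono)
  also have "\<dots> = (\<Sum>n. \<integral>\<^sup>+x. (SUP i. U i) x \<partial>M n)"
    unfolding SUP_apply by (intro suminf_cong nn_integral_monotone_convergence_SUP[symmetric] seq meas)
  finally show ?case .
qed

lemma integral_msum_nonneg:
  fixes f :: "'a::topological_space \<Rightarrow> real"
  assumes M: "\<And>n. sets (M n) = sets borel" and f: "f \<in> borel_measurable borel" "\<And>x. f x \<ge> 0"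
    and int: "\<And>n. integrable (M n) f" and zero: "\<And>n. n \<ge> N \<Longrightarrow> (\<integral>x. f x \<partial>M n) = 0"
  shows "has_bochner_integral (msum M) f (\<Sum>n<N. \<integral>x. f x \<partial>M n)"
proof (rule has_bochner_integral_nn_integral)
  have "(\<integral>\<^sup>+x. ennreal (f x) \<partial>msum M) = (\<Sum>n. \<integral>\<^sup>+x. ennreal (f x) \<partial>M n)"
    using f by (intro nn_integral_msum M) auto
  also have "\<dots> = (\<Sum>n. ennreal (\<integral>x. f x \<partial>M n))"
    using f int by (intro suminf_cong nn_integral_eq_integral) auto
  also have "\<dots> = (\<Sum>n<N. ennreal (\<integral>x. f x \<partial>M n))"
    by (rule suminf_finite) (use zero in auto)
  also have "\<dots> = ennreal (\<Sum>n<N. \<integral>x. f x \<partial>M n)"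
    using f by (intro sum_ennreal integral_nonneg_AE) auto
  finally show "(\<integral>\<^sup>+x. ennreal (f x) \<partial>msum M) = ennreal (\<Sum>n<N. \<integral>x. f x \<partial>M n)" .
qed (use f in \<open>auto intro!: sum_nonneg integral_nonneg_AE simp: measurable_cong_sets[OF sets_msum refl]\<close>)

lemma integral_msum:
  fixes f :: "'a::topological_space \<Rightarrow> real"
  assumes M: "\<And>n. sets (M n) = sets borel" and f: "f \<in> borel_measurable borel"
    and int: "\<And>n. integrable (M n) f" and zero: "\<And>n. n \<ge> N \<Longrightarrow> AE x in M n. f x = 0"
  shows "(\<integral>x. f x \<partial>msum M) = (\<Sum>n<N. \<integral>x. f x \<partial>M n)"
proof -
  have max0: "AE x in M n. max (\<sigma> * f x) 0 = 0" if "n \<ge> N" for n \<sigma>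
    using zero[OF that] by eventually_elim simp
  have p: "has_bochner_integral (msum M) (\<lambda>x. max (f x) 0) (\<Sum>n<N. \<integral>x. max (f x) 0 \<partial>M n)"
    using f int max0[of _ 1] by (intro integral_msum_nonneg M) (auto intro!: integral_eq_zero_AE)
  have q: "has_bochner_integral (msum M) (\<lambda>x. max (- f x) 0) (\<Sum>n<N. \<integral>x. max (- f x) 0 \<partial>M n)"
    using f int max0[of _ "- 1"] by (intro integral_msum_nonneg M) (auto intro!: integral_eq_zero_AE)
  have e: "max (f x) 0 - max (- f x) 0 = f x" for x by (simp add: max_def)
  have "(\<integral>x. f x \<partial>msum M) = (\<Sum>n<N. \<integral>x. max (f x) 0 \<partial>M n) - (\<Sum>n<N. \<integral>x. max (- f x) 0 \<partial>M n)"
    using has_bochner_integral_integral_eq[OF has_bochner_integral_diff[OF p q]] by (simp add: e)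
  also have "\<dots> = (\<Sum>n<N. \<integral>x. max (f x) 0 - max (- f x) 0 \<partial>M n)"
    unfolding sum_subtractf[symmetric]
    using int by (intro sum.cong refl Bochner_Integration.integral_diff[symmetric]) auto
  finally show ?thesis by (simp add: e)
qed

section \<open>Functionals represented by measures on compact sets\<close>

lemma C0inf_integrable_finite:
  assumes "w \<in> C0inf W" "finite_measure \<mu>" "sets \<mu> = sets borel" shows "integrable \<mu> w"
proof -
  obtain B where "\<And>x. \<bar>w x\<bar> \<le> B" using C0inf_bounded[OF assms(1)] by metis
  thus ?thesis using assms(2,3) smooth_measurable[OF C0infD(1)[OF assms(1)]]
    by (intro finite_measure.integrable_const_bound[of \<mu> _ B])
      (auto simp: measurable_cong_sets[OF assms(3) refl])
qed

lemma radon_integrable: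
  assumes "radon_on W \<mu>" "w \<in> C0inf W" shows "integrable \<mu> w"
proof -
  have s: "sets \<mu> = sets borel" using assms by (simp add: radon_on_def)
  obtain B where B: "\<And>x. \<bar>w x\<bar> \<le> B" using C0inf_bounded[OF assms(2)] by metis
  have "integrable \<mu> (\<lambda>x. B * indicator (tsupp w) x)"
    using assms s C0infD[OF assms(2)] unfolding radon_on_def
    by (intro integrable_mult_right integrable_real_indicator) (auto intro: borel_compact)
  thus ?thesis
  proof (rule Bochner_Integration.integrable_bound)
    have "\<bar>w x\<bar> \<le> \<bar>B * indicator (tsupp w) x\<bar>" for x
      using B[of x] tsupp_zero[of x w] by (auto simp: indicator_def)
    thus "AE x in \<mu>. norm (w x) \<le> norm (B * indicator (tsupp w) x)" by simp
  qed (use smooth_measurable[OF C0infD(1)[OF assms(2)]] in \<open>simp add: measurable_cong_sets[OF s refl]\<close>)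
qed

text \<open>\<open>\<phi>\<close> has to agree with a pair of finite measures only on test functions
  supported in \<open>F\<close>. The pairs for different \<open>F\<close> need not be related as
  measures; that they all compute \<open>\<phi>\<close> is what the gluing uses.\<close>

definition local_rep :: "(real^'n::finite) set \<Rightarrow> ((real^'n \<Rightarrow> real) \<Rightarrow> real) \<Rightarrow> bool" where
  "local_rep F \<phi> \<longleftrightarrow> (\<exists>\<mu>. finite_measure (fst \<mu>) \<and> finite_measure (snd \<mu>) \<and>
     sets (fst \<mu>) = sets borel \<and> sets (snd \<mu>) = sets borel \<and>
     (\<forall>w\<in>C0inf UNIV. tsupp w \<subseteq> F \<longrightarrow> \<phi> w = sint \<mu> w))"

lemma local_rep_cong:
  assumes "local_rep F \<phi>" "\<And>w. w \<in> C0inf UNIV \<Longrightarrow> tsupp w \<subseteq> F \<Longrightarrow> \<psi> w = \<phi> w"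
  shows "local_rep F \<psi>"
proof -
  obtain \<mu> where "finite_measure (fst \<mu>) \<and> finite_measure (snd \<mu>) \<and>
     sets (fst \<mu>) = sets borel \<and> sets (snd \<mu>) = sets borel \<and>
     (\<forall>w\<in>C0inf UNIV. tsupp w \<subseteq> F \<longrightarrow> \<phi> w = sint \<mu> w)"
    using assms(1) unfolding local_rep_def ..
  thus ?thesis unfolding local_rep_def using assms(2) by (intro exI[of _ \<mu>]) simp
qed

text \<open>The pair consists of the images under \<open>\<pi>\<close> of the measures with
  densities max(\<rho>, 0) and max(-\<rho>, 0). With a coordinate projection for
  \<open>\<pi>\<close>, integrals against \<open>J\<close> become integrals against measures on one
  factor.\<close>

lemma local_rep_image:
  fixes \<pi> :: "'b \<Rightarrow> real^'n::finite"
  assumes \<rho>: "integrable M \<rho>" and \<pi>: "\<pi> \<in> measurable M borel"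
  shows "local_rep F (\<lambda>w. \<integral>z. \<rho> z * w (\<pi> z) \<partial>M)"
proof -
  define \<mu> where "\<mu> = (\<lambda>\<sigma>::real. distr (density M (\<lambda>z. ennreal (max (\<sigma> * \<rho> z) 0))) borel \<pi>)"
  have meas: "\<rho> \<in> borel_measurable M" using \<rho> by simp
  have \<pi>': "\<pi> \<in> measurable (density M f) borel" for f using \<pi> by simp
  have "finite_measure (\<mu> \<sigma>)" for \<sigma>
  proof (rule finite_measureI)
    have "emeasure (\<mu> \<sigma>) (space (\<mu> \<sigma>)) = (\<integral>\<^sup>+z. ennreal (max (\<sigma> * \<rho> z) 0) \<partial>M)"
      using meas \<pi>' by (simp add: \<mu>_def emeasure_distr emeasure_density cong: nn_integral_cong)
    also have "\<dots> < \<infinity>" using \<rho> integrable_iff_bounded[of M "\<lambda>z. max (\<sigma> * \<rho> z) 0"] by simp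
    finally show "emeasure (\<mu> \<sigma>) (space (\<mu> \<sigma>)) \<noteq> \<infinity>" by simp
  qed
  moreover have "(\<integral>z. \<rho> z * w (\<pi> z) \<partial>M) = sint (\<mu> 1, \<mu> (- 1)) w" if w: "w \<in> C0inf UNIV" for w
  proof -
    have wm: "w \<in> borel_measurable borel" by (intro smooth_measurable C0infD(1)[OF w])
    obtain B where B: "\<And>x. \<bar>w x\<bar> \<le> B" using C0inf_bounded[OF w] by metis
    have wp: "(\<lambda>z. w (\<pi> z)) \<in> borel_measurable M" using measurable_compose[OF \<pi> wm] .
    have i: "integrable M (\<lambda>z. max (\<sigma> * \<rho> z) 0 * w (\<pi> z))" for \<sigma>
    proof (rule Bochner_Integration.integrable_bound)
      show "integrable M (\<lambda>z. max (\<sigma> * \<rho> z) 0 * B)" using \<rho> by simp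
      have "\<bar>max (\<sigma> * \<rho> z) 0\<bar> * \<bar>w (\<pi> z)\<bar> \<le> \<bar>max (\<sigma> * \<rho> z) 0\<bar> * \<bar>B\<bar>" for z
        using B[of "\<pi> z"] by (intro mult_left_mono) auto
      thus "AE z in M. norm (max (\<sigma> * \<rho> z) 0 * w (\<pi> z)) \<le> norm (max (\<sigma> * \<rho> z) 0 * B)"
        by (simp add: abs_mult)
    qed (use wp meas in measurable)
    have d: "(\<integral>x. w x \<partial>\<mu> \<sigma>) = (\<integral>z. max (\<sigma> * \<rho> z) 0 * w (\<pi> z) \<partial>M)" for \<sigma>
      unfolding \<mu>_def using wm wp meas
      by (subst integral_distr[OF \<pi>' wm], subst integral_density) (auto simp del: borel_measurable_ereal_iff)
    have "sint (\<mu> 1, \<mu> (- 1)) w = (\<integral>z. max (\<rho> z) 0 * w (\<pi> z) - max (- \<rho> z) 0 * w (\<pi> z) \<partial>M)"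
      using i[of 1] i[of "- 1"] by (simp add: sint_def d)
    also have "\<dots> = (\<integral>z. \<rho> z * w (\<pi> z) \<partial>M)"
      by (intro Bochner_Integration.integral_cong refl) (auto simp: max_def)
    finally show ?thesis by simp
  qed
  ultimately show ?thesis unfolding local_rep_def
    by (intro exI[of _ "(\<mu> 1, \<mu> (- 1))"]) (simp, simp add: \<mu>_def)
qed

lemma finite_msum_add:
  assumes "finite_measure \<mu>" "finite_measure \<mu>'" "sets \<mu> = sets borel" "sets \<mu>' = sets borel"
  obtains \<nu> where "finite_measure \<nu>" "sets \<nu> = sets borel"
    "\<And>w. w \<in> C0inf W \<Longrightarrow> (\<integral>x. w x \<partial>\<nu>) = (\<integral>x. w x \<partial>\<mu>) + (\<integral>x. w x \<partial>\<mu>')"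
proof -
  \<comment> \<open>A sum of two measures as a countable sum continued by null measures.\<close>
  define M where "M = (\<lambda>n::nat. if n = 0 then \<mu> else if n = 1 then \<mu>' else null_measure borel)"
  have M: "sets (M n) = sets borel" for n using assms by (simp add: M_def)
  have fin: "finite_measure (M n)" for n using assms by (auto simp: M_def intro: finite_measureI)
  have sp: "space (msum M) = UNIV" using sets_eq_imp_space_eq[OF sets_msum[of M]] by simp
  have "emeasure (msum M) UNIV = (\<Sum>n. emeasure (M n) UNIV)" by (intro emeasure_msum M) simp
  also have "\<dots> = (\<Sum>n<2. emeasure (M n) UNIV)" by (rule suminf_finite) (auto simp: M_def)
  also have "\<dots> < \<infinity>" using finite_measure.emeasure_finite[OF fin]
    by (auto simp: less_top[symmetric])
  finally have "finite_measure (msum M)" by (intro finite_measureI) (simp add: sp)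
  moreover have "(\<integral>x. w x \<partial>msum M) = (\<integral>x. w x \<partial>\<mu>) + (\<integral>x. w x \<partial>\<mu>')" if w: "w \<in> C0inf W" for w
  proof -
    have "(\<integral>x. w x \<partial>msum M) = (\<Sum>n<2. \<integral>x. w x \<partial>M n)"
      using C0inf_integrable_finite[OF w fin M] smooth_measurable[OF C0infD(1)[OF w]]
      by (intro integral_msum M) (auto simp: M_def null_sets_def intro!: AE_I'[of UNIV])
    thus ?thesis by (simp add: M_def numeral_2_eq_2)
  qed
  ultimately show ?thesis using that by simp
qed

lemma local_rep_add:
  assumes "local_rep F \<phi>" "local_rep F \<psi>" shows "local_rep F (\<lambda>w. \<phi> w + \<psi> w)"
proof -
  obtain \<mu> where \<mu>: "finite_measure (fst \<mu>)" "finite_measure (snd \<mu>)" "sets (fst \<mu>) = sets borel"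
    "sets (snd \<mu>) = sets borel" "\<And>w. w \<in> C0inf UNIV \<Longrightarrow> tsupp w \<subseteq> F \<Longrightarrow> \<phi> w = sint \<mu> w"
    using assms(1) unfolding local_rep_def by blast
  obtain \<mu>' where \<mu>': "finite_measure (fst \<mu>')" "finite_measure (snd \<mu>')" "sets (fst \<mu>') = sets borel"
    "sets (snd \<mu>') = sets borel" "\<And>w. w \<in> C0inf UNIV \<Longrightarrow> tsupp w \<subseteq> F \<Longrightarrow> \<psi> w = sint \<mu>' w"
    using assms(2) unfolding local_rep_def by blast
  obtain \<nu>1 where 1: "finite_measure \<nu>1" "sets \<nu>1 = sets borel"
    "\<And>w. w \<in> C0inf UNIV \<Longrightarrow> (\<integral>x. w x \<partial>\<nu>1) = (\<integral>x. w x \<partial>fst \<mu>) + (\<integral>x. w x \<partial>fst \<mu>')"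
    by (rule finite_msum_add[OF \<mu>(1) \<mu>'(1) \<mu>(3) \<mu>'(3), where W=UNIV]) blast
  obtain \<nu>2 where 2: "finite_measure \<nu>2" "sets \<nu>2 = sets borel"
    "\<And>w. w \<in> C0inf UNIV \<Longrightarrow> (\<integral>x. w x \<partial>\<nu>2) = (\<integral>x. w x \<partial>snd \<mu>) + (\<integral>x. w x \<partial>snd \<mu>')"
    by (rule finite_msum_add[OF \<mu>(2) \<mu>'(2) \<mu>(4) \<mu>'(4), where W=UNIV]) blast
  show ?thesis unfolding local_rep_def
    by (intro exI[of _ "(\<nu>1, \<nu>2)"]) (auto simp: 1 2 sint_def \<mu>(5) \<mu>'(5))
qed

lemma C0inf_UNIV: "w \<in> C0inf W \<Longrightarrow> w \<in> C0inf UNIV"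
  using C0inf_mono[of W UNIV] by auto

text \<open>An exhaustion of \<open>W\<close> by compact sets carries a partition of unity
  \<theta>_n, and the measure is the sum of the \<theta>_n \<mu>_n, where \<mu>_n represents
  \<open>\<phi>\<close> on a compact set containing the support of \<theta>_n. Since \<theta>_n
  \<ge> 0, both components of the pair remain positive measures.\<close>

lemma local_rep_glue:
  fixes W :: "(real^'n::finite) set"
  assumes W: "open W" and rep: "\<And>F. compact F \<Longrightarrow> F \<subseteq> W \<Longrightarrow> local_rep F \<phi>"
  obtains \<nu> where "signed_radon_on W \<nu>" "\<And>w. w \<in> C0inf W \<Longrightarrow> sint \<nu> w = \<phi> w"
proof -
  \<comment> \<open>Additivity of \<open>\<phi>\<close> comes from the representation itself: two
    test functions have their supports in one compact set, on which a single pair computes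
    \<open>\<phi>\<close>.\<close>
  have add: "\<phi> (\<lambda>x. u x + v x) = \<phi> u + \<phi> v" if u: "u \<in> C0inf W" and v: "v \<in> C0inf W" for u v
  proof -
    have "local_rep (tsupp u \<union> tsupp v) \<phi>" using C0infD[OF u] C0infD[OF v] by (intro rep) auto
    then obtain \<mu> where \<mu>: "finite_measure (fst \<mu>)" "finite_measure (snd \<mu>)" "sets (fst \<mu>) = sets borel"
      "sets (snd \<mu>) = sets borel" "\<And>w. w \<in> C0inf UNIV \<Longrightarrow> tsupp w \<subseteq> tsupp u \<union> tsupp v \<Longrightarrow> \<phi> w = sint \<mu> w"
      unfolding local_rep_def by blast
    have "tsupp (\<lambda>x. u x + v x) \<subseteq> tsupp u \<union> tsupp v"
      by (rule tsupp_subsetI) (auto simp: closed_tsupp tsupp_zero)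
    thus ?thesis
      using C0inf_integrable_finite[OF u \<mu>(1,3)] C0inf_integrable_finite[OF u \<mu>(2,4)]
        C0inf_integrable_finite[OF v \<mu>(1,3)] C0inf_integrable_finite[OF v \<mu>(2,4)]
        \<mu>(5)[OF C0inf_UNIV[OF u]] \<mu>(5)[OF C0inf_UNIV[OF v]] \<mu>(5)[OF C0inf_UNIV[OF C0inf_add[OF u v]]]
      by (simp add: sint_def)
  qed
  obtain C where C: "\<And>n. compact (C n)" "\<And>n. C n \<subseteq> W" "\<And>n. C n \<subseteq> interior (C (Suc n))"
    "\<And>F. compact F \<Longrightarrow> F \<subseteq> W \<Longrightarrow> \<exists>N. \<forall>n\<ge>N. F \<subseteq> C n"
    using open_Union_compact_subsets[OF W] by metis
  have Cmono: "C k \<subseteq> C n" if "k \<le> n" for k n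
    using that by (induction rule: dec_induct) (use C(3) interior_subset in blast)+
  have "\<exists>c. c \<in> C0inf (interior (C (Suc n))) \<and> (\<forall>x. 0 \<le> c x \<and> c x \<le> 1) \<and> (\<forall>x\<in>C n. c x = 1)" for n
    by (rule cutoff_exists[OF C(1)[of n] C(3)[of n] open_interior]) blast
  then obtain c where c: "\<And>n. c n \<in> C0inf (interior (C (Suc n)))" "\<And>n x. 0 \<le> c n x"
    "\<And>n x. c n x \<le> 1" "\<And>n x. x \<in> C n \<Longrightarrow> c n x = 1" by metis
  have c0: "c n x = 0" if "x \<notin> C (Suc n)" for n x
    using C0infD(3)[OF c(1)[of n]] interior_subset[of "C (Suc n)"] that tsupp_zero[of x "c n"] by blast
  \<comment> \<open>Telescoping differences: the terms up to N add up to \<open>c N\<close>. They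
    are nonnegative because \<open>c n\<close> is one on \<open>C n\<close>, outside of which
    \<open>c (n - 1)\<close> is zero.\<close>
  define \<theta> where "\<theta> = (\<lambda>n x. c n x - (if n = 0 then 0 else c (n - 1) x))"
  have \<theta>nn: "0 \<le> \<theta> n x" for n x
  proof (cases n)
    case (Suc k)
    show ?thesis using Suc c(3)[of k x] c(2)[of n x] c(4)[of x n] c0[of x k]
      by (cases "x \<in> C (Suc k)") (auto simp: \<theta>_def)
  qed (simp add: \<theta>_def c(2))
  have \<theta>1: "\<theta> n x \<le> 1" for n x using c(2)[of "n - 1" x] c(3)[of n x] by (auto simp: \<theta>_def)
  have \<theta>sum: "(\<Sum>n<Suc N. \<theta> n x) = c N x" for N x
    by (induction N) (auto simp: \<theta>_def)
  have \<theta>smooth: "smooth (\<theta> n)" for n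
    unfolding \<theta>_def using C0infD(1)[OF c(1)] by (cases n) (auto intro: smooth_diff)
  have \<theta>supp: "\<theta> n x = 0" if "x \<notin> C (Suc n)" for n x
    using c0[OF that] that Cmono[of n "Suc n"] c0[of x "n - 1"] by (cases n) (auto simp: \<theta>_def)
  have \<theta>zero: "\<theta> n x = 0" if xk: "x \<in> C k" "k < n" for n k x
  proof -
    obtain j where "n = Suc j" using xk(2) less_imp_Suc_add by blast
    moreover have "x \<in> C j" "x \<in> C n" using \<open>n = Suc j\<close> xk Cmono[of k j] Cmono[of k n] by auto
    ultimately show ?thesis using c(4)[of x j] c(4)[of x n] by (simp add: \<theta>_def)
  qed
  have "\<exists>\<mu>. finite_measure (fst \<mu>) \<and> finite_measure (snd \<mu>) \<and> sets (fst \<mu>) = sets borel \<and>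
      sets (snd \<mu>) = sets borel \<and> (\<forall>w\<in>C0inf UNIV. tsupp w \<subseteq> C (Suc n) \<longrightarrow> \<phi> w = sint \<mu> w)" for n
    using rep[OF C(1,2)[of "Suc n"]] unfolding local_rep_def .
  then obtain \<mu> where \<mu>: "\<And>n. finite_measure (fst (\<mu> n))" "\<And>n. finite_measure (snd (\<mu> n))"
    "\<And>n. sets (fst (\<mu> n)) = sets borel" "\<And>n. sets (snd (\<mu> n)) = sets borel"
    "\<And>n w. w \<in> C0inf UNIV \<Longrightarrow> tsupp w \<subseteq> C (Suc n) \<Longrightarrow> \<phi> w = sint (\<mu> n) w" by metis
  define glue where "glue = (\<lambda>M :: nat \<Rightarrow> (real^'n) measure. msum (\<lambda>n. density (M n) (\<lambda>x. ennreal (\<theta> n x))))"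
  have \<theta>m: "\<theta> n \<in> borel_measurable borel" for n by (intro smooth_measurable \<theta>smooth)
  have \<theta>fin: "\<exists>N. \<forall>n\<ge>N. \<forall>x\<in>F. \<theta> n x = 0" if CF: "compact F" "F \<subseteq> W" for F
  proof -
    obtain N where "F \<subseteq> C N" using C(4)[OF CF] by blast
    thus ?thesis using \<theta>zero by (intro exI[of _ "Suc N"]) auto
  qed
  have radon: "radon_on W (glue M)"
    and integral: "\<And>w N. w \<in> C0inf W \<Longrightarrow> (\<And>n x. n \<ge> N \<Longrightarrow> x \<in> tsupp w \<Longrightarrow> \<theta> n x = 0) \<Longrightarrow>
        (\<integral>x. w x \<partial>glue M) = (\<Sum>n<N. \<integral>x. \<theta> n x * w x \<partial>M n)"
    if M: "\<And>n. finite_measure (M n)" "\<And>n. sets (M n) = sets borel" for M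
  proof -
    have s: "sets (density (M n) f) = sets borel" for n f using M by simp
    have \<theta>M: "\<theta> n \<in> borel_measurable (M n)" for n using \<theta>m by (simp add: measurable_cong_sets[OF M(2) refl])
    have em: "emeasure (glue M) B = (\<Sum>n. \<integral>\<^sup>+x. ennreal (\<theta> n x) * indicator B x \<partial>M n)" if "B \<in> sets borel" for B
      unfolding glue_def using that M \<theta>M by (simp add: emeasure_msum[OF s] emeasure_density)
    show "radon_on W (glue M)" unfolding radon_on_def
    proof (intro conjI allI impI)
      show "sets (glue M) = sets borel" by (simp add: glue_def)
      have "ennreal (\<theta> n x) * indicator (- W) x = 0" for n x
      proof (cases "x \<in> W")
        case False
        hence "\<theta> n x = 0" using C(2)[of "Suc n"] by (intro \<theta>supp) auto
        thus ?thesis by simp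
      qed simp
      note z = this
      have "- W \<in> sets borel" using W by (intro borel_closed) (simp add: closed_Compl)
      from em[OF this] show "emeasure (glue M) (- W) = 0" unfolding z by simp
      fix F assume F: "compact F \<and> F \<subseteq> W"
      obtain N where N: "\<And>n x. n \<ge> N \<Longrightarrow> x \<in> F \<Longrightarrow> \<theta> n x = 0"
        using \<theta>fin[of F] F by auto
      have "emeasure (glue M) F = (\<Sum>n. \<integral>\<^sup>+x. ennreal (\<theta> n x) * indicator F x \<partial>M n)"
        using F by (intro em borel_compact) auto
      also have "\<dots> = (\<Sum>n<N. \<integral>\<^sup>+x. ennreal (\<theta> n x) * indicator F x \<partial>M n)"
      proof (rule suminf_finite)
        fix n assume "n \<notin> {..<N}"
        hence z: "ennreal (\<theta> n x) * indicator F x = 0" for x using N[of n x] by (auto simp: indicator_def)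
        show "(\<integral>\<^sup>+x. ennreal (\<theta> n x) * indicator F x \<partial>M n) = 0" unfolding z by simp
      qed simp
      also have "\<dots> \<le> (\<Sum>n<N. \<integral>\<^sup>+x. 1 \<partial>M n)"
        using \<theta>1 by (intro sum_mono nn_integral_mono) (auto simp: indicator_def)
      also have "\<dots> < \<infinity>"
        using finite_measure.emeasure_finite[OF M(1)] by (simp add: less_top[symmetric])
      finally show "emeasure (glue M) F < \<infinity>" .
    qed
    fix w N assume w: "w \<in> C0inf W" and N: "\<And>n x. n \<ge> N \<Longrightarrow> x \<in> tsupp w \<Longrightarrow> \<theta> n x = 0"
    have wm: "w \<in> borel_measurable borel" by (intro smooth_measurable C0infD(1)[OF w])
    have wM: "w \<in> borel_measurable (M n)" for n using wm by (simp add: measurable_cong_sets[OF M(2) refl])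
    have d: "integrable (density (M n) (\<lambda>x. ennreal (\<theta> n x))) w"
      "(\<integral>x. w x \<partial>density (M n) (\<lambda>x. ennreal (\<theta> n x))) = (\<integral>x. \<theta> n x * w x \<partial>M n)" for n
      using C0inf_integrable_finite[OF C0inf_mult_left[OF \<theta>smooth w] M] \<theta>nn \<theta>M wM
      by (auto simp: integrable_density integral_density)
    have "AE x in density (M n) (\<lambda>x. ennreal (\<theta> n x)). w x = 0" if "n \<ge> N" for n
    proof -
      have "ennreal (\<theta> n x) > 0 \<longrightarrow> w x = 0" for x
        using N[OF that, of x] tsupp_zero[of x w] by (cases "x \<in> tsupp w") auto
      thus ?thesis using \<theta>M by (simp add: AE_density)
    qed
    thus "(\<integral>x. w x \<partial>glue M) = (\<Sum>n<N. \<integral>x. \<theta> n x * w x \<partial>M n)"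
      unfolding glue_def using integral_msum[OF s wm d(1), of N] by (simp add: d(2))
  qed
  define \<nu> where "\<nu> = (glue (\<lambda>n. fst (\<mu> n)), glue (\<lambda>n. snd (\<mu> n)))"
  have "signed_radon_on W \<nu>" unfolding signed_radon_on_def \<nu>_def using \<mu> by (auto intro: radon)
  moreover have "sint \<nu> w = \<phi> w" if w: "w \<in> C0inf W" for w
  proof -
    obtain N where N: "tsupp w \<subseteq> C N" using C(4)[of "tsupp w"] C0infD[OF w] by blast
    have \<theta>w: "(\<lambda>x. \<theta> n x * w x) \<in> C0inf W" for n by (rule C0inf_mult_left[OF \<theta>smooth w])
    \<comment> \<open>On \<open>C N\<close> the cutoff \<open>c N\<close> and all later ones are
      one, so the differences vanish from index N + 1 on and the sum is finite.\<close>
    have z: "\<theta> n x = 0" if "n \<ge> Suc N" "x \<in> tsupp w" for n x using \<theta>zero[where x=x and k=N and n=n] N that by auto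
    have \<phi>0: "\<phi> (\<lambda>x. 0) = 0" using add[OF C0inf_zero C0inf_zero] by simp
    have fs: "\<phi> (\<lambda>x. \<Sum>n<k. \<theta> n x * w x) = (\<Sum>n<k. \<phi> (\<lambda>x. \<theta> n x * w x))" for k
    proof (induction k)
      case (Suc k)
      show ?case using add[OF C0inf_sum[of "{..<k}" "\<lambda>n x. \<theta> n x * w x", OF \<theta>w] \<theta>w[of k]] Suc by simp
    qed (simp add: \<phi>0)
    have "(\<Sum>n<Suc N. \<theta> n x * w x) = w x" for x
      using \<theta>sum[where N=N and x=x] c(4)[of x N] N tsupp_zero[of x w]
      by (cases "x \<in> tsupp w") (auto simp: sum_distrib_right[symmetric])
    hence "\<phi> w = (\<Sum>n<Suc N. \<phi> (\<lambda>x. \<theta> n x * w x))" using fs[of "Suc N"] by simp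
    also have "\<dots> = (\<Sum>n<Suc N. sint (\<mu> n) (\<lambda>x. \<theta> n x * w x))"
    proof (intro sum.cong refl \<mu>(5) C0inf_UNIV[OF \<theta>w] tsupp_subsetI)
      show "closed (C (Suc n))" for n by (intro compact_imp_closed C)
    qed (use \<theta>supp in auto)
    also have "\<dots> = sint \<nu> w" unfolding \<nu>_def sint_def fst_conv snd_conv
      using integral[OF \<mu>(1,3) w z] integral[OF \<mu>(2,4) w z] by (simp add: sum_subtractf)
    finally show ?thesis by simp
  qed
  ultimately show ?thesis using that by blast
qed

text \<open>Test functions between the indicators of \<open>F\<close> and of neighbourhoods
  shrinking to \<open>F\<close>. One sequence serves all measures at once, so relations between
  integrals of test functions pass to the values on \<open>F\<close>.\<close>

lemma compact_approx:
  fixes F W :: "(real^'n::finite) set"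
  assumes W: "open W" and F: "compact F" "F \<subseteq> W"
  obtains h where "\<And>n. h n \<in> C0inf W" "\<And>n x. 0 \<le> h n x"
    "\<And>\<nu>. signed_radon_on W \<nu> \<Longrightarrow> (\<lambda>n::nat. sint \<nu> (h n)) \<longlonglongrightarrow> sval \<nu> F"
proof (cases "F = {}")
  case True
  show ?thesis by (rule that[of "\<lambda>n x. 0"]) (auto simp: C0inf_zero sint_def sval_def True)
next
  case False
  obtain k M where k: "k \<in> C0inf W" "open M" "F \<subseteq> M" "\<And>x. x \<in> M \<Longrightarrow> k x = 1"
    using cutoff_exists[OF F W] by metis
  \<comment> \<open>Intersecting with \<open>M\<close> keeps every \<open>V n\<close> inside the
    compact support of \<open>k\<close>, whose indicator then dominates all
    \<open>h n\<close>.\<close>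
  define V where "V = (\<lambda>n. M \<inter> {x. infdist x F < inverse (real (Suc n))})"
  have oV: "open (V n)" for n unfolding V_def
    by (intro open_Int k open_Collect_less continuous_intros)
  have "F \<subseteq> V n" for n unfolding V_def using k by auto
  then have "\<exists>h. h \<in> C0inf (V n) \<and> (\<forall>x. 0 \<le> h x \<and> h x \<le> 1) \<and> (\<forall>x\<in>F. h x = 1)" for n
    by (rule_tac cutoff_exists[OF F(1) _ oV[of n]]) blast+
  then obtain h where h: "\<And>n. h n \<in> C0inf (V n)" "\<And>n x. 0 \<le> h n x" "\<And>n x. h n x \<le> 1"
    "\<And>n x. x \<in> F \<Longrightarrow> h n x = 1" by metis
  have h0: "h n x = 0" if "x \<notin> V n" for n x
    using C0infD(3)[OF h(1)[of n]] that tsupp_zero[of x "h n"] by auto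
  have VW: "V n \<subseteq> tsupp k" for n
  proof
    fix x assume "x \<in> V n"
    hence "k x \<noteq> 0" using k(4)[of x] by (auto simp: V_def)
    thus "x \<in> tsupp k" using tsupp_zero by blast
  qed
  have hW: "h n \<in> C0inf W" for n using h(1)[of n] C0inf_mono[of "V n" W] VW[of n] C0infD(3)[OF k(1)] by blast
  have lim: "(\<lambda>n. \<integral>x. h n x \<partial>\<mu>) \<longlonglongrightarrow> measure \<mu> F" if \<mu>: "radon_on W \<mu>" for \<mu>
  proof -
    have s: "sets \<mu> = sets borel" using \<mu> by (simp add: radon_on_def)
    have Fs: "F \<in> sets \<mu>" using F s by (auto intro: borel_compact)
    have "(\<lambda>n. \<integral>x. h n x \<partial>\<mu>) \<longlonglongrightarrow> (\<integral>x. indicator F x \<partial>\<mu>)"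
    proof (rule integral_dominated_convergence[where w="indicator (tsupp k)"])
      show "integrable \<mu> (indicator (tsupp k) :: _ \<Rightarrow> real)"
        using \<mu> s C0infD[OF k(1)] unfolding radon_on_def
        by (intro integrable_real_indicator) (auto intro: borel_compact)
      show "AE x in \<mu>. norm (h n x) \<le> indicator (tsupp k) x" for n
      proof (intro AE_I2)
        fix x show "norm (h n x) \<le> indicator (tsupp k) x"
          using h(2,3)[of n x] h0[of x n] VW[of n] by (cases "x \<in> V n") (auto simp: indicator_def)
      qed
      show "AE x in \<mu>. (\<lambda>n. h n x) \<longlonglongrightarrow> indicator F x"
      proof (intro AE_I2)
        fix x
        show "(\<lambda>n. h n x) \<longlonglongrightarrow> indicator F x"
        proof (cases "x \<in> F")
          case True
          thus ?thesis using h(4) by simp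
        next
          case x: False
          have "infdist x F > 0"
            using x False F in_closed_iff_infdist_zero[of F x] compact_imp_closed infdist_nonneg[of x F]
            by (metis less_eq_real_def)
          hence "eventually (\<lambda>n. inverse (real (Suc n)) < infdist x F) sequentially"
            using LIMSEQ_inverse_real_of_nat by (intro order_tendstoD(2)[of _ 0]) auto
          hence "eventually (\<lambda>n. h n x = 0) sequentially"
            by eventually_elim (intro h0, auto simp: V_def)
          thus ?thesis using x by (simp add: tendsto_eventually)
        qed
      qed
    qed (use borel_compact[OF F(1)] smooth_measurable[OF C0infD(1)[OF h(1)]] in \<open>auto simp: measurable_cong_sets[OF s refl]\<close>)
    thus ?thesis using Fs sets.sets_into_space[OF Fs] by (simp add: Int_absorb2)
  qed
  show ?thesis
    by (rule that[of h]) (auto simp: hW h(2) sint_def sval_def signed_radon_on_def intro!: tendsto_diff lim)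
qed

section \<open>The diffusion functional\<close>

lemma pd_mult_smooth:
  "smooth u \<Longrightarrow> smooth v \<Longrightarrow> pd i (\<lambda>x. u x * v x) = (\<lambda>x. u x * pd i v x + pd i u x * v x)"
  by (intro ext pd_mult smooth_differentiable)

lemma abs_diff_component_le: "\<bar>x $ i - y $ i\<bar> \<le> dist x y" for x y :: "real^'n::finite"
  using component_le_norm_cart[of "x - y" i] by (simp add: dist_norm)

text \<open>A neighbourhood is asked for because tensors evaluate \<open>\<kappa>\<close> at points
  \<open>x\<close> that are close to a tested point y \<in> F but may lie outside
  \<open>F\<close>.\<close>

definition nbhd_one :: "(real^'n::finite) set \<Rightarrow> (real^'n \<Rightarrow> real) \<Rightarrow> bool" where
  "nbhd_one F \<kappa> \<longleftrightarrow> (\<exists>N. open N \<and> F \<subseteq> N \<and> (\<forall>x\<in>N. \<kappa> x = 1))"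

lemma nbhd_one_exists:
  assumes "compact F" "F \<subseteq> U" "open U"
  obtains \<kappa> where "\<kappa> \<in> C0inf U" "nbhd_one F \<kappa>" "\<And>x. 0 \<le> \<kappa> x"
  using cutoff_exists[OF assms] unfolding nbhd_one_def by metis

lemma nbhd_one_eq: "nbhd_one F \<kappa> \<Longrightarrow> x \<in> F \<Longrightarrow> \<kappa> x = 1"
  by (auto simp: nbhd_one_def)

lemma nbhd_one_mono: "nbhd_one F \<kappa> \<Longrightarrow> F' \<subseteq> F \<Longrightarrow> nbhd_one F' \<kappa>"
  unfolding nbhd_one_def by blast

lemma nbhd_one_tsupp: "nbhd_one F \<kappa> \<Longrightarrow> F \<subseteq> tsupp \<kappa>"
  using nbhd_one_eq tsupp_zero by fastforce

text \<open>Compactness of \<open>F\<close> gives the neighbourhood a uniform width, hence a strip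
  around the diagonal.\<close>

lemma nbhd_one_near:
  assumes "nbhd_one F \<kappa>" "compact F"
  shows "\<exists>\<rho>>0. \<forall>x. \<forall>y\<in>F. dist x y < \<rho> \<longrightarrow> \<kappa> x = 1"
proof -
  obtain N where N: "open N" "F \<subseteq> N" "\<forall>x\<in>N. \<kappa> x = 1" using assms(1) unfolding nbhd_one_def by blast
  obtain e where e: "e > 0" "(\<Union>x\<in>F. ball x e) \<subseteq> N"
    using compact_subset_open_imp_ball_epsilon_subset[OF assms(2) N(1,2)] by metis
  show ?thesis using e N(3) by (intro exI[of _ e]) (auto simp: subset_iff dist_commute)
qed

lemma mult_cutoff: "nbhd_one F \<kappa> \<Longrightarrow> tsupp w \<subseteq> F \<Longrightarrow> \<kappa> x * w x = w x"
  using nbhd_one_eq[of F \<kappa> x] tsupp_zero[of x w] by (cases "x \<in> F") auto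

lemma tsupp_mult_right: "tsupp (\<lambda>x. b x * w x) \<subseteq> tsupp w"
  by (rule tsupp_subsetI) (auto simp: closed_tsupp tsupp_zero)

section \<open>The second-order part of the operator\<close>

context dirichlet_form_on
begin

lemma jump_integrable':
  assumes "f \<in> borel_measurable borel" "compact X" "X \<subseteq> U" "compact F" "F \<subseteq> U"
    and "\<And>z. fst z \<notin> X \<or> snd z \<notin> F \<Longrightarrow> f z = 0"
    and "\<And>z. fst z \<in> X \<Longrightarrow> snd z \<in> F \<Longrightarrow> \<bar>f z\<bar> \<le> C * (dist (fst z) (snd z))\<^sup>2"
  shows "integrable J f"
  using assms by (intro jump_integrable[where X=X and F=F and C=C]) auto

lemma coord_measurable [measurable]:
  "(\<lambda>z. fst z $ i) \<in> borel_measurable (borel :: ((real^'n) \<times> (real^'n)) measure)"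
  "(\<lambda>z. snd z $ i) \<in> borel_measurable (borel :: ((real^'n) \<times> (real^'n)) measure)"
  by (intro borel_measurable_continuous_onI continuous_intros)+

lemma near_measurable [measurable]:
  "indicator {p. dist (fst p) (snd p) \<le> \<delta>} \<in> borel_measurable (borel :: ((real^'n) \<times> (real^'n)) measure)"
  by (intro borel_measurable_indicator borel_closed closed_Collect_le continuous_intros)

lemma tens_local':
  assumes "tens S g" "v \<in> C0inf U"
    and "\<And>\<epsilon>. \<epsilon> > 0 \<Longrightarrow> \<exists>\<rho>>0. \<forall>x. \<forall>y\<in>tsupp v. dist x y < \<rho> \<longrightarrow> \<bar>S x y\<bar> \<le> \<epsilon> * (dist x y)\<^sup>2"
  shows "integrable J (\<lambda>z. S (fst z) (snd z) * v (snd z))"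
    and "(\<integral>y. g y * v y \<partial>m) = 2 * (\<integral>z. S (fst z) (snd z) * v (snd z) \<partial>J)"
  using tens_local[OF assms] by (simp_all add: split_def)

text \<open>The case used to compare two cutoffs: their tensors agree in a strip around the
  diagonal, so the difference vanishes there.\<close>

lemma tens_local_vanish:
  assumes "tens S g" "v \<in> C0inf U" "\<rho> > 0" "\<And>x y. y \<in> tsupp v \<Longrightarrow> dist x y < \<rho> \<Longrightarrow> S x y = 0"
  shows "integrable J (\<lambda>z. S (fst z) (snd z) * v (snd z))"
    and "(\<integral>y. g y * v y \<partial>m) = 2 * (\<integral>z. S (fst z) (snd z) * v (snd z) \<partial>J)"
  by (rule tens_local'[OF assms(1,2)]; use assms(3,4) in \<open>intro exI[of _ \<rho>], auto\<close>)+

definition quad :: "(real^'n \<Rightarrow> real) \<Rightarrow> 'n \<Rightarrow> 'n \<Rightarrow> (real^'n) \<times> (real^'n) \<Rightarrow> real" where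
  "quad \<kappa> i j z = (fst z $ i - snd z $ i) * (fst z $ j - snd z $ j) * \<kappa> (fst z)"

lemma quad_measurable: "\<kappa> \<in> C0inf S \<Longrightarrow> quad \<kappa> i j \<in> borel_measurable borel"
  unfolding quad_def[abs_def] using smooth_fst_measurable[OF C0infD(1)] by measurable

lemma quad_integrable:
  assumes "\<kappa> \<in> C0inf U" "w \<in> C0inf U"
  shows "integrable J (\<lambda>z. quad \<kappa> i j z * w (snd z))"
proof -
  obtain B1 where B1: "B1 > 0" "\<And>x. \<bar>\<kappa> x\<bar> \<le> B1" using C0inf_bounded[OF assms(1)] by metis
  obtain B2 where B2: "B2 > 0" "\<And>x. \<bar>w x\<bar> \<le> B2" using C0inf_bounded[OF assms(2)] by metis
  show ?thesis
  proof (rule jump_integrable')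
    show "(\<lambda>z. quad \<kappa> i j z * w (snd z)) \<in> borel_measurable borel"
      using quad_measurable[OF assms(1)] smooth_snd_measurable[OF C0infD(1)[OF assms(2)]] by measurable
    show "compact (tsupp \<kappa>)" "tsupp \<kappa> \<subseteq> U" "compact (tsupp w)" "tsupp w \<subseteq> U"
      using C0infD[OF assms(1)] C0infD[OF assms(2)] by auto
    show "quad \<kappa> i j z * w (snd z) = 0" if "fst z \<notin> tsupp \<kappa> \<or> snd z \<notin> tsupp w" for z
      using that tsupp_zero by (auto simp: quad_def)
    show "\<bar>quad \<kappa> i j z * w (snd z)\<bar> \<le> (B1 * B2) * (dist (fst z) (snd z))\<^sup>2" for z
    proof -
      have "\<bar>quad \<kappa> i j z * w (snd z)\<bar> \<le> (dist (fst z) (snd z) * dist (fst z) (snd z) * B1) * B2"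
        unfolding quad_def abs_mult using B1(1) B2(1)
        by (intro mult_mono abs_diff_component_le B1 B2) auto
      thus ?thesis by (simp add: power2_eq_square mult_ac)
    qed
  qed
qed

definition diffusion_cut :: "(real^'n \<Rightarrow> real) \<Rightarrow> 'n \<Rightarrow> 'n \<Rightarrow> (real^'n \<Rightarrow> real) \<Rightarrow> real" where
  "diffusion_cut \<kappa> i j w = (\<integral>y. d2 \<kappa> i j y * w y \<partial>m) - 2 * (\<integral>z. quad \<kappa> i j z * w (snd z) \<partial>J)"

text \<open>A cutoff with compact support is in general not one near every compact subset of
  \<open>U\<close>, so one is chosen for each \<open>w\<close>. Any other admissible choice gives
  the same value, which makes this a functional of \<open>w\<close> alone.\<close>

definition diffusion :: "'n \<Rightarrow> 'n \<Rightarrow> (real^'n \<Rightarrow> real) \<Rightarrow> real" where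
  "diffusion i j w = diffusion_cut (SOME \<kappa>. \<kappa> \<in> C0inf U \<and> nbhd_one (tsupp w) \<kappa>) i j w"

lemma d2_integrable: "\<kappa> \<in> C0inf U \<Longrightarrow> w \<in> C0inf U \<Longrightarrow> integrable m (\<lambda>y. d2 \<kappa> i j y * w y)"
  using tens_integrable tens_d2 by blast

lemma d1_integrable: "\<kappa> \<in> C0inf U \<Longrightarrow> w \<in> C0inf U \<Longrightarrow> integrable m (\<lambda>y. d1 \<kappa> i y * w y)"
  using tens_integrable tens_d1 by blast

text \<open>The tensors for two cutoffs differ by one that vanishes in a strip around the diagonal
  over the support of \<open>w\<close>. For it the \<open>m\<close> integral is twice the
  \<open>J\<close> integral, so the change in the \<open>d2\<close> term cancels the change in the
  \<open>quad\<close> term.\<close>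

lemma diffusion_eq:
  assumes w: "w \<in> C0inf U" and \<kappa>: "\<kappa> \<in> C0inf U" "nbhd_one (tsupp w) \<kappa>"
  shows "diffusion i j w = diffusion_cut \<kappa> i j w"
proof -
  define \<eta> where "\<eta> = (SOME \<kappa>. \<kappa> \<in> C0inf U \<and> nbhd_one (tsupp w) \<kappa>)"
  have \<eta>: "\<eta> \<in> C0inf U" "nbhd_one (tsupp w) \<eta>"
    using someI[of "\<lambda>\<kappa>. \<kappa> \<in> C0inf U \<and> nbhd_one (tsupp w) \<kappa>" \<kappa>] \<kappa> unfolding \<eta>_def by auto
  have cw: "compact (tsupp w)" using C0infD[OF w] by simp
  obtain \<rho>1 where \<rho>1: "\<rho>1 > 0" "\<And>x y. y \<in> tsupp w \<Longrightarrow> dist x y < \<rho>1 \<Longrightarrow> \<kappa> x = 1"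
    using nbhd_one_near[OF \<kappa>(2) cw] by auto
  obtain \<rho>2 where \<rho>2: "\<rho>2 > 0" "\<And>x y. y \<in> tsupp w \<Longrightarrow> dist x y < \<rho>2 \<Longrightarrow> \<eta> x = 1"
    using nbhd_one_near[OF \<eta>(2) cw] by auto
  have "(\<integral>y. (d2 \<eta> i j y - d2 \<kappa> i j y) * w y \<partial>m)
      = 2 * (\<integral>z. ((fst z $ i - snd z $ i) * (fst z $ j - snd z $ j) * \<eta> (fst z)
        - (fst z $ i - snd z $ i) * (fst z $ j - snd z $ j) * \<kappa> (fst z)) * w (snd z) \<partial>J)"
  proof (rule tens_local_vanish(2)[OF tens_diff[OF tens_d2[OF \<eta>(1)] tens_d2[OF \<kappa>(1)]] w])
    show "min \<rho>1 \<rho>2 > 0" using \<rho>1 \<rho>2 by simp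
  qed (use \<rho>1(2) \<rho>2(2) in fastforce)
  also have "\<dots> = 2 * (\<integral>z. quad \<eta> i j z * w (snd z) - quad \<kappa> i j z * w (snd z) \<partial>J)"
    by (simp add: quad_def left_diff_distrib)
  finally have "diffusion_cut \<eta> i j w = diffusion_cut \<kappa> i j w"
    using quad_integrable[OF \<eta>(1) w] quad_integrable[OF \<kappa>(1) w] d2_integrable[OF \<eta>(1) w] d2_integrable[OF \<kappa>(1) w]
    by (simp add: diffusion_cut_def left_diff_distrib)
  thus ?thesis by (simp add: diffusion_def \<eta>_def)
qed

lemma diffusion_sym:
  assumes w: "w \<in> C0inf U" shows "diffusion i j w = diffusion j i w"
proof -
  obtain \<kappa> where \<kappa>: "\<kappa> \<in> C0inf U" "nbhd_one (tsupp w) \<kappa>"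
    using nbhd_one_exists[OF C0infD(2,3)[OF w] U] by metis
  have "(\<lambda>x. x $ i * (x $ j * \<kappa> x)) = (\<lambda>x. x $ j * (x $ i * \<kappa> x))"
    by (simp add: fun_eq_iff)
  hence "d2 \<kappa> i j y = d2 \<kappa> j i y" for y by (simp add: d2_def)
  moreover have "quad \<kappa> i j = quad \<kappa> j i" by (simp add: quad_def fun_eq_iff)
  ultimately show ?thesis by (simp add: diffusion_eq[OF w \<kappa>] diffusion_cut_def)
qed

lemma diffusion_add:
  assumes u: "u \<in> C0inf U" and v: "v \<in> C0inf U"
  shows "diffusion i j (\<lambda>x. u x + v x) = diffusion i j u + diffusion i j v"
proof -
  obtain \<kappa> where \<kappa>: "\<kappa> \<in> C0inf U" "nbhd_one (tsupp u \<union> tsupp v) \<kappa>"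
    by (rule nbhd_one_exists[of "tsupp u \<union> tsupp v" U]) (use C0infD[OF u] C0infD[OF v] U in auto)
  have "tsupp (\<lambda>x. u x + v x) \<subseteq> tsupp u \<union> tsupp v"
    by (rule tsupp_subsetI) (auto simp: closed_tsupp tsupp_zero)
  hence "nbhd_one (tsupp u) \<kappa>" "nbhd_one (tsupp v) \<kappa>" "nbhd_one (tsupp (\<lambda>x. u x + v x)) \<kappa>"
    using nbhd_one_mono[OF \<kappa>(2)] by auto
  thus ?thesis
    using quad_integrable[OF \<kappa>(1) u, of i j] quad_integrable[OF \<kappa>(1) v, of i j]
      d2_integrable[OF \<kappa>(1) u, of i j] d2_integrable[OF \<kappa>(1) v, of i j]
    by (simp add: diffusion_eq[OF _ \<kappa>(1)] u v C0inf_add diffusion_cut_def distrib_left)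
qed

text \<open>The combination belongs to the tensor \<open>\<kappa> x\<close> times the square of
  \<Sum> \<xi>_i (x_i - y_i). This is nonnegative and zero on the diagonal, so its jump part is at
  most its full action.\<close>

lemma diffusion_nonneg:
  assumes w: "w \<in> C0inf U" "\<And>x. 0 \<le> w x"
  shows "0 \<le> (\<Sum>i\<in>UNIV. \<Sum>j\<in>UNIV. \<xi> i * \<xi> j * diffusion i j w)"
proof -
  obtain \<kappa> where \<kappa>: "\<kappa> \<in> C0inf U" "nbhd_one (tsupp w) \<kappa>" "\<And>x. 0 \<le> \<kappa> x"
    using nbhd_one_exists[OF C0infD(2,3)[OF w(1)] U] by metis
  define S where "S = (\<lambda>x y. \<Sum>i\<in>UNIV. \<Sum>j\<in>UNIV. \<xi> i * \<xi> j * ((x $ i - y $ i) * (x $ j - y $ j) * \<kappa> x))"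
  have S: "tens S (\<lambda>y. \<Sum>i\<in>UNIV. \<Sum>j\<in>UNIV. \<xi> i * \<xi> j * d2 \<kappa> i j y)"
    unfolding S_def by (intro tens_sum tens_cmult tens_d2 \<kappa>)
  have Sq: "S x y = (\<Sum>i\<in>UNIV. \<xi> i * (x $ i - y $ i))\<^sup>2 * \<kappa> x" for x y
    unfolding S_def power2_eq_square sum_product
    by (simp only: sum_distrib_right) (intro sum.cong refl, simp add: mult_ac)
  have "2 * (\<integral>(x, y). S x y * w y \<partial>J) \<le> (\<integral>y. (\<Sum>i\<in>UNIV. \<Sum>j\<in>UNIV. \<xi> i * \<xi> j * d2 \<kappa> i j y) * w y \<partial>m)"
    by (rule tens_jump_le(2)[OF S w]) (auto simp: Sq \<kappa>(3))
  also have "(\<integral>y. (\<Sum>i\<in>UNIV. \<Sum>j\<in>UNIV. \<xi> i * \<xi> j * d2 \<kappa> i j y) * w y \<partial>m)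
      = (\<integral>y. (\<Sum>i\<in>UNIV. \<Sum>j\<in>UNIV. \<xi> i * \<xi> j * (d2 \<kappa> i j y * w y)) \<partial>m)"
    by (simp add: sum_distrib_right mult.assoc)
  also have "\<dots> = (\<Sum>i\<in>UNIV. \<Sum>j\<in>UNIV. \<xi> i * \<xi> j * (\<integral>y. d2 \<kappa> i j y * w y \<partial>m))"
    using d2_integrable[OF \<kappa>(1) w(1)] by simp
  also have "(\<integral>(x, y). S x y * w y \<partial>J)
      = (\<integral>z. (\<Sum>i\<in>UNIV. \<Sum>j\<in>UNIV. \<xi> i * \<xi> j * (quad \<kappa> i j z * w (snd z))) \<partial>J)"
    by (simp add: split_def S_def quad_def sum_distrib_right mult.assoc)
  also have "\<dots> = (\<Sum>i\<in>UNIV. \<Sum>j\<in>UNIV. \<xi> i * \<xi> j * (\<integral>z. quad \<kappa> i j z * w (snd z) \<partial>J))"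
    using quad_integrable[OF \<kappa>(1) w(1)] by simp
  finally show ?thesis
    by (simp add: diffusion_eq[OF w(1) \<kappa>(1,2)] diffusion_cut_def right_diff_distrib sum_subtractf
        sum_distrib_left mult_ac)
qed

text \<open>One cutoff serves all \<open>w\<close> supported in \<open>F\<close>, and writing
  \<open>w\<close> as \<kappa> w supplies integrable densities:
  \<open>d2 \<kappa> i j y * \<kappa> y\<close> for \<open>m\<close>, and a multiple of
  \<open>quad \<kappa> i j z * \<kappa> (snd z)\<close> for \<open>J\<close>, which is projected to
  the second coordinate.\<close>

lemma diffusion_local_rep:
  assumes F: "compact F" "F \<subseteq> U" shows "local_rep F (diffusion i j)"
proof -
  obtain \<kappa> where \<kappa>: "\<kappa> \<in> C0inf U" "nbhd_one F \<kappa>"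
    using nbhd_one_exists[OF F U] by metis
  have "local_rep F (\<lambda>w. (\<integral>y. (d2 \<kappa> i j y * \<kappa> y) * w y \<partial>m)
      + (\<integral>z. (- 2 * (quad \<kappa> i j z * \<kappa> (snd z))) * w (snd z) \<partial>J))"
    using d2_integrable[OF \<kappa>(1,1), of i j] quad_integrable[OF \<kappa>(1,1), of i j]
    by (intro local_rep_add local_rep_image integrable_mult_right)
      (auto simp: measurable_cong_sets[OF sets_J refl] measurable_cong_sets[OF sets_m refl]
        intro!: borel_measurable_continuous_onI continuous_intros)
  thus ?thesis
  proof (rule local_rep_cong)
    fix w :: "real^'n \<Rightarrow> real" assume w: "w \<in> C0inf UNIV" "tsupp w \<subseteq> F"
    have wU: "w \<in> C0inf U" using w F C0infD by (auto simp: C0inf_def)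
    have e: "\<kappa> y * w y = w y" for y by (rule mult_cutoff[OF \<kappa>(2) w(2)])
    show "diffusion i j w = (\<integral>y. (d2 \<kappa> i j y * \<kappa> y) * w y \<partial>m)
      + (\<integral>z. (- 2 * (quad \<kappa> i j z * \<kappa> (snd z))) * w (snd z) \<partial>J)"
      using diffusion_eq[OF wU \<kappa>(1) nbhd_one_mono[OF \<kappa>(2) w(2)], of i j]
      by (simp add: diffusion_cut_def mult.assoc e)
  qed
qed

end

section \<open>The drift functional\<close>

lemma Udelta_subset: "Udelta U \<delta> \<subseteq> U"
  by (auto simp: Udelta_def)

lemma open_Udelta: assumes "open U" shows "open (Udelta U \<delta>)"
proof (cases "frontier U = {}")
  case True
  thus ?thesis using assms by (simp add: Udelta_def)
next
  case False
  hence "Udelta U \<delta> = U \<inter> {x. \<delta> < infdist x (frontier U)}" by (auto simp: Udelta_def)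
  moreover have "open {x. \<delta> < infdist x (frontier U)}"
    by (intro open_Collect_less continuous_intros)
  ultimately show ?thesis using assms by auto
qed

definition thicken :: "real \<Rightarrow> (real^'n::finite) set \<Rightarrow> (real^'n) set" where
  "thicken \<delta> F = {x. \<exists>y\<in>F. dist x y \<le> \<delta>}"

lemma compact_thicken: assumes "compact F" shows "compact (thicken \<delta> F)"
proof -
  have "thicken \<delta> F = (\<lambda>z. fst z + snd z) ` (F \<times> cball 0 \<delta>)"
  proof (intro equalityI subsetI)
    fix x assume "x \<in> thicken \<delta> F"
    then obtain y where y: "y \<in> F" "dist x y \<le> \<delta>" unfolding thicken_def by auto
    have "x = fst (y, x - y) + snd (y, x - y)" by simp
    moreover have "(y, x - y) \<in> F \<times> cball 0 \<delta>" using y by (simp add: dist_norm norm_minus_commute)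
    ultimately show "x \<in> (\<lambda>z. fst z + snd z) ` (F \<times> cball 0 \<delta>)" by blast
  next
    fix x assume "x \<in> (\<lambda>z. fst z + snd z) ` (F \<times> cball 0 \<delta>)"
    then obtain y z where "y \<in> F" "norm z \<le> \<delta>" "x = y + z" by auto
    thus "x \<in> thicken \<delta> F" by (auto simp: thicken_def dist_norm intro: bexI[of _ y])
  qed
  thus ?thesis
    using assms by (auto intro!: compact_continuous_image compact_Times continuous_intros)
qed

text \<open>If a point \<open>x\<close> within distance \<delta> of y \<in> F lay outside
  \<open>U\<close>, the segment from \<open>y\<close> to \<open>x\<close> would meet the frontier at
  a point within \<delta> of \<open>y\<close>. This contradicts the definition of
  \<open>Udelta\<close>, also when the frontier is empty.\<close>

lemma thicken_subset_of_Udelta: assumes "F \<subseteq> Udelta U \<delta>" shows "thicken \<delta> F \<subseteq> U"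
proof
  fix x assume "x \<in> thicken \<delta> F"
  then obtain y where y: "y \<in> F" "dist x y \<le> \<delta>" unfolding thicken_def by auto
  hence yU: "y \<in> U" "frontier U = {} \<or> infdist y (frontier U) > \<delta>" using assms by (auto simp: Udelta_def)
  show "x \<in> U"
  proof (rule ccontr)
    assume x: "x \<notin> U"
    have "closed_segment y x \<inter> frontier U \<noteq> {}"
      using x yU(1) by (intro connected_Int_frontier connected_segment) auto
    then obtain p where p: "p \<in> closed_segment y x" "p \<in> frontier U" by blast
    have "dist y p \<le> dist y x" using p(1) by (auto dest: dist_in_closed_segment simp: dist_commute)
    hence "infdist y (frontier U) \<le> \<delta>" using infdist_le[OF p(2), of y] y(2) by (simp add: dist_commute)
    thus False using yU(2) p(2) by auto
  qed
qed

lemma subset_thicken: "\<delta> \<ge> 0 \<Longrightarrow> F \<subseteq> thicken \<delta> F"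
  unfolding thicken_def by (auto intro!: bexI)

lemma thicken_mono: "F \<subseteq> F' \<Longrightarrow> thicken \<delta> F \<subseteq> thicken \<delta> F'"
  unfolding thicken_def by blast

section \<open>The first-order part of the operator\<close>

context dirichlet_form_on
begin

lemma adjointE:
  assumes "v \<in> C0inf U"
  obtains v' where "v' \<in> L2 m" "\<And>u. u \<in> C0inf U \<Longrightarrow> (\<integral>x. A u x * v x \<partial>m) = (\<integral>x. u x * v' x \<partial>m)"
  using C0inf_adjoint C0inf_DA assms unfolding adjoint_domain_def l2_inner_def by fast

abbreviation near :: "real \<Rightarrow> (real^'n) \<times> (real^'n) \<Rightarrow> real" where
  "near \<delta> \<equiv> indicator {p. dist (fst p) (snd p) \<le> \<delta>}"

text \<open>The first two terms are the drift of \<open>x\<^sub>i\<close>, compensated outside the strip \<open>|x - y| \<le> \<delta>\<close>. The others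
  are what integrating \<open>\<partial>\<^sub>j\<partial>\<^sub>i u v\<close> by parts against the diffusion measures leaves over, minus the
  symmetric jump term of the formula; each of these two involves derivatives of \<open>w\<close>, only their
  sum is a measure.\<close>

definition drift_cut :: "real \<Rightarrow> (real^'n \<Rightarrow> real) \<Rightarrow> 'n \<Rightarrow> (real^'n \<Rightarrow> real) \<Rightarrow> real" where
  "drift_cut \<delta> \<kappa> i w = - (\<integral>y. d1 \<kappa> i y * w y \<partial>m)
     - 2 * (\<integral>z. (snd z $ i - fst z $ i) * (\<kappa> (fst z) - near \<delta> z) * w (snd z) \<partial>J)
     - 1 / 2 * (\<Sum>j\<in>UNIV. diffusion i j (pd j w))
     - (\<integral>z. (snd z $ i - fst z $ i) * (w (snd z) - w (fst z)) * near \<delta> z \<partial>J)"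

text \<open>Here the cutoff has to be one on the whole closed \<delta>-neighbourhood of the support.
  Then \<open>\<kappa> (fst z) - near \<delta> z\<close> vanishes on short jumps whose second end is
  in the support, and the second term of \<open>drift_cut\<close> sees only jumps longer than
  \<delta>.\<close>

definition drift :: "real \<Rightarrow> 'n \<Rightarrow> (real^'n \<Rightarrow> real) \<Rightarrow> real" where
  "drift \<delta> i w = drift_cut \<delta> (SOME \<kappa>. \<kappa> \<in> C0inf U \<and> nbhd_one (thicken \<delta> (tsupp w)) \<kappa>) i w"

text \<open>Beyond the strip, |x - y| is at most |x - y|^2 / \<delta>, so the linear integrand is
  dominated by a quadratic one.\<close>

lemma far_integrable:
  assumes \<kappa>: "\<kappa> \<in> C0inf U" and \<eta>: "\<eta> \<in> C0inf U" and \<delta>: "\<delta> > 0"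
  shows "integrable J (\<lambda>z. (fst z $ i - snd z $ i) * \<kappa> (fst z) * \<eta> (snd z) * (1 - near \<delta> z))"
proof -
  obtain B1 where B1: "B1 > 0" "\<And>x. \<bar>\<kappa> x\<bar> \<le> B1" using C0inf_bounded[OF \<kappa>] by metis
  obtain B2 where B2: "B2 > 0" "\<And>x. \<bar>\<eta> x\<bar> \<le> B2" using C0inf_bounded[OF \<eta>] by metis
  show ?thesis
  proof (rule jump_integrable')
    show "(\<lambda>z. (fst z $ i - snd z $ i) * \<kappa> (fst z) * \<eta> (snd z) * (1 - near \<delta> z)) \<in> borel_measurable borel"
      using smooth_snd_measurable[OF C0infD(1)[OF \<eta>]] smooth_fst_measurable[OF C0infD(1)[OF \<kappa>]] by measurable
    show "compact (tsupp \<kappa>)" "tsupp \<kappa> \<subseteq> U" "compact (tsupp \<eta>)" "tsupp \<eta> \<subseteq> U"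
      using C0infD[OF \<kappa>] C0infD[OF \<eta>] by auto
    show "(fst z $ i - snd z $ i) * \<kappa> (fst z) * \<eta> (snd z) * (1 - near \<delta> z) = 0"
      if "fst z \<notin> tsupp \<kappa> \<or> snd z \<notin> tsupp \<eta>" for z
      using that tsupp_zero[of "fst z" \<kappa>] tsupp_zero[of "snd z" \<eta>] by auto
    show "\<bar>(fst z $ i - snd z $ i) * \<kappa> (fst z) * \<eta> (snd z) * (1 - near \<delta> z)\<bar>
        \<le> (B1 * B2 / \<delta>) * (dist (fst z) (snd z))\<^sup>2" for z
    proof (cases "dist (fst z) (snd z) \<le> \<delta>")
      case True
      thus ?thesis using B1 B2 \<delta> by simp
    next
      case False
      let ?d = "dist (fst z) (snd z)"
      have "\<bar>(fst z $ i - snd z $ i) * \<kappa> (fst z) * \<eta> (snd z)\<bar> \<le> ?d * B1 * B2"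
        unfolding abs_mult using B1(1) B2(1)
        by (intro mult_mono abs_diff_component_le B1 B2) auto
      also have "\<dots> \<le> (?d * B1 * B2) * (?d / \<delta>)"
        using False B1(1) B2(1) \<delta> mult_left_mono[of 1 "?d / \<delta>" "?d * B1 * B2"] by simp
      also have "\<dots> = (B1 * B2 / \<delta>) * ?d\<^sup>2" by (simp add: power2_eq_square)
      finally show ?thesis using False by simp
    qed
  qed
qed

lemma far_term:
  assumes w: "w \<in> C0inf U" and \<kappa>: "\<kappa> \<in> C0inf U" "nbhd_one (thicken \<delta> (tsupp w)) \<kappa>"
  shows "(snd z $ i - fst z $ i) * (\<kappa> (fst z) - near \<delta> z) * w (snd z)
    = - ((fst z $ i - snd z $ i) * \<kappa> (fst z) * w (snd z) * (1 - near \<delta> z))"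
proof (cases "dist (fst z) (snd z) \<le> \<delta> \<and> snd z \<in> tsupp w")
  case True
  hence "fst z \<in> thicken \<delta> (tsupp w)" by (auto simp: thicken_def)
  hence "\<kappa> (fst z) = 1" by (rule nbhd_one_eq[OF \<kappa>(2)])
  thus ?thesis using True by simp
next
  case False
  thus ?thesis using tsupp_zero[of "snd z" w] by (auto simp: algebra_simps)
qed

lemma far_term_integrable:
  assumes "\<delta> > 0" "w \<in> C0inf U" "\<kappa> \<in> C0inf U" "nbhd_one (thicken \<delta> (tsupp w)) \<kappa>"
  shows "integrable J (\<lambda>z. (snd z $ i - fst z $ i) * (\<kappa> (fst z) - near \<delta> z) * w (snd z))"
  unfolding far_term[OF assms(2-4)]
  by (intro Bochner_Integration.integrable_minus far_integrable assms)

text \<open>Only the first two terms of \<open>drift_cut\<close> involve the cutoff. Over the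
  support of \<open>w\<close> the tensors for two cutoffs agree when |x - y| < \<delta>, so the
  change in the \<open>d1\<close> term is a \<open>J\<close> integral, and it cancels the change in
  the far term.\<close>

lemma drift_eq:
  assumes \<delta>: "\<delta> > 0" and w: "w \<in> C0inf U" and \<kappa>: "\<kappa> \<in> C0inf U" "nbhd_one (thicken \<delta> (tsupp w)) \<kappa>"
  shows "drift \<delta> i w = drift_cut \<delta> \<kappa> i w"
proof -
  define \<eta> where "\<eta> = (SOME \<kappa>. \<kappa> \<in> C0inf U \<and> nbhd_one (thicken \<delta> (tsupp w)) \<kappa>)"
  have \<eta>: "\<eta> \<in> C0inf U" "nbhd_one (thicken \<delta> (tsupp w)) \<eta>"
    using someI[of "\<lambda>\<kappa>. \<kappa> \<in> C0inf U \<and> nbhd_one (thicken \<delta> (tsupp w)) \<kappa>" \<kappa>] \<kappa> unfolding \<eta>_def by auto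
  have one: "\<kappa> x = 1" "\<eta> x = 1" if "y \<in> tsupp w" "dist x y < \<delta>" for x y
    using that by (auto intro!: nbhd_one_eq[OF \<kappa>(2)] nbhd_one_eq[OF \<eta>(2)] bexI[of _ y] simp: thicken_def)
  have "(\<integral>y. (d1 \<eta> i y - d1 \<kappa> i y) * w y \<partial>m)
      = 2 * (\<integral>z. ((fst z $ i - snd z $ i) * \<eta> (fst z) - (fst z $ i - snd z $ i) * \<kappa> (fst z)) * w (snd z) \<partial>J)"
    by (rule tens_local_vanish(2)[OF tens_diff[OF tens_d1[OF \<eta>(1)] tens_d1[OF \<kappa>(1)]] w \<delta>]) (use one in auto)
  also have "\<dots> = 2 * (\<integral>z. (snd z $ i - fst z $ i) * (\<kappa> (fst z) - near \<delta> z) * w (snd z)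
      - (snd z $ i - fst z $ i) * (\<eta> (fst z) - near \<delta> z) * w (snd z) \<partial>J)"
    by (intro arg_cong[where f="\<lambda>t. 2 * t"] Bochner_Integration.integral_cong refl) (simp add: algebra_simps)
  finally show ?thesis
    using far_term_integrable[OF \<delta> w \<kappa>, of i] far_term_integrable[OF \<delta> w \<eta>, of i]
      d1_integrable[OF \<eta>(1) w, of i] d1_integrable[OF \<kappa>(1) w, of i]
    by (simp add: drift_def \<eta>_def[symmetric] drift_cut_def left_diff_distrib)
qed

text \<open>The tensor is, near the diagonal, (x_i - y_i) times the remainder of the first-order
  Taylor expansion of \<open>w\<close> at \<open>y\<close>. It is therefore cubic there and acts as
  a pure jump integral, while its pieces act as \<open>d1 w i\<close>, \<open>d1 \<kappa> i\<close>
  and \<open>d2 \<kappa> i j\<close>. The test function is \<open>\<eta>\<close> and not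
  \<open>w\<close>, because the tensor contains w(x), which may be nonzero for \<open>y\<close>
  outside the support of \<open>w\<close>; \<open>\<kappa>\<close> must then be one near the support
  of \<open>\<eta>\<close>.\<close>

lemma diffusion_divergence:
  assumes w: "w \<in> C0inf U" and \<eta>: "\<eta> \<in> C0inf U" "nbhd_one (tsupp w) \<eta>"
    and \<kappa>: "\<kappa> \<in> C0inf U" "nbhd_one (tsupp \<eta>) \<kappa>"
  shows "integrable J (\<lambda>z. (fst z $ i - snd z $ i) * (w (fst z) - w (snd z)) * \<kappa> (fst z) * \<eta> (snd z))" (is ?I)
    and "(\<Sum>j\<in>UNIV. diffusion i j (pd j w)) = (\<integral>y. d1 w i y * \<eta> y \<partial>m) - (\<integral>y. d1 \<kappa> i y * w y \<partial>m)
      - 2 * (\<integral>z. (fst z $ i - snd z $ i) * (w (fst z) - w (snd z)) * \<kappa> (fst z) * \<eta> (snd z) \<partial>J)"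
proof -
  have sw: "smooth w" using C0infD(1)[OF w] .
  have pdw: "pd j w \<in> C0inf U" for j by (rule C0inf_pd[OF w])
  have w\<eta>: "\<eta> y * w y = w y" for y by (rule mult_cutoff[OF \<eta>(2)]) simp
  have pd\<eta>: "\<eta> y * pd j w y = pd j w y" for y j by (rule mult_cutoff[OF \<eta>(2) tsupp_pd])
  have \<kappa>w: "nbhd_one (tsupp w) \<kappa>" by (rule nbhd_one_mono[OF \<kappa>(2) nbhd_one_tsupp[OF \<eta>(2)]])
  have w\<kappa>: "\<kappa> y * w y = w y" for y by (rule mult_cutoff[OF \<kappa>w]) simp
  define S where "S = (\<lambda>x y. (x $ i - y $ i) * w x - (x $ i - y $ i) * \<kappa> x * w y
      - (\<Sum>j\<in>UNIV. (x $ i - y $ i) * (x $ j - y $ j) * \<kappa> x * pd j w y))"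
  have S: "tens S (\<lambda>y. d1 w i y - d1 \<kappa> i y * w y - (\<Sum>j\<in>UNIV. d2 \<kappa> i j y * pd j w y))"
    unfolding S_def by (intro tens_diff tens_sum tens_ymult tens_d1 tens_d2 w \<kappa>(1) sw smooth_pd)
  obtain B where B: "B > 0" "\<And>x y. \<bar>w x - w y - (\<Sum>j\<in>UNIV. (x $ j - y $ j) * pd j w y)\<bar> \<le> B * (dist x y)\<^sup>2"
    by (rule taylor_order2[OF w]) (rule that)
  obtain \<rho> where \<rho>: "\<rho> > 0" "\<And>x y. y \<in> tsupp \<eta> \<Longrightarrow> dist x y < \<rho> \<Longrightarrow> \<kappa> x = 1"
    using nbhd_one_near[OF \<kappa>(2) C0infD(2)[OF \<eta>(1)]] by auto
  have small: "\<exists>\<rho>>0. \<forall>x. \<forall>y\<in>tsupp \<eta>. dist x y < \<rho> \<longrightarrow> \<bar>S x y\<bar> \<le> \<epsilon> * (dist x y)\<^sup>2" if \<epsilon>: "\<epsilon> > 0" for \<epsilon>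
  proof (intro exI[of _ "min \<rho> (\<epsilon> / B)"] conjI allI ballI impI)
    fix x y assume y: "y \<in> tsupp \<eta>" and d: "dist x y < min \<rho> (\<epsilon> / B)"
    have k: "\<kappa> x = 1" using \<rho>(2)[OF y, of x] d by simp
    have "S x y = (x $ i - y $ i) * (w x - w y - (\<Sum>j\<in>UNIV. (x $ j - y $ j) * pd j w y))"
      by (simp add: S_def k algebra_simps sum_distrib_left)
    hence "\<bar>S x y\<bar> \<le> dist x y * (B * (dist x y)\<^sup>2)"
      by (simp only: abs_mult) (intro mult_mono abs_diff_component_le B(2), auto)
    also have "\<dots> = (dist x y * B) * (dist x y)\<^sup>2" by simp
    also have "\<dots> \<le> \<epsilon> * (dist x y)\<^sup>2" using d B(1) by (intro mult_right_mono) (auto simp: field_simps)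
    finally show "\<bar>S x y\<bar> \<le> \<epsilon> * (dist x y)\<^sup>2" .
  qed (use \<rho> \<epsilon> B in auto)
  note loc = tens_local'[OF S \<eta>(1) small]
  let ?j = "\<lambda>z. (fst z $ i - snd z $ i) * (w (fst z) - w (snd z)) * \<kappa> (fst z) * \<eta> (snd z)"
  have Se: "S (fst z) (snd z) * \<eta> (snd z) = ?j z - (\<Sum>j\<in>UNIV. quad \<kappa> i j z * pd j w (snd z))" for z
  proof -
    define P where "P = (\<Sum>j\<in>UNIV. quad \<kappa> i j z * pd j w (snd z))"
    have "P * \<eta> (snd z) = (\<Sum>j\<in>UNIV. quad \<kappa> i j z * (\<eta> (snd z) * pd j w (snd z)))"
      unfolding P_def sum_distrib_right by (intro sum.cong refl) (simp add: mult_ac)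
    hence P: "P * \<eta> (snd z) = P" by (simp only: pd\<eta> P_def)
    have "S (fst z) (snd z) * \<eta> (snd z) = (fst z $ i - snd z $ i) * (\<kappa> (fst z) * w (fst z)) * \<eta> (snd z)
        - (fst z $ i - snd z $ i) * \<kappa> (fst z) * w (snd z) * \<eta> (snd z) - P * \<eta> (snd z)"
      by (simp only: w\<kappa> S_def quad_def P_def left_diff_distrib)
    also have "\<dots> = ?j z - P" unfolding P by (simp add: algebra_simps)
    finally show ?thesis by (simp only: P_def)
  qed
  have qi: "integrable J (\<lambda>z. \<Sum>j\<in>UNIV. quad \<kappa> i j z * pd j w (snd z))"
    by (intro Bochner_Integration.integrable_sum quad_integrable \<kappa>(1) pdw)
  have "integrable J (\<lambda>z. S (fst z) (snd z) * \<eta> (snd z) + (\<Sum>j\<in>UNIV. quad \<kappa> i j z * pd j w (snd z)))"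
    by (intro Bochner_Integration.integrable_add loc(1) qi)
  thus I: ?I by (simp add: Se)
  have l: "(\<integral>z. S (fst z) (snd z) * \<eta> (snd z) \<partial>J) = (\<integral>z. ?j z \<partial>J) - (\<Sum>j\<in>UNIV. \<integral>z. quad \<kappa> i j z * pd j w (snd z) \<partial>J)"
    unfolding Se using I qi quad_integrable[OF \<kappa>(1) pdw] by simp
  have ge: "(d1 w i y - d1 \<kappa> i y * w y - (\<Sum>j\<in>UNIV. d2 \<kappa> i j y * pd j w y)) * \<eta> y
      = d1 w i y * \<eta> y - d1 \<kappa> i y * w y - (\<Sum>j\<in>UNIV. d2 \<kappa> i j y * pd j w y)" for y
  proof -
    have "(\<Sum>j\<in>UNIV. d2 \<kappa> i j y * pd j w y) * \<eta> y = (\<Sum>j\<in>UNIV. d2 \<kappa> i j y * (\<eta> y * pd j w y))"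
      unfolding sum_distrib_right by (intro sum.cong refl) (simp add: mult_ac)
    moreover have "d1 \<kappa> i y * w y * \<eta> y = d1 \<kappa> i y * (\<eta> y * w y)" by (simp add: mult_ac)
    ultimately show ?thesis by (simp only: left_diff_distrib pd\<eta> w\<eta>)
  qed
  have "(\<integral>y. d1 w i y * \<eta> y - d1 \<kappa> i y * w y - (\<Sum>j\<in>UNIV. d2 \<kappa> i j y * pd j w y) \<partial>m)
      = 2 * (\<integral>z. S (fst z) (snd z) * \<eta> (snd z) \<partial>J)"
    using loc(2) unfolding ge .
  hence "(\<integral>y. d1 w i y * \<eta> y \<partial>m) - (\<integral>y. d1 \<kappa> i y * w y \<partial>m) - (\<Sum>j\<in>UNIV. \<integral>y. d2 \<kappa> i j y * pd j w y \<partial>m)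
      = 2 * (\<integral>z. S (fst z) (snd z) * \<eta> (snd z) \<partial>J)"
    using d1_integrable[OF w \<eta>(1), of i] d1_integrable[OF \<kappa>(1) w, of i] d2_integrable[OF \<kappa>(1) pdw, of i]
    by simp
  moreover have "diffusion i j (pd j w) = (\<integral>y. d2 \<kappa> i j y * pd j w y \<partial>m) - 2 * (\<integral>z. quad \<kappa> i j z * pd j w (snd z) \<partial>J)" for j
    using diffusion_eq[OF pdw \<kappa>(1) nbhd_one_mono[OF \<kappa>w tsupp_pd]] by (simp add: diffusion_cut_def)
  ultimately show "(\<Sum>j\<in>UNIV. diffusion i j (pd j w)) = (\<integral>y. d1 w i y * \<eta> y \<partial>m) - (\<integral>y. d1 \<kappa> i y * w y \<partial>m)
      - 2 * (\<integral>z. ?j z \<partial>J)"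
    by (simp add: l sum_subtractf sum_distrib_left)
qed

text \<open>If either end of a short jump is in the support of \<open>w\<close>, both ends are in
  its closed \<delta>-neighbourhood, where both cutoffs are one; otherwise both sides are
  zero.\<close>

lemma near_part:
  assumes "dist (fst z) (snd z) \<le> \<delta>" "\<delta> > 0" "nbhd_one (thicken \<delta> (tsupp w)) \<eta>"
    and "nbhd_one (tsupp \<eta>) \<kappa>"
  shows "(w (fst z) - w (snd z)) * \<kappa> (fst z) * \<eta> (snd z) = w (fst z) - w (snd z)"
proof (cases "fst z \<in> tsupp w \<or> snd z \<in> tsupp w")
  case True
  have "fst z \<in> thicken \<delta> (tsupp w) \<and> snd z \<in> thicken \<delta> (tsupp w)"
    using True
  proof
    assume "fst z \<in> tsupp w"
    thus ?thesis using assms(1,2) by (auto simp: thicken_def dist_commute intro: bexI[of _ "fst z"])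
  next
    assume "snd z \<in> tsupp w"
    thus ?thesis using assms(1,2) by (auto simp: thicken_def intro: bexI[of _ "snd z"])
  qed
  moreover from this have "fst z \<in> tsupp \<eta>" using nbhd_one_tsupp[OF assms(3)] by auto
  ultimately show ?thesis using nbhd_one_eq[OF assms(3)] nbhd_one_eq[OF assms(4)] by simp
qed (simp add: tsupp_zero)

text \<open>Inserting the divergence identity into \<open>drift_cut\<close> cancels the integrals
  over short jumps, in which increments of \<open>w\<close> occur. What remains depends on the
  values of \<open>w\<close> through integrable densities, once the adjoint has moved
  \<open>A\<close> from \<open>w\<close> to the fixed functions \<open>\<eta> x\<close> and
  \<open>x $ i * \<eta> x\<close>.\<close>

lemma drift_local_rep:
  assumes \<delta>: "\<delta> > 0" and F: "compact F" "F \<subseteq> Udelta U \<delta>"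
  shows "local_rep F (drift \<delta> i)"
proof -
  obtain \<eta> where \<eta>: "\<eta> \<in> C0inf U" "nbhd_one (thicken \<delta> F) \<eta>"
    using nbhd_one_exists[OF compact_thicken[OF F(1)] thicken_subset_of_Udelta[OF F(2)] U] by metis
  obtain \<kappa> where \<kappa>: "\<kappa> \<in> C0inf U" "nbhd_one (tsupp \<eta>) \<kappa>"
    using nbhd_one_exists[OF C0infD(2,3)[OF \<eta>(1)] U] by metis
  have F\<eta>: "nbhd_one F \<eta>" by (rule nbhd_one_mono[OF \<eta>(2) subset_thicken]) (use \<delta> in simp)
  have \<kappa>F: "nbhd_one (thicken \<delta> F) \<kappa>" by (rule nbhd_one_mono[OF \<kappa>(2) nbhd_one_tsupp[OF \<eta>(2)]])
  obtain a where a: "a \<in> L2 m" "\<And>u. u \<in> C0inf U \<Longrightarrow> (\<integral>x. A u x * \<eta> x \<partial>m) = (\<integral>x. u x * a x \<partial>m)"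
    using adjointE[OF \<eta>(1)] by metis
  have x\<eta>: "(\<lambda>x. x $ i * \<eta> x) \<in> C0inf U" by (rule C0inf_coord[OF \<eta>(1)])
  obtain b where b: "b \<in> L2 m" "\<And>u. u \<in> C0inf U \<Longrightarrow> (\<integral>x. A u x * (x $ i * \<eta> x) \<partial>m) = (\<integral>x. u x * b x \<partial>m)"
    using adjointE[OF x\<eta>] by metis
  \<comment> \<open>The divergence term, with its factor 1/2, cancels half of the
    \<open>d1 \<kappa> i\<close> term of \<open>drift_cut\<close>. The other two summands are its
    \<open>d1 w i\<close> integral, rewritten with the adjoint images \<open>a\<close> of
    \<open>\<eta> x\<close> and \<open>b\<close> of \<open>x $ i * \<eta> x\<close>. The factor
    \<open>\<eta>\<close>, which is one on \<open>F\<close>, makes each summand integrable.\<close>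
  define \<rho>m where "\<rho>m = (\<lambda>y. 1 / 2 * (b y * \<eta> y) - 1 / 2 * (d1 \<kappa> i y * \<eta> y) - 1 / 2 * (a y * (y $ i * \<eta> y)))"
  \<comment> \<open>The density of the long jumps. The compensated far term contributes twice its
    image under the second projection; passing from all increments to those over short jumps removes
    one copy and adds the image under the first projection.\<close>
  define \<rho>J where "\<rho>J = (\<lambda>z. (fst z $ i - snd z $ i) * \<kappa> (fst z) * \<eta> (snd z) * (1 - near \<delta> z))"
  have \<rho>m: "integrable m \<rho>m" unfolding \<rho>m_def
    by (intro Bochner_Integration.integrable_diff integrable_mult_right d1_integrable \<kappa>(1) \<eta>(1)
        L2_mult_integrable a(1) b(1) C0inf_L2 x\<eta>)
  have \<rho>J: "integrable J \<rho>J" unfolding \<rho>J_def by (rule far_integrable[OF \<kappa>(1) \<eta>(1) \<delta>])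
  have "local_rep F (\<lambda>w. (\<integral>y. \<rho>m y * w y \<partial>m) + ((\<integral>z. \<rho>J z * w (snd z) \<partial>J) + (\<integral>z. \<rho>J z * w (fst z) \<partial>J)))"
    using \<rho>m \<rho>J
    by (intro local_rep_add local_rep_image)
      (auto simp: measurable_cong_sets[OF sets_J refl] measurable_cong_sets[OF sets_m refl]
        intro!: borel_measurable_continuous_onI continuous_intros)
  thus ?thesis
  proof (rule local_rep_cong)
    fix w :: "real^'n \<Rightarrow> real" assume w: "w \<in> C0inf UNIV" "tsupp w \<subseteq> F"
    have wU: "w \<in> C0inf U" using w F Udelta_subset[of U \<delta>] by (auto simp: C0inf_def)
    have th: "thicken \<delta> (tsupp w) \<subseteq> thicken \<delta> F" by (rule thicken_mono[OF w(2)])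
    note \<kappa>w = nbhd_one_mono[OF \<kappa>F th]
    have ew: "\<eta> y * w y = w y" for y by (rule mult_cutoff[OF F\<eta> w(2)])
    let ?j = "\<lambda>z. (fst z $ i - snd z $ i) * (w (fst z) - w (snd z)) * \<kappa> (fst z) * \<eta> (snd z)"
    note dd = diffusion_divergence[OF wU \<eta>(1) nbhd_one_mono[OF F\<eta> w(2)] \<kappa>, of i]
    have wL: "w \<in> L2 m" by (rule C0inf_L2[OF wU])
    have xwL: "(\<lambda>x. x $ i * w x) \<in> L2 m" by (intro C0inf_L2 C0inf_coord wU)
    have i1: "integrable m (\<lambda>x. x $ i * w x * a x)" using L2_mult_integrable[OF xwL a(1)] .
    have i2: "integrable m (\<lambda>x. w x * b x)" using L2_mult_integrable[OF wL b(1)] .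
    have d1w: "(\<integral>y. d1 w i y * \<eta> y \<partial>m) = (\<integral>x. x $ i * w x * a x \<partial>m) - (\<integral>x. w x * b x \<partial>m)"
    proof -
      have "(\<integral>y. d1 w i y * \<eta> y \<partial>m) = (\<integral>y. A (\<lambda>x. x $ i * w x) y * \<eta> y - A w y * (y $ i * \<eta> y) \<partial>m)"
        by (simp add: d1_def algebra_simps)
      also have "\<dots> = (\<integral>y. A (\<lambda>x. x $ i * w x) y * \<eta> y \<partial>m) - (\<integral>y. A w y * (y $ i * \<eta> y) \<partial>m)"
        by (intro Bochner_Integration.integral_diff L2_mult_integrable C0inf_A_L2 C0inf_L2 C0inf_coord wU \<eta>(1))
      finally show ?thesis by (simp add: a(2)[OF C0inf_coord[OF wU]] b(2)[OF wU])
    qed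
    have J1: "(\<integral>z. (snd z $ i - fst z $ i) * (\<kappa> (fst z) - near \<delta> z) * w (snd z) \<partial>J) = - (\<integral>z. \<rho>J z * w (snd z) \<partial>J)"
      unfolding far_term[OF wU \<kappa>(1) \<kappa>w] integral_minus[symmetric]
    proof (intro Bochner_Integration.integral_cong refl)
      fix z show "- ((fst z $ i - snd z $ i) * \<kappa> (fst z) * w (snd z) * (1 - near \<delta> z)) = - (\<rho>J z * w (snd z))"
      proof -
        have "\<rho>J z * w (snd z) = (fst z $ i - snd z $ i) * \<kappa> (fst z) * (\<eta> (snd z) * w (snd z)) * (1 - near \<delta> z)"
          by (simp add: \<rho>J_def mult_ac)
        thus ?thesis by (simp only: ew)
      qed
    qed
    obtain B where B: "\<And>x. \<bar>w x\<bar> \<le> B" using C0inf_bounded[OF wU] by metis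
    have sw: "smooth w" using C0infD(1)[OF wU] .
    have \<rho>w: "integrable J (\<lambda>z. \<rho>J z * w (snd z))" "integrable J (\<lambda>z. \<rho>J z * w (fst z))"
    proof -
      have "integrable J (\<lambda>z. \<rho>J z * f z)" if "f \<in> borel_measurable borel" "\<And>z. \<bar>f z\<bar> \<le> B" for f
      proof (rule Bochner_Integration.integrable_bound)
        show "integrable J (\<lambda>z. \<rho>J z * B)" using \<rho>J by simp
        have "f \<in> borel_measurable J" using that(1) by (simp add: measurable_cong_sets[OF sets_J refl])
        thus "(\<lambda>z. \<rho>J z * f z) \<in> borel_measurable J" using \<rho>J by measurable
        have "\<bar>\<rho>J z\<bar> * \<bar>f z\<bar> \<le> \<bar>\<rho>J z\<bar> * \<bar>B\<bar>" for z using that(2)[of z] by (intro mult_left_mono) auto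
        thus "AE z in J. norm (\<rho>J z * f z) \<le> norm (\<rho>J z * B)" by (simp add: abs_mult)
      qed
      thus "integrable J (\<lambda>z. \<rho>J z * w (snd z))" "integrable J (\<lambda>z. \<rho>J z * w (fst z))"
        using smooth_snd_measurable[OF sw] smooth_fst_measurable[OF sw] B by auto
    qed
    \<comment> \<open>On short jumps both cutoffs are one and \<open>?j\<close> is the plain
      increment; the long jumps contained in \<open>?j\<close> are taken out by the two
      \<open>\<rho>J\<close> integrals.\<close>
    have J3: "(\<integral>z. (snd z $ i - fst z $ i) * (w (snd z) - w (fst z)) * near \<delta> z \<partial>J)
        = (\<integral>z. ?j z \<partial>J) - (\<integral>z. \<rho>J z * w (fst z) \<partial>J) + (\<integral>z. \<rho>J z * w (snd z) \<partial>J)"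
    proof -
      have "(snd z $ i - fst z $ i) * (w (snd z) - w (fst z)) * near \<delta> z
          = ?j z - \<rho>J z * w (fst z) + \<rho>J z * w (snd z)" for z
      proof (cases "dist (fst z) (snd z) \<le> \<delta>")
        case True
        have "?j z = (fst z $ i - snd z $ i) * ((w (fst z) - w (snd z)) * \<kappa> (fst z) * \<eta> (snd z))"
          by (simp add: mult_ac)
        also have "\<dots> = (fst z $ i - snd z $ i) * (w (fst z) - w (snd z))"
          by (simp only: near_part[OF True \<delta> nbhd_one_mono[OF \<eta>(2) th] \<kappa>(2)])
        finally show ?thesis using True by (simp add: \<rho>J_def algebra_simps)
      next
        case False
        thus ?thesis by (simp add: \<rho>J_def algebra_simps)
      qed
      thus ?thesis using dd(1) \<rho>w by simp
    qed
    have m1: "(\<integral>y. \<rho>m y * w y \<partial>m) = 1 / 2 * (\<integral>x. w x * b x \<partial>m) - 1 / 2 * (\<integral>y. d1 \<kappa> i y * w y \<partial>m)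
        - 1 / 2 * (\<integral>x. x $ i * w x * a x \<partial>m)"
    proof -
      have "\<rho>m y * w y = 1 / 2 * (w y * b y) - 1 / 2 * (d1 \<kappa> i y * w y) - 1 / 2 * (y $ i * w y * a y)" for y
      proof -
        have "\<rho>m y * w y = 1 / 2 * ((\<eta> y * w y) * b y) - 1 / 2 * (d1 \<kappa> i y * (\<eta> y * w y)) - 1 / 2 * (y $ i * (\<eta> y * w y) * a y)"
          by (simp add: \<rho>m_def algebra_simps)
        thus ?thesis by (simp only: ew)
      qed
      thus ?thesis using i1 i2 d1_integrable[OF \<kappa>(1) wU, of i] by simp
    qed
    show "drift \<delta> i w = (\<integral>y. \<rho>m y * w y \<partial>m) + ((\<integral>z. \<rho>J z * w (snd z) \<partial>J) + (\<integral>z. \<rho>J z * w (fst z) \<partial>J))"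
      unfolding drift_eq[OF \<delta> wU \<kappa>(1) \<kappa>w] drift_cut_def J1 J3 m1 dd(2) d1w by (simp add: algebra_simps)
  qed
qed

text \<open>On short jumps the integrand agrees in absolute value with the one of
  \<open>diffusion_divergence\<close>, and elsewhere it is zero. The support in
  \<open>Udelta\<close> makes room for cutoffs that are one at both ends of these jumps.\<close>

lemma near_increment_integrable:
  assumes \<delta>: "\<delta> > 0" and w: "w \<in> C0inf (Udelta U \<delta>)"
  shows "integrable J (\<lambda>z. (snd z $ i - fst z $ i) * (w (snd z) - w (fst z)) * near \<delta> z)"
proof -
  have wU: "w \<in> C0inf U" using w C0inf_mono[OF Udelta_subset] by blast
  obtain \<eta> where \<eta>: "\<eta> \<in> C0inf U" "nbhd_one (thicken \<delta> (tsupp w)) \<eta>"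
    using nbhd_one_exists[OF compact_thicken[OF C0infD(2)[OF w]] thicken_subset_of_Udelta[OF C0infD(3)[OF w]] U] by metis
  obtain \<kappa> where \<kappa>: "\<kappa> \<in> C0inf U" "nbhd_one (tsupp \<eta>) \<kappa>"
    using nbhd_one_exists[OF C0infD(2,3)[OF \<eta>(1)] U] by metis
  have e\<eta>: "nbhd_one (tsupp w) \<eta>" by (rule nbhd_one_mono[OF \<eta>(2) subset_thicken]) (use \<delta> in simp)
  note I = diffusion_divergence(1)[OF wU \<eta>(1) e\<eta> \<kappa>, of i]
  show ?thesis
  proof (rule Bochner_Integration.integrable_bound[OF I])
    show "(\<lambda>z. (snd z $ i - fst z $ i) * (w (snd z) - w (fst z)) * near \<delta> z) \<in> borel_measurable J"
      using smooth_snd_measurable[OF C0infD(1)[OF w]] smooth_fst_measurable[OF C0infD(1)[OF w]]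
      unfolding measurable_cong_sets[OF sets_J refl] by measurable
    have "\<bar>(snd z $ i - fst z $ i) * (w (snd z) - w (fst z)) * near \<delta> z\<bar>
        \<le> \<bar>(fst z $ i - snd z $ i) * (w (fst z) - w (snd z)) * \<kappa> (fst z) * \<eta> (snd z)\<bar>" for z
    proof (cases "dist (fst z) (snd z) \<le> \<delta>")
      case True
      have "(fst z $ i - snd z $ i) * (w (fst z) - w (snd z)) * \<kappa> (fst z) * \<eta> (snd z)
          = (fst z $ i - snd z $ i) * ((w (fst z) - w (snd z)) * \<kappa> (fst z) * \<eta> (snd z))"
        by (simp add: mult_ac)
      also have "\<dots> = (fst z $ i - snd z $ i) * (w (fst z) - w (snd z))"
        by (simp only: near_part[OF True \<delta> \<eta>(2) \<kappa>(2)])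
      finally have e: "(fst z $ i - snd z $ i) * (w (fst z) - w (snd z)) * \<kappa> (fst z) * \<eta> (snd z)
          = (fst z $ i - snd z $ i) * (w (fst z) - w (snd z))" .
      show ?thesis unfolding e using True by (simp add: abs_mult abs_minus_commute)
    qed simp
    thus "AE z in J. norm ((snd z $ i - fst z $ i) * (w (snd z) - w (fst z)) * near \<delta> z)
        \<le> norm ((fst z $ i - snd z $ i) * (w (fst z) - w (snd z)) * \<kappa> (fst z) * \<eta> (snd z))" by simp
  qed
qed

end

section \<open>The representation formula\<close>

context dirichlet_form_on
begin

text \<open>The Taylor remainder of \<open>u\<close> after second order, localized by
  \<open>\<kappa>\<close> and tested with \<open>v\<close>, acts as a pure jump integral. Its pieces
  involve \<open>A u\<close>, \<open>A \<kappa>\<close>, the first moments and half of the second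
  moments, which yield in turn the form, the killing term, the drift and the diffusion. The
  \<open>J\<close> integrals left over by them recombine to the two jump terms.\<close>

lemma form_formula:
  assumes \<delta>: "\<delta> > 0" and u: "u \<in> C0inf (Udelta U \<delta>)" and v: "v \<in> C0inf (Udelta U \<delta>)"
  defines "jump \<equiv> \<lambda>z. 2 * (u (snd z) - u (fst z)
      - (\<Sum>i\<in>UNIV. (snd z $ i - fst z $ i) * pd i u (snd z) * near \<delta> z)) * v (snd z)"
    and "osc \<equiv> \<lambda>z. (\<Sum>i\<in>UNIV. (snd z $ i - fst z $ i)
      * (pd i u (snd z) * v (snd z) - pd i u (fst z) * v (fst z))) * near \<delta> z"
  shows "integrable J osc" and "integrable J jump" and "integrable K (\<lambda>x. u x * v x)"
    and "- (\<integral>x. A u x * v x \<partial>m) =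
      1 / 2 * (\<Sum>i\<in>UNIV. \<Sum>j\<in>UNIV. diffusion i j (\<lambda>x. pd i u x * pd j v x))
      + (\<Sum>i\<in>UNIV. drift \<delta> i (\<lambda>x. pd i u x * v x))
      + (\<integral>z. osc z \<partial>J) + (\<integral>z. jump z \<partial>J) + (\<integral>x. u x * v x \<partial>K)"
proof -
  define F where "F = tsupp v"
  have uU: "u \<in> C0inf U" and vU: "v \<in> C0inf U" using u v C0inf_mono[OF Udelta_subset] by blast+
  have su: "smooth u" "smooth (pd i u)" "smooth (pd j (pd i u))" for i j
    using C0infD(1)[OF uU] by (auto intro: smooth_pd)
  have F: "compact F" "F \<subseteq> Udelta U \<delta>" using C0infD[OF v] by (auto simp: F_def)
  obtain \<kappa> where \<kappa>: "\<kappa> \<in> C0inf U" "nbhd_one (thicken \<delta> F) \<kappa>"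
    using nbhd_one_exists[OF compact_thicken[OF F(1)] thicken_subset_of_Udelta[OF F(2)] U] by metis
  have \<kappa>F: "nbhd_one F \<kappa>" by (rule nbhd_one_mono[OF \<kappa>(2) subset_thicken]) (use \<delta> in simp)
  define w where "w = (\<lambda>i x. pd i u x * v x)"
  define W where "W = (\<lambda>i j x. pd j (pd i u) x * v x)"
  define Z where "Z = (\<lambda>i j x. pd i u x * pd j v x)"
  have wV: "w i \<in> C0inf (Udelta U \<delta>)" and wU: "w i \<in> C0inf U" and WU: "W i j \<in> C0inf U"
    and ZU: "Z i j \<in> C0inf U" and uvU: "(\<lambda>x. u x * v x) \<in> C0inf U" for i j
    unfolding w_def W_def Z_def using su v vU by (auto intro: C0inf_mult_left C0inf_pd)
  have wF: "tsupp (w i) \<subseteq> F" for i unfolding w_def F_def by (rule tsupp_mult_right)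
  have uvF: "tsupp (\<lambda>x. u x * v x) \<subseteq> F" unfolding F_def by (rule tsupp_mult_right)
  have \<kappa>w: "nbhd_one (thicken \<delta> (tsupp (w i))) \<kappa>" for i
    by (rule nbhd_one_mono[OF \<kappa>(2) thicken_mono[OF wF]])

  define R where "R = (\<lambda>x y. u x * 1 - \<kappa> x * u y - (\<Sum>i\<in>UNIV. (x $ i - y $ i) * \<kappa> x * pd i u y)
     - 1 / 2 * (\<Sum>i\<in>UNIV. \<Sum>j\<in>UNIV. (x $ i - y $ i) * (x $ j - y $ j) * \<kappa> x * pd j (pd i u) y))"
  define gR where "gR = (\<lambda>y. 1 * A u y - u y * A \<kappa> y - (\<Sum>i\<in>UNIV. d1 \<kappa> i y * pd i u y)
     - 1 / 2 * (\<Sum>i\<in>UNIV. \<Sum>j\<in>UNIV. d2 \<kappa> i j y * pd j (pd i u) y))"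
  have R: "tens R gR" unfolding R_def gR_def
    by (intro tens_diff tens_cmult tens_sum tens_ymult tens_single tens_d1 tens_d2 uU \<kappa>(1) su smooth_const)
  obtain B where B: "B > 0" "\<And>x y. \<bar>u x - u y - (\<Sum>i\<in>UNIV. (x $ i - y $ i) * pd i u y)
       - 1 / 2 * (\<Sum>i\<in>UNIV. \<Sum>j\<in>UNIV. (x $ i - y $ i) * (x $ j - y $ j) * pd j (pd i u) y)\<bar>
       \<le> B * (dist x y) ^ 3" by (rule taylor_order3[OF uU]) (rule that)
  have small: "\<exists>\<rho>>0. \<forall>x. \<forall>y\<in>tsupp v. dist x y < \<rho> \<longrightarrow> \<bar>R x y\<bar> \<le> \<epsilon> * (dist x y)\<^sup>2" if \<epsilon>: "\<epsilon> > 0" for \<epsilon>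
  \<comment> \<open>Within distance \<delta> of the support the cutoff is one and the tensor is the
    plain remainder; below distance \<epsilon> / B the cubic bound is at most \<epsilon> |x -
    y|^2.\<close>
  proof (intro exI[of _ "min \<delta> (\<epsilon> / B)"] conjI allI ballI impI)
    fix x y assume y: "y \<in> tsupp v" and d: "dist x y < min \<delta> (\<epsilon> / B)"
    have "x \<in> thicken \<delta> F" using y d unfolding thicken_def F_def by (auto intro!: bexI[of _ y])
    hence k: "\<kappa> x = 1" by (rule nbhd_one_eq[OF \<kappa>(2)])
    have "\<bar>R x y\<bar> \<le> B * (dist x y) ^ 3" unfolding R_def k mult_1_left mult_1_right by (rule B(2))
    also have "\<dots> = (dist x y * B) * (dist x y)\<^sup>2" by (simp add: power3_eq_cube power2_eq_square)
    also have "\<dots> \<le> \<epsilon> * (dist x y)\<^sup>2" using d B(1) by (intro mult_right_mono) (auto simp: field_simps)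
    finally show "\<bar>R x y\<bar> \<le> \<epsilon> * (dist x y)\<^sup>2" .
  qed (use \<delta> \<epsilon> B in auto)
  note loc = tens_local'[OF R vU small]

  \<comment> \<open>The kinds of \<open>J\<close> integrands: \<open>r\<close> from the remainder,
    \<open>f\<close> from the compensation of the drift, \<open>q\<close> from the second moments,
    \<open>k\<close> from the zeroth-order term, \<open>c\<close> from the increments over short
    jumps.\<close>
  define r where "r = (\<lambda>z. R (fst z) (snd z) * v (snd z))"
  define f where "f = (\<lambda>i z. (snd z $ i - fst z $ i) * (\<kappa> (fst z) - near \<delta> z) * w i (snd z))"
  define q where "q = (\<lambda>i j z. quad \<kappa> i j z * W i j (snd z))"
  define k where "k = (\<lambda>z. 2 * (\<kappa> (snd z) - \<kappa> (fst z)) * (u (snd z) * v (snd z)))"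
  define c where "c = (\<lambda>i z. (snd z $ i - fst z $ i) * (w i (snd z) - w i (fst z)) * near \<delta> z)"
  have ir: "integrable J r" using loc(1) by (simp add: r_def)
  have "if": "integrable J (f i)" for i unfolding f_def by (rule far_term_integrable[OF \<delta> wU \<kappa>(1) \<kappa>w])
  have iq: "integrable J (q i j)" for i j unfolding q_def by (rule quad_integrable[OF \<kappa>(1) WU])
  have ic: "integrable J (c i)" for i unfolding c_def by (rule near_increment_integrable[OF \<delta> wV])
  obtain N where N: "open N" "F \<subseteq> N" "\<forall>x\<in>N. \<kappa> x = 1" using \<kappa>F unfolding nbhd_one_def by blast
  \<comment> \<open>\<open>\<kappa>\<close> is constant near the support of \<open>u * v\<close>, so
    the defining identity of \<open>J\<close> and \<open>K\<close> evaluates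
    \<open>A \<kappa>\<close> against this product. This is the source of the killing term.\<close>
  note jk = jump_kill_formula[OF \<kappa>(1) uvU N(1) subset_trans[OF uvF N(2)] N(3)]
  have \<kappa>uv: "\<kappa> x * (u x * v x) = u x * v x" for x by (rule mult_cutoff[OF \<kappa>F uvF])
  have ik: "integrable J k" using jk(1) by (simp add: k_def split_def)
  show iK: "integrable K (\<lambda>x. u x * v x)" using jk(2) by (simp add: \<kappa>uv)
  have jk3: "- (\<integral>x. A \<kappa> x * (u x * v x) \<partial>m) = (\<integral>z. k z \<partial>J) + (\<integral>x. u x * v x \<partial>K)"
    using jk(3) by (simp add: \<kappa>uv k_def split_def)

  have comp_c: "osc = (\<lambda>z. \<Sum>i\<in>UNIV. c i z)"
    unfolding osc_def c_def w_def sum_distrib_right by (rule refl)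
  show "integrable J osc" unfolding comp_c by (intro Bochner_Integration.integrable_sum ic)
  \<comment> \<open>Every term with \<open>\<kappa> x\<close> cancels on the right: order zero
    between \<open>k\<close> and \<open>r\<close>, order one between \<open>f\<close> and
    \<open>r\<close>, order two between \<open>q\<close> and \<open>r\<close>. The compensator
    restricted to the strip is what \<open>f\<close> leaves behind.\<close>
  have jump_e: "jump z = k z + 2 * (\<Sum>i\<in>UNIV. f i z) - (\<Sum>i\<in>UNIV. \<Sum>j\<in>UNIV. q i j z) - 2 * r z" for z
  proof -
    define x where "x = fst z"
    define y where "y = snd z"
    define S1 where "S1 = (\<Sum>i\<in>UNIV. (y $ i - x $ i) * pd i u y)"
    define S2 where "S2 = (\<Sum>i\<in>UNIV. \<Sum>j\<in>UNIV. (x $ i - y $ i) * (x $ j - y $ j) * \<kappa> x * pd j (pd i u) y)"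
    have "(\<Sum>i\<in>UNIV. (y $ i - x $ i) * pd i u y * near \<delta> z) = S1 * near \<delta> z"
      by (simp add: S1_def sum_distrib_right)
    hence j: "jump z = 2 * (u y - u x - S1 * near \<delta> z) * v y" by (simp add: jump_def x_def y_def)
    have f: "(\<Sum>i\<in>UNIV. f i z) = S1 * ((\<kappa> x - near \<delta> z) * v y)"
      unfolding f_def w_def S1_def x_def y_def sum_distrib_right by (intro sum.cong refl) (simp add: mult_ac)
    have q: "(\<Sum>i\<in>UNIV. \<Sum>j\<in>UNIV. q i j z) = S2 * v y"
      unfolding q_def quad_def W_def S2_def x_def y_def sum_distrib_right by (intro sum.cong refl) (simp add: mult_ac)
    have "(\<Sum>i\<in>UNIV. (x $ i - y $ i) * \<kappa> x * pd i u y) = - (S1 * \<kappa> x)"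
      unfolding S1_def sum_distrib_right sum_negf[symmetric] by (intro sum.cong refl) (simp add: algebra_simps)
    hence r: "r z = (u x - \<kappa> x * u y + S1 * \<kappa> x - 1 / 2 * S2) * v y"
      by (simp add: r_def R_def S2_def x_def y_def)
    have "\<kappa> y * (u y * v y) = u y * v y" by (rule \<kappa>uv)
    hence "k z = 2 * (u y * v y) - 2 * \<kappa> x * (u y * v y)"
      by (simp add: k_def x_def y_def algebra_simps)
    thus ?thesis unfolding j f q r by (simp add: algebra_simps)
  qed
  have sums: "integrable J (\<lambda>z. \<Sum>i\<in>UNIV. f i z)" "integrable J (\<lambda>z. \<Sum>i\<in>UNIV. \<Sum>j\<in>UNIV. q i j z)"
    using "if" iq by auto
  show "integrable J jump" unfolding jump_e[abs_def]
    by (intro Bochner_Integration.integrable_diff Bochner_Integration.integrable_add integrable_mult_right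
        ik ir sums)
  have int_jump: "(\<integral>z. jump z \<partial>J) = (\<integral>z. k z \<partial>J) + 2 * (\<Sum>i\<in>UNIV. \<integral>z. f i z \<partial>J)
      - (\<Sum>i\<in>UNIV. \<Sum>j\<in>UNIV. \<integral>z. q i j z \<partial>J) - 2 * (\<integral>z. r z \<partial>J)"
    unfolding jump_e using ik ir sums "if" iq by simp
  have int_comp: "(\<integral>z. osc z \<partial>J) = (\<Sum>i\<in>UNIV. \<integral>z. c i z \<partial>J)" unfolding comp_c using ic by simp

  have d2W: "(\<integral>y. d2 \<kappa> i j y * W i j y \<partial>m) = diffusion i j (W i j) + 2 * (\<integral>z. q i j z \<partial>J)" for i j
  proof -
    have "tsupp (W i j) \<subseteq> F" unfolding W_def F_def by (rule tsupp_mult_right)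
    from diffusion_eq[OF WU \<kappa>(1) nbhd_one_mono[OF \<kappa>F this]] show ?thesis
      by (simp add: diffusion_cut_def q_def)
  qed
  \<comment> \<open>The product rule performs the integration by parts. The divergence contained in
    the drift splits into \<open>W\<close>, which cancels the second-order Taylor term, and
    \<open>Z\<close>, the product of first derivatives in the final formula.\<close>
  have dw: "diffusion i j (pd j (w i)) = diffusion i j (Z i j) + diffusion i j (W i j)" for i j
  proof -
    have "pd j (w i) = (\<lambda>x. Z i j x + W i j x)"
      unfolding w_def Z_def W_def by (rule pd_mult_smooth[OF su(2) C0infD(1)[OF v]])
    thus ?thesis by (simp add: diffusion_add[OF ZU WU])
  qed
  have d1w: "(\<integral>y. d1 \<kappa> i y * w i y \<partial>m) = - drift \<delta> i (w i) - 2 * (\<integral>z. f i z \<partial>J)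
      - 1 / 2 * (\<Sum>j\<in>UNIV. diffusion i j (Z i j) + diffusion i j (W i j)) - (\<integral>z. c i z \<partial>J)" for i
    using drift_eq[OF \<delta> wU \<kappa>(1) \<kappa>w, of i] by (simp add: drift_cut_def f_def c_def dw)
  have gRv: "gR y * v y = A u y * v y - A \<kappa> y * (u y * v y) - (\<Sum>i\<in>UNIV. d1 \<kappa> i y * w i y)
      - 1 / 2 * (\<Sum>i\<in>UNIV. \<Sum>j\<in>UNIV. d2 \<kappa> i j y * W i j y)" for y
    unfolding gR_def w_def W_def
    by (simp add: left_diff_distrib sum_distrib_right mult.assoc)
  have "(\<integral>y. gR y * v y \<partial>m) = (\<integral>y. A u y * v y \<partial>m) - (\<integral>y. A \<kappa> y * (u y * v y) \<partial>m)
      - (\<Sum>i\<in>UNIV. \<integral>y. d1 \<kappa> i y * w i y \<partial>m) - 1 / 2 * (\<Sum>i\<in>UNIV. \<Sum>j\<in>UNIV. \<integral>y. d2 \<kappa> i j y * W i j y \<partial>m)"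
  proof -
    have a: "integrable m (\<lambda>y. A u y * v y)" "integrable m (\<lambda>y. A \<kappa> y * (u y * v y))"
      by (intro L2_mult_integrable C0inf_A_L2 C0inf_L2 uU vU \<kappa>(1) uvU)+
    show ?thesis unfolding gRv using a d1_integrable[OF \<kappa>(1) wU] d2_integrable[OF \<kappa>(1) WU] by simp
  qed
  moreover have "(\<integral>y. gR y * v y \<partial>m) = 2 * (\<integral>z. r z \<partial>J)" using loc(2) by (simp add: r_def)
  ultimately have main: "(\<integral>y. A u y * v y \<partial>m) = (\<integral>y. A \<kappa> y * (u y * v y) \<partial>m)
      + (\<Sum>i\<in>UNIV. \<integral>y. d1 \<kappa> i y * w i y \<partial>m)
      + 1 / 2 * (\<Sum>i\<in>UNIV. \<Sum>j\<in>UNIV. \<integral>y. d2 \<kappa> i j y * W i j y \<partial>m) + 2 * (\<integral>z. r z \<partial>J)"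
    by simp
  show "- (\<integral>x. A u x * v x \<partial>m) =
      1 / 2 * (\<Sum>i\<in>UNIV. \<Sum>j\<in>UNIV. diffusion i j (\<lambda>x. pd i u x * pd j v x))
      + (\<Sum>i\<in>UNIV. drift \<delta> i (\<lambda>x. pd i u x * v x))
      + (\<integral>z. osc z \<partial>J) + (\<integral>z. jump z \<partial>J) + (\<integral>x. u x * v x \<partial>K)"
  proof -
    have "(\<lambda>x. pd i u x * v x) = w i" "(\<lambda>x. pd i u x * pd j v x) = Z i j" for i j
      by (simp_all add: w_def Z_def)
    thus ?thesis unfolding main d1w d2W int_jump int_comp using jk3
      by (simp add: sum.distrib sum_subtractf sum_negf sum_distrib_left[symmetric]
          sum_divide_distrib[symmetric] add_divide_distrib)
  qed
qed

section \<open>From functionals to measures\<close>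

lemma diffusion_measures:
  obtains \<nu> where "\<And>i j. signed_radon_on U (\<nu> i j)" "\<And>i j w. w \<in> C0inf U \<Longrightarrow> sint (\<nu> i j) w = diffusion i j w"
proof -
  have "\<exists>\<mu>. signed_radon_on U \<mu> \<and> (\<forall>w\<in>C0inf U. sint \<mu> w = diffusion i j w)" for i j
    by (rule local_rep_glue[OF U diffusion_local_rep]) auto
  then obtain \<nu> where "\<And>i j. signed_radon_on U (\<nu> i j) \<and> (\<forall>w\<in>C0inf U. sint (\<nu> i j) w = diffusion i j w)"
    by metis
  thus ?thesis using that by blast
qed

lemma drift_measures:
  assumes "\<delta> > 0"
  obtains \<nu> where "\<And>i. signed_radon_on (Udelta U \<delta>) (\<nu> i)"
    "\<And>i w. w \<in> C0inf (Udelta U \<delta>) \<Longrightarrow> sint (\<nu> i) w = drift \<delta> i w"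
proof -
  have "\<exists>\<mu>. signed_radon_on (Udelta U \<delta>) \<mu> \<and> (\<forall>w\<in>C0inf (Udelta U \<delta>). sint \<mu> w = drift \<delta> i w)" for i
    by (rule local_rep_glue[OF open_Udelta[OF U] drift_local_rep[OF assms]]) auto
  then obtain \<nu> where "\<And>i. signed_radon_on (Udelta U \<delta>) (\<nu> i) \<and> (\<forall>w\<in>C0inf (Udelta U \<delta>). sint (\<nu> i) w = drift \<delta> i w)"
    by metis
  thus ?thesis using that by blast
qed

text \<open>Symmetry and positivity hold for the functionals on nonnegative test functions;
  approximating the indicator of \<open>F\<close> by such functions carries them over to the values
  on \<open>F\<close>.\<close>

lemma diffusion_measure_compact:
  assumes \<nu>: "\<And>i j. signed_radon_on U (\<nu> i j)" "\<And>i j w. w \<in> C0inf U \<Longrightarrow> sint (\<nu> i j) w = diffusion i j w"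
    and F: "compact F" "F \<subseteq> U"
  shows "sval (\<nu> i j) F = sval (\<nu> j i) F"
    and "0 \<le> (\<Sum>i\<in>UNIV. \<Sum>j\<in>UNIV. \<xi> i * \<xi> j * sval (\<nu> i j) F)"
proof -
  obtain h where h: "\<And>n. h n \<in> C0inf U" "\<And>n x. 0 \<le> h n x"
    "\<And>\<nu>. signed_radon_on U \<nu> \<Longrightarrow> (\<lambda>n::nat. sint \<nu> (h n)) \<longlonglongrightarrow> sval \<nu> F"
    using compact_approx[OF U F] by metis
  have lim: "(\<lambda>n. diffusion i j (h n)) \<longlonglongrightarrow> sval (\<nu> i j) F" for i j
    using h(3)[OF \<nu>(1)[of i j]] by (simp add: \<nu>(2)[OF h(1)])
  show "sval (\<nu> i j) F = sval (\<nu> j i) F"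
    using LIMSEQ_unique[OF lim[of i j]] lim[of j i] by (simp add: diffusion_sym[OF h(1), of i j])
  have "(\<lambda>n. \<Sum>i\<in>UNIV. \<Sum>j\<in>UNIV. \<xi> i * \<xi> j * diffusion i j (h n)) \<longlonglongrightarrow>
      (\<Sum>i\<in>UNIV. \<Sum>j\<in>UNIV. \<xi> i * \<xi> j * sval (\<nu> i j) F)"
    by (intro tendsto_sum tendsto_mult tendsto_const lim)
  thus "0 \<le> (\<Sum>i\<in>UNIV. \<Sum>j\<in>UNIV. \<xi> i * \<xi> j * sval (\<nu> i j) F)"
    by (rule LIMSEQ_le_const) (use diffusion_nonneg[OF h(1,2)] in blast)
qed

end

theorem theorem1p2:
  fixes U :: "(real^'n::finite) set"
    and m :: "(real^'n) measure"
    and T :: "real \<Rightarrow> (real^'n \<Rightarrow> real) \<Rightarrow> (real^'n \<Rightarrow> real)"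
    and A :: "(real^'n \<Rightarrow> real) \<Rightarrow> (real^'n \<Rightarrow> real)"
    and DA :: "(real^'n \<Rightarrow> real) set"
    and J :: "((real^'n) \<times> (real^'n)) measure"
    and K :: "(real^'n) measure"
    and \<delta> :: real
  assumes "open U"
    and "radon_on U m" and "full_support_on U m"
    and "sc_contraction_semigroup m T" and "is_generator m T A DA"
    and "dirichlet_operator m A DA"
    and "C0inf U \<subseteq> DA" and "C0inf U \<subseteq> adjoint_domain m A DA"
    and "jump_kill U (\<lambda>u v. - l2_inner m (A u) v) J K"
    and "\<delta> > 0" and "Udelta U \<delta> \<noteq> {}"
  shows "\<exists>(\<nu> :: 'n \<Rightarrow> 'n \<Rightarrow> (real^'n) measure \<times> (real^'n) measure)
           (\<nu>\<delta> :: 'n \<Rightarrow> (real^'n) measure \<times> (real^'n) measure).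
     (\<forall>i j. signed_radon_on U (\<nu> i j)) \<and>
     (\<forall>F. compact F \<and> F \<subseteq> U \<longrightarrow>
        (\<forall>i j. sval (\<nu> i j) F = sval (\<nu> j i) F) \<and>
        (\<forall>\<xi> :: 'n \<Rightarrow> real. (\<Sum>i\<in>UNIV. \<Sum>j\<in>UNIV. \<xi> i * \<xi> j * sval (\<nu> i j) F) \<ge> 0)) \<and>
     (\<forall>i. signed_radon_on (Udelta U \<delta>) (\<nu>\<delta> i)) \<and>
     (\<forall>u\<in>C0inf (Udelta U \<delta>). \<forall>v\<in>C0inf (Udelta U \<delta>).
        (\<forall>i j. sintegrable (\<nu> i j) (\<lambda>x. pd i u x * pd j v x)) \<and>
        (\<forall>i. sintegrable (\<nu>\<delta> i) (\<lambda>x. pd i u x * v x)) \<and>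
        integrable J (\<lambda>(x, y). (\<Sum>i\<in>UNIV. (y $ i - x $ i) * (pd i u y * v y - pd i u x * v x))
                                  * indicator {p. dist (fst p) (snd p) \<le> \<delta>} (x, y)) \<and>
        integrable J (\<lambda>(x, y). 2 * (u y - u x - (\<Sum>i\<in>UNIV. (y $ i - x $ i) * pd i u y
                                  * indicator {p. dist (fst p) (snd p) \<le> \<delta>} (x, y))) * v y) \<and>
        integrable K (\<lambda>x. u x * v x) \<and>
        - l2_inner m (A u) v =
          1/2 * (\<Sum>i\<in>UNIV. \<Sum>j\<in>UNIV. sint (\<nu> i j) (\<lambda>x. pd i u x * pd j v x))
          + (\<Sum>i\<in>UNIV. sint (\<nu>\<delta> i) (\<lambda>x. pd i u x * v x))
          + (\<integral>(x, y). (\<Sum>i\<in>UNIV. (y $ i - x $ i) * (pd i u y * v y - pd i u x * v x))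
                        * indicator {p. dist (fst p) (snd p) \<le> \<delta>} (x, y) \<partial>J)
          + (\<integral>(x, y). 2 * (u y - u x - (\<Sum>i\<in>UNIV. (y $ i - x $ i) * pd i u y
                        * indicator {p. dist (fst p) (snd p) \<le> \<delta>} (x, y))) * v y \<partial>J)
          + (\<integral>x. u x * v x \<partial>K))"
proof -
  interpret dirichlet_form_on m T A DA U J K
    using assms by unfold_locales
  obtain \<nu> where \<nu>: "\<And>i j. signed_radon_on U (\<nu> i j)"
    "\<And>i j w. w \<in> C0inf U \<Longrightarrow> sint (\<nu> i j) w = diffusion i j w"
    using diffusion_measures by metis
  obtain \<nu>\<delta> where \<nu>\<delta>: "\<And>i. signed_radon_on (Udelta U \<delta>) (\<nu>\<delta> i)"
    "\<And>i w. w \<in> C0inf (Udelta U \<delta>) \<Longrightarrow> sint (\<nu>\<delta> i) w = drift \<delta> i w"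
    using drift_measures[OF \<open>\<delta> > 0\<close>] by metis
  have Z: "(\<lambda>x. pd i u x * pd j v x) \<in> C0inf U"
    and w: "(\<lambda>x. pd i u x * v x) \<in> C0inf (Udelta U \<delta>)"
    if "u \<in> C0inf (Udelta U \<delta>)" "v \<in> C0inf (Udelta U \<delta>)" for i j u v
  proof -
    have "v \<in> C0inf U" using that C0inf_mono[OF Udelta_subset] by auto
    thus "(\<lambda>x. pd i u x * pd j v x) \<in> C0inf U" "(\<lambda>x. pd i u x * v x) \<in> C0inf (Udelta U \<delta>)"
      using that C0infD(1)[OF that(1)] by (auto intro: C0inf_mult_left C0inf_pd smooth_pd)
  qed
  show ?thesis
  proof (intro exI[of _ \<nu>] exI[of _ \<nu>\<delta>] conjI allI impI ballI)
    fix F assume "compact F \<and> F \<subseteq> U"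
    hence F: "compact F" "F \<subseteq> U" by auto
    show "sval (\<nu> i j) F = sval (\<nu> j i) F" for i j
      by (rule diffusion_measure_compact(1)[of \<nu>, OF \<nu> F])
    show "(\<Sum>i\<in>UNIV. \<Sum>j\<in>UNIV. \<xi> i * \<xi> j * sval (\<nu> i j) F) \<ge> 0" for \<xi>
      by (rule diffusion_measure_compact(2)[of \<nu>, OF \<nu> F])
  next
    fix u v assume uv: "u \<in> C0inf (Udelta U \<delta>)" "v \<in> C0inf (Udelta U \<delta>)"
    show "sintegrable (\<nu> i j) (\<lambda>x. pd i u x * pd j v x)" for i j
      using \<nu>(1)[of i j] Z[OF uv] by (auto simp: sintegrable_def signed_radon_on_def intro: radon_integrable)
    show "sintegrable (\<nu>\<delta> i) (\<lambda>x. pd i u x * v x)" for i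
      using \<nu>\<delta>(1)[of i] w[OF uv] by (auto simp: sintegrable_def signed_radon_on_def intro: radon_integrable)
  qed (simp_all only: \<nu>(1) \<nu>\<delta>(1) \<nu>(2)[OF Z] \<nu>\<delta>(2)[OF w] l2_inner_def split_def prod.collapse
      form_formula[OF \<open>\<delta> > 0\<close>])
qed

end
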